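(* Let $X$ be a time-frequency shifts invariant Banach space on $\mathbb R^d$ with polynomial weight $v$ and constant $C>0$, so that $\|\pi_z u\|_X\le C\,v(z)\|u\|_X$ for all $u\in X$, $z\in\mathbb R^{2d}$. Let $\gamma,g$ be measurable functions on $\mathbb R^d$ with $\gamma\in L^1(\mathbb R^d)$ and $\hat g\in L^1(\mathbb R^d)$, and let $L\in GL(2d)$ be such that $$\sigma_{L,g,\gamma}:=\sum_{\kappa\in\mathbb Z^{2d}}v(\mathcal J L^{-T}\kappa)\,|V_g\gamma(\mathcal J L^{-T}\kappa)|<+\infty.$$ Then the Gabor operator $S^L_{g,\gamma}$ extends to a bounded linear operator in $\mathcal L(X)$ and $$\|S^L_{g,\gamma}\|_{\mathcal L(X)}\le\frac{C}{|\det L|}\,\sigma_{L,g,\gamma}.$$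
   Context: $GL(2d)$ is the set of real invertible $2d\times 2d$ matrices, $L^{-T}=(L^{-1})^T$, and $\mathcal J=\begin{pmatrix}0&-I\\ I&0\end{pmatrix}$ with $d\times d$ blocks. $\hat f(\omega)=\int f(x)e^{-2\pi ix\cdot\omega}dx$ (extended to $\mathcal S'$). For $z=(x,\omega)\in\mathbb R^{2d}$, $T_xf(t)=f(t-x)$, $M_\omega f(t)=e^{2\pi i\omega\cdot t}f(t)$, $\pi_z f=M_\omega T_xf$. Short-time Fourier transform: $V_g\gamma(x,\omega)=\int_{\mathbb R^d}\gamma(t)e^{-2\pi i\omega\cdot t}\overline{g(t-x)}\,dt$. A polynomial weight is $v(z)=(1+|z|)^s$ for some $s\ge0$. A Banach space $X$ with $\mathcal S(\mathbb R^d)\hookrightarrow X\hookrightarrow\mathcal S'(\mathbb R^d)$ and $\mathcal S(\mathbb R^d)$ dense in $X$ is called time-frequency shifts invariant if for some polynomial weight $v$ and some constant $C>0$, $\|\pi_z u\|_X\le C v(z)\|u\|_X$ for all $u\in X$, $z\in\mathbb R^{2d}$. $\mathcal L(X)$ is the space of bounded linear operators on $X$. The Gabor operator is $S^L_{g,\gamma}u=\sum_{\kappa\in\mathbb Z^{2d}}(u,\pi_{-L\kappa}g)_{L^2}\,\pi_{-L\kappa}\gamma$ for $u\in\mathcal S(\mathbb R^d)$, where $(f,h)_{L^2}=\int f\bar h$; under $\gamma,\hat g\in L^1(\mathbb R^d)$ the series converges in $\mathcal S'(\mathbb R^d)$. *)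

theory Defs
  imports "HOL-Analysis.Analysis"
begin

section \<open>Schwartz functions and tempered distributions\<close>

text \<open>The phase space $\mathbb R^{2d}$ is \<open>real^('d + 'd)\<close>: the components \<open>Inl i\<close> form the
  position \<open>x\<close> and the components \<open>Inr i\<close> the frequency \<open>\<omega>\<close> of \<open>z = (x, \<omega>)\<close>.\<close>

type_synonym 'd cfun = "real^'d \<Rightarrow> complex"
type_synonym 'd functional = "'d cfun \<Rightarrow> complex"

primrec partials :: "'d::finite list \<Rightarrow> 'd cfun \<Rightarrow> 'd cfun" where
  "partials [] f = f"
| "partials (i # is) f = (\<lambda>x. frechet_derivative (partials is f) (at x) (axis i 1))"

text \<open>A multi-index is a list of coordinate directions, so every mixed partial derivative occurs,
  in every order; its order is the length of the list.\<close>

definition schwartz :: "'d::finite cfun \<Rightarrow> bool" where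
  "schwartz f \<longleftrightarrow>
     (\<forall>is x. partials is f differentiable (at x)) \<and>
     (\<forall>is N. bounded (range (\<lambda>x. (1 + norm x) ^ N *\<^sub>R partials is f x)))"

definition schwartz_norm :: "nat \<Rightarrow> 'd::finite cfun \<Rightarrow> real" where
  "schwartz_norm N f =
     (SUP (is, x) \<in> {is. length is \<le> N} \<times> UNIV. (1 + norm x) ^ N * cmod (partials is f x))"

text \<open>Functionals on the Schwartz space are represented by functions on all of \<open>'d cfun\<close> that
  vanish off the Schwartz space, so that equality of distributions is equality of functions.\<close>

definition tempered_dists :: "'d::finite functional set" where
  "tempered_dists =
     {u. (\<forall>\<phi>. \<not> schwartz \<phi> \<longrightarrow> u \<phi> = 0) \<and>
         (\<forall>\<phi> \<psi>. schwartz \<phi> \<longrightarrow> schwartz \<psi> \<longrightarrow> u (\<lambda>x. \<phi> x + \<psi> x) = u \<phi> + u \<psi>) \<and>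
         (\<forall>c \<phi>. schwartz \<phi> \<longrightarrow> u (\<lambda>x. c * \<phi> x) = c * u \<phi>) \<and>
         (\<exists>K N. \<forall>\<phi>. schwartz \<phi> \<longrightarrow> cmod (u \<phi>) \<le> K * schwartz_norm N \<phi>)}"

text \<open>The embedding of functions uses the bilinear pairing (no complex conjugation).\<close>

definition dist_of :: "'d::finite cfun \<Rightarrow> 'd functional" where
  "dist_of f = (\<lambda>\<phi>. if schwartz \<phi> then LINT x|lebesgue. f x * \<phi> x else 0)"

definition tempered_function :: "'d::finite cfun \<Rightarrow> bool" where
  "tempered_function f \<longleftrightarrow>
     f \<in> borel_measurable lebesgue \<and>
     (\<forall>\<phi>. schwartz \<phi> \<longrightarrow> integrable lebesgue (\<lambda>x. f x * \<phi> x)) \<and>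
     dist_of f \<in> tempered_dists"

section \<open>Fourier transform and time-frequency shifts\<close>

definition fourier :: "'d::finite cfun \<Rightarrow> 'd cfun" where
  "fourier f = (\<lambda>\<omega>. LINT x|lebesgue. f x * exp (- (2 * of_real pi * \<i> * of_real (x \<bullet> \<omega>))))"

definition fourier_dist :: "'d::finite functional \<Rightarrow> 'd functional" where
  "fourier_dist u = (\<lambda>\<phi>. if schwartz \<phi> then u (fourier \<phi>) else 0)"

text \<open>$\hat g \in L^1$, where $\hat g$ is the Fourier transform of \<open>g\<close> in the sense of tempered
  distributions; \<open>g\<close> itself need not be integrable.\<close>

definition fourier_in_L1 :: "'d::finite cfun \<Rightarrow> bool" where
  "fourier_in_L1 g \<longleftrightarrow>
     tempered_function g \<and>
     (\<exists>h. integrable lebesgue h \<and> fourier_dist (dist_of g) = dist_of h)"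

definition pos :: "real^('d + 'd) \<Rightarrow> real^'d::finite" where
  "pos z = (\<chi> i. z $ Inl i)"

definition freq :: "real^('d + 'd) \<Rightarrow> real^'d::finite" where
  "freq z = (\<chi> i. z $ Inr i)"

definition translation :: "real^'d \<Rightarrow> 'd::finite cfun \<Rightarrow> 'd cfun" where
  "translation x f = (\<lambda>t. f (t - x))"

definition modulation :: "real^'d \<Rightarrow> 'd::finite cfun \<Rightarrow> 'd cfun" where
  "modulation \<omega> f = (\<lambda>t. exp (2 * of_real pi * \<i> * of_real (\<omega> \<bullet> t)) * f t)"

definition tf_shift :: "real^('d + 'd) \<Rightarrow> 'd::finite cfun \<Rightarrow> 'd cfun" where
  "tf_shift z f = modulation (freq z) (translation (pos z) f)"

text \<open>For distributions, $\langle T_x u, \phi\rangle = \langle u, T_{-x}\phi\rangle$ and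
  $\langle M_\omega u, \phi\rangle = \langle u, M_\omega\phi\rangle$, the pairing being bilinear.\<close>

definition translation_dist :: "real^'d \<Rightarrow> 'd::finite functional \<Rightarrow> 'd functional" where
  "translation_dist x u = (\<lambda>\<phi>. u (translation (- x) \<phi>))"

definition modulation_dist :: "real^'d \<Rightarrow> 'd::finite functional \<Rightarrow> 'd functional" where
  "modulation_dist \<omega> u = (\<lambda>\<phi>. u (modulation \<omega> \<phi>))"

definition tf_shift_dist :: "real^('d + 'd) \<Rightarrow> 'd::finite functional \<Rightarrow> 'd functional" where
  "tf_shift_dist z u = modulation_dist (freq z) (translation_dist (pos z) u)"

text \<open>\<open>stft g f\<close> is $V_g f$.\<close>

definition stft :: "'d::finite cfun \<Rightarrow> 'd cfun \<Rightarrow> real^('d + 'd) \<Rightarrow> complex" where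
  "stft g f z =
     (LINT t|lebesgue. f t * exp (- (2 * of_real pi * \<i> * of_real (freq z \<bullet> t))) * cnj (g (t - pos z)))"

section \<open>Time-frequency shifts invariant Banach spaces\<close>

definition poly_weight :: "real \<Rightarrow> real^'n::finite \<Rightarrow> real" where
  "poly_weight s z = (1 + norm z) powr s"

text \<open>A complex Banach space continuously contained in $\mathcal S'$ is given by its carrier
  \<open>X\<close>, a set of tempered distributions with the pointwise operations, and its norm \<open>nrm\<close>, which
  only matters on \<open>X\<close>.\<close>

definition complex_banach_on :: "'d::finite functional set \<Rightarrow> ('d functional \<Rightarrow> real) \<Rightarrow> bool" where
  "complex_banach_on X nrm \<longleftrightarrow>
     (\<lambda>\<phi>. 0) \<in> X \<and>
     (\<forall>u\<in>X. \<forall>w\<in>X. (\<lambda>\<phi>. u \<phi> + w \<phi>) \<in> X) \<and>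
     (\<forall>c. \<forall>u\<in>X. (\<lambda>\<phi>. c * u \<phi>) \<in> X) \<and>
     (\<forall>u\<in>X. nrm u \<ge> 0 \<and> (nrm u = 0 \<longleftrightarrow> u = (\<lambda>\<phi>. 0))) \<and>
     (\<forall>c. \<forall>u\<in>X. nrm (\<lambda>\<phi>. c * u \<phi>) = cmod c * nrm u) \<and>
     (\<forall>u\<in>X. \<forall>w\<in>X. nrm (\<lambda>\<phi>. u \<phi> + w \<phi>) \<le> nrm u + nrm w) \<and>
     (\<forall>U. (\<forall>n::nat. U n \<in> X) \<and>
          (\<forall>e>0. \<exists>N. \<forall>m\<ge>N. \<forall>n\<ge>N. nrm (\<lambda>\<phi>. U m \<phi> - U n \<phi>) < e) \<longrightarrow>
          (\<exists>u\<in>X. (\<lambda>n. nrm (\<lambda>\<phi>. U n \<phi> - u \<phi>)) \<longlonglongrightarrow> 0))"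

text \<open>$\mathcal S'$ carries the weak-* topology.\<close>

definition banach_between :: "'d::finite functional set \<Rightarrow> ('d functional \<Rightarrow> real) \<Rightarrow> bool" where
  "banach_between X nrm \<longleftrightarrow>
     complex_banach_on X nrm \<and>
     X \<subseteq> tempered_dists \<and>
     (\<forall>\<phi>. schwartz \<phi> \<longrightarrow> (\<exists>K. \<forall>u\<in>X. cmod (u \<phi>) \<le> K * nrm u)) \<and>
     (\<forall>f. schwartz f \<longrightarrow> dist_of f \<in> X) \<and>
     (\<exists>K N. \<forall>f. schwartz f \<longrightarrow> nrm (dist_of f) \<le> K * schwartz_norm N f) \<and>
     (\<forall>u\<in>X. \<forall>e>0. \<exists>f. schwartz f \<and> nrm (\<lambda>\<phi>. u \<phi> - dist_of f \<phi>) < e)"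

definition tf_invariant ::
    "'d::finite functional set \<Rightarrow> ('d functional \<Rightarrow> real) \<Rightarrow> (real^('d + 'd) \<Rightarrow> real) \<Rightarrow> real \<Rightarrow> bool" where
  "tf_invariant X nrm v C \<longleftrightarrow>
     (\<forall>u\<in>X. \<forall>z. tf_shift_dist z u \<in> X \<and> nrm (tf_shift_dist z u) \<le> C * v z * nrm u)"

definition bounded_operators ::
    "'d::finite functional set \<Rightarrow> ('d functional \<Rightarrow> real) \<Rightarrow> ('d functional \<Rightarrow> 'd functional) set" where
  "bounded_operators X nrm =
     {A. (\<forall>u\<in>X. A u \<in> X) \<and>
         (\<forall>u\<in>X. \<forall>w\<in>X. A (\<lambda>\<phi>. u \<phi> + w \<phi>) = (\<lambda>\<phi>. A u \<phi> + A w \<phi>)) \<and>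
         (\<forall>c. \<forall>u\<in>X. A (\<lambda>\<phi>. c * u \<phi>) = (\<lambda>\<phi>. c * A u \<phi>)) \<and>
         (\<exists>K. \<forall>u\<in>X. nrm (A u) \<le> K * nrm u)}"

definition operator_norm ::
    "'d::finite functional set \<Rightarrow> ('d functional \<Rightarrow> real) \<Rightarrow> ('d functional \<Rightarrow> 'd functional) \<Rightarrow> real" where
  "operator_norm X nrm A = (SUP u \<in> {u \<in> X. nrm u \<le> 1}. nrm (A u))"

section \<open>Gabor operators\<close>

definition int_vec :: "int^'n \<Rightarrow> real^'n::finite" where
  "int_vec \<kappa> = (\<chi> i. of_int (\<kappa> $ i))"

definition symplectic_J :: "real^('d + 'd)^('d + 'd::finite)" where
  "symplectic_J = (\<chi> i j. case (i, j) of
       (Inl a, Inr b) \<Rightarrow> if a = b then - 1 else 0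
     | (Inr a, Inl b) \<Rightarrow> if a = b then 1 else 0
     | _ \<Rightarrow> 0)"

text \<open>The point $\mathcal J L^{-T}\kappa$.\<close>

definition adjoint_point :: "real^('d + 'd)^('d + 'd::finite) \<Rightarrow> int^('d + 'd) \<Rightarrow> real^('d + 'd)" where
  "adjoint_point L \<kappa> = (symplectic_J ** transpose (matrix_inv L)) *v int_vec \<kappa>"

definition L2_product :: "'d::finite cfun \<Rightarrow> 'd cfun \<Rightarrow> complex" where
  "L2_product f h = (LINT x|lebesgue. f x * cnj (h x))"

text \<open>\<open>gabor_sums L g \<gamma> u w\<close> states that the series defining $S^L_{g,\gamma}u$ converges
  (unconditionally, in the weak-* topology) to \<open>w\<close> in $\mathcal S'$. Such a \<open>w\<close> is unique. A relation
  is used because an \<open>infsum\<close> would silently be 0 in the absence of convergence.\<close>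

definition gabor_sums ::
    "real^('d + 'd)^('d + 'd) \<Rightarrow> 'd::finite cfun \<Rightarrow> 'd cfun \<Rightarrow> 'd cfun \<Rightarrow> 'd functional \<Rightarrow> bool" where
  "gabor_sums L g \<gamma> u w \<longleftrightarrow>
     w \<in> tempered_dists \<and>
     (\<forall>\<phi>. schwartz \<phi> \<longrightarrow>
        ((\<lambda>\<kappa>::int^('d + 'd).
            L2_product u (tf_shift (- (L *v int_vec \<kappa>)) g) *
            dist_of (tf_shift (- (L *v int_vec \<kappa>)) \<gamma>) \<phi>) has_sum w \<phi>) UNIV)"

end

theory Submission
  imports Defs
begin

text \<open>
  Put \<open>z\<^sub>\<kappa> = \<J> L\<^sup>-\<^sup>T \<kappa>\<close>. The theorem rests on the Janssen representation of the Gabor operator,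
  \<open>S u = \<bar>det L\<bar>\<^sup>-\<^sup>1 \<Sum>\<^sub>\<kappa> V\<^sub>g\<gamma>(z\<^sub>\<kappa>) \<pi>\<^bsub>z\<^sub>\<kappa>\<^esub> u\<close> for Schwartz functions \<open>u\<close>. Its right-hand side makes sense for
  every \<open>u \<in> X\<close>: the norm of the term at \<open>\<kappa>\<close> is at most \<open>C \<bar>det L\<bar>\<^sup>-\<^sup>1 v(z\<^sub>\<kappa>) \<bar>V\<^sub>g\<gamma>(z\<^sub>\<kappa>)\<bar>\<close> times the norm of \<open>u\<close>,
  so that the series converges absolutely in \<open>X\<close>, and summing these bounds gives the bound on the operator
  norm. Since \<open>X\<close> embeds continuously into the tempered distributions, the sum in \<open>X\<close> is also the sum
  in the sense of distributions (\<open>absolutely_convergent_series\<close>).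

  The Janssen representation, tested against a Schwartz function \<open>\<phi>\<close> (\<open>janssen_representation\<close>), is the Poisson
  summation formula over the lattice \<open>L \<int>\<^sup>2\<^sup>d\<close> for the function \<open>F(z) = (u, \<pi>\<^sub>z g) \<langle>\<pi>\<^sub>z \<gamma>, \<phi>\<rangle>\<close> on phase space.
  Continuity and integrability of \<open>F\<close> alone would not justify that formula, and \<open>F\<close> has no rate of decay,
  as \<open>g\<close> and \<open>\<gamma>\<close> have none. What helps is that \<open>g\<close> is a superposition of characters with an
  integrable density, the Fourier transform of \<open>g\<close> (\<open>fourier_in_L1_representation\<close>), while \<open>\<gamma>\<close> is a
  superposition of point masses with an integrable density, \<open>\<gamma>\<close> itself. Hence \<open>F\<close> is an integral
  \<open>\<integral> k(p) R(z + p) dp\<close> of translates of one continuous, rapidly decaying function \<open>R\<close>, with an integrable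
  kernel \<open>k\<close> (\<open>gabor_term_eq_convolution\<close>). The sums of \<open>\<bar>R\<bar>\<close> over the translates of a lattice are uniformly
  bounded (\<open>lattice_decay_sum_bounded\<close>), which gives the domination that Poisson summation needs
  (\<open>poisson_summation_convolution\<close>). The Fourier transform of \<open>F\<close> is the product of that of \<open>k\<close>, which is
  \<open>V\<^sub>g\<gamma>\<close> (\<open>gabor_kernel_fourier\<close>), and that of \<open>R\<close>, which is \<open>\<langle>\<pi>\<^sub>z u, \<phi>\<rangle>\<close>
  (\<open>integral_rihaczek_character\<close>); the matrix \<open>\<J>\<close> enters here. The Fourier coefficients are
  summable because \<open>v \<ge> 1\<close> and \<open>\<sigma>\<close> is finite.

  The Poisson summation formula itself compares the periodization of a function with its Fourier series: both are
  continuous on the unit cube and have the same Fourier coefficients, and a continuous function all of whose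
  coefficients vanish is zero at the centre of the cube (\<open>fourier_coefficients_zero_imp_zero\<close>). Fourier inversion for Schwartz functions
  follows by letting the lattice \<open>R \<int>\<^sup>d\<close> become sparse (\<open>fourier_inversion\<close>).
\<close>

section \<open>The Schwartz class\<close>

definition partial_deriv :: "'d::finite \<Rightarrow> 'd cfun \<Rightarrow> 'd cfun" where
  "partial_deriv i f = (\<lambda>x. frechet_derivative f (at x) (axis i 1))"

definition rapidly_decaying :: "'d::finite cfun \<Rightarrow> bool" where
  "rapidly_decaying f \<longleftrightarrow> (\<forall>N. \<exists>c. \<forall>x. (1 + norm x) ^ N * cmod (f x) \<le> c)"

lemma rapidly_decaying_iff_bounded:
  "rapidly_decaying f \<longleftrightarrow> (\<forall>N. bounded (range (\<lambda>x. (1 + norm x) ^ N *\<^sub>R f x)))"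
  unfolding rapidly_decaying_def bounded_iff
  by (simp add: add_nonneg_nonneg abs_of_nonneg zero_le_power)

lemma partials_Cons_partial_deriv: "partials (i # is) f = partial_deriv i (partials is f)"
  by (simp add: partial_deriv_def)

lemma partials_append: "partials (is @ js) f = partials is (partials js f)"
  by (induction "is") auto

lemma partial_deriv_eqI:
  assumes "\<And>x. (f has_derivative f' x) (at x)"
  shows "partial_deriv i f = (\<lambda>x. f' x (axis i 1))"
  unfolding partial_deriv_def using frechet_derivative_at[OF assms] by metis

text \<open>The Schwartz class is the largest class of differentiable, rapidly decaying functions that is closed under
  partial derivatives. Its closure properties therefore need no formula for iterated derivatives: it suffices to
  exhibit one such class that contains the given function.\<close>

lemma schwartz_coinduct:
  assumes "f \<in> K"
    and diff: "\<And>f x. f \<in> K \<Longrightarrow> f differentiable (at x)"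
    and decay: "\<And>f. f \<in> K \<Longrightarrow> rapidly_decaying f"
    and closed: "\<And>f i. f \<in> K \<Longrightarrow> partial_deriv i f \<in> K"
  shows "schwartz f"
proof -
  have "partials is f \<in> K" for "is"
    by (induction "is") (use assms(1) closed in \<open>auto simp: partials_Cons_partial_deriv simp del: partials.simps(2)\<close>)
  then show ?thesis
    unfolding schwartz_def using diff decay rapidly_decaying_iff_bounded by blast
qed

lemma schwartz_differentiable: "schwartz f \<Longrightarrow> f differentiable (at x)"
  unfolding schwartz_def by (metis partials.simps(1))

lemma schwartz_rapidly_decaying: "schwartz f \<Longrightarrow> rapidly_decaying f"
  unfolding schwartz_def rapidly_decaying_iff_bounded by (metis partials.simps(1))

lemma schwartz_partial_deriv:
  assumes "schwartz f" shows "schwartz (partial_deriv i f)"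
proof -
  have "partials is (partial_deriv i f) = partials (is @ [i]) f" for "is"
    by (simp add: partials_append partial_deriv_def)
  with assms show ?thesis unfolding schwartz_def by metis
qed

lemma schwartz_has_derivative:
  "schwartz f \<Longrightarrow> (f has_derivative frechet_derivative f (at x)) (at x)"
  using schwartz_differentiable frechet_derivative_works by blast

lemma schwartz_continuous_on: "schwartz f \<Longrightarrow> continuous_on A f"
  using schwartz_differentiable differentiable_imp_continuous_within
  by (meson continuous_at_imp_continuous_on)

lemma schwartz_borel: "schwartz f \<Longrightarrow> f \<in> borel_measurable borel"
  by (rule borel_measurable_continuous_onI) (rule schwartz_continuous_on)

lemma rapidly_decaying_cmult:
  assumes "rapidly_decaying f" shows "rapidly_decaying (\<lambda>x. c * f x)"
  unfolding rapidly_decaying_def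
proof
  fix N
  obtain b where b: "\<forall>x. (1 + norm x) ^ N * cmod (f x) \<le> b"
    using assms unfolding rapidly_decaying_def by blast
  have "(1 + norm x) ^ N * cmod (c * f x) \<le> cmod c * b" for x
    using mult_left_mono[OF b[rule_format, of x], of "cmod c"] by (simp add: norm_mult mult_ac)
  then show "\<exists>c'. \<forall>x. (1 + norm x) ^ N * cmod (c * f x) \<le> c'" by blast
qed

lemma rapidly_decaying_add:
  assumes "rapidly_decaying f" "rapidly_decaying g" shows "rapidly_decaying (\<lambda>x. f x + g x)"
  unfolding rapidly_decaying_def
proof
  fix N
  obtain a where a: "\<forall>x. (1 + norm x) ^ N * cmod (f x) \<le> a"
    using assms unfolding rapidly_decaying_def by blast
  obtain b where b: "\<forall>x. (1 + norm x) ^ N * cmod (g x) \<le> b"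
    using assms unfolding rapidly_decaying_def by blast
  have "(1 + norm x) ^ N * cmod (f x + g x) \<le> a + b" for x
  proof -
    have "(1 + norm x) ^ N * cmod (f x + g x) \<le> (1 + norm x) ^ N * (cmod (f x) + cmod (g x))"
      by (intro mult_left_mono norm_triangle_ineq) auto
    then show ?thesis using a[rule_format, of x] b[rule_format, of x] by (simp add: distrib_left)
  qed
  then show "\<exists>c'. \<forall>x. (1 + norm x) ^ N * cmod (f x + g x) \<le> c'" by blast
qed

text \<open>A factor of modulus at most \<open>(1 + \<bar>x\<bar>)\<^sup>k\<close> costs only a shift of the exponent; this covers
  coordinates (\<open>k = 1\<close>) and characters (\<open>k = 0\<close>).\<close>

lemma rapidly_decaying_mult:
  assumes f: "rapidly_decaying f" and a: "\<And>x. cmod (a x) \<le> (1 + norm x) ^ k"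
  shows "rapidly_decaying (\<lambda>x. a x * f x)"
  unfolding rapidly_decaying_def
proof
  fix N
  obtain b where b: "\<forall>x. (1 + norm x) ^ (N + k) * cmod (f x) \<le> b"
    using f unfolding rapidly_decaying_def by blast
  have "(1 + norm x) ^ N * cmod (a x * f x) \<le> b" for x
  proof -
    have "(1 + norm x) ^ N * (cmod (a x) * cmod (f x)) \<le> (1 + norm x) ^ N * ((1 + norm x) ^ k * cmod (f x))"
      by (intro mult_left_mono mult_right_mono a) auto
    also have "\<dots> \<le> b" using b[rule_format, of x] by (simp add: power_add mult_ac)
    finally show ?thesis by (simp add: norm_mult)
  qed
  then show "\<exists>c'. \<forall>x. (1 + norm x) ^ N * cmod (a x * f x) \<le> c'" by blast
qed

lemma one_plus_norm_add_le:
  "1 + norm (x + y :: 'a::real_normed_vector) \<le> (1 + norm x) * (1 + norm y)"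
proof -
  have "0 \<le> norm x * norm y" by simp
  then show ?thesis using norm_triangle_ineq[of x y]
    unfolding distrib_left distrib_right mult_1_left mult_1_right by linarith
qed

lemma rapidly_decaying_translation:
  assumes "rapidly_decaying f" shows "rapidly_decaying (translation y f)"
  unfolding rapidly_decaying_def
proof
  fix N
  obtain b where b: "\<forall>x. (1 + norm x) ^ N * cmod (f x) \<le> b"
    using assms unfolding rapidly_decaying_def by blast
  have "(1 + norm x) ^ N * cmod (translation y f x) \<le> (1 + norm y) ^ N * b" for x
  proof -
    have "(1 + norm x) ^ N \<le> ((1 + norm y) * (1 + norm (x - y))) ^ N"
      using one_plus_norm_add_le[of y "x - y"] by (intro power_mono) auto
    then have "(1 + norm x) ^ N * cmod (f (x - y))
        \<le> ((1 + norm y) ^ N * (1 + norm (x - y)) ^ N) * cmod (f (x - y))"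
      by (intro mult_right_mono) (auto simp: power_mult_distrib)
    also have "\<dots> \<le> (1 + norm y) ^ N * b"
      using b[rule_format, of "x - y"] by (simp add: mult.assoc mult_left_mono)
    finally show ?thesis by (simp add: translation_def)
  qed
  then show "\<exists>c'. \<forall>x. (1 + norm x) ^ N * cmod (translation y f x) \<le> c'" by blast
qed

lemma rapidly_decaying_reflect:
  assumes "rapidly_decaying f" shows "rapidly_decaying (\<lambda>x. f (- x))"
  using assms unfolding rapidly_decaying_def by (metis norm_minus_cancel)

text \<open>The classes needed below are families of explicit form, such as the translates of Schwartz functions, for which a
  partial derivative amounts to a change of the parameter.\<close>

lemma schwartz_family:
  fixes F :: "'p \<Rightarrow> 'd::finite cfun"
  assumes "Q p"
    and der: "\<And>p x. Q p \<Longrightarrow> (F p has_derivative D p x) (at x)"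
    and decay: "\<And>p. Q p \<Longrightarrow> rapidly_decaying (F p)"
    and closed: "\<And>p i. Q p \<Longrightarrow> \<exists>p'. Q p' \<and> (\<forall>x. D p x (axis i 1) = F p' x)"
  shows "schwartz (F p)"
proof (rule schwartz_coinduct[where K="F ` Collect Q"])
  fix h i assume "h \<in> F ` Collect Q"
  then obtain p where p: "Q p" "h = F p" by auto
  then have "partial_deriv i h = (\<lambda>x. D p x (axis i 1))" using partial_deriv_eqI[OF der] by blast
  moreover obtain p' where "Q p'" "\<forall>x. D p x (axis i 1) = F p' x" using closed[OF p(1)] by blast
  ultimately show "partial_deriv i h \<in> F ` Collect Q" by auto
next
  fix h x assume "h \<in> F ` Collect Q"
  then show "h differentiable (at x)" using der differentiableI by blast
qed (use assms(1) decay in auto)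

lemma schwartz_cmult:
  assumes "schwartz f" shows "schwartz (\<lambda>x. c * f x)"
proof (rule schwartz_family[where F="\<lambda>f x. c * f x" and Q=schwartz
    and D="\<lambda>f x h. c * frechet_derivative f (at x) h"])
  fix f :: "'a cfun" and x assume f: "schwartz f"
  show "((\<lambda>x. c * f x) has_derivative (\<lambda>h. c * frechet_derivative f (at x) h)) (at x)"
    by (intro has_derivative_mult_right schwartz_has_derivative f)
next
  fix f :: "'a cfun" and i assume f: "schwartz f"
  then show "\<exists>f'. schwartz f' \<and> (\<forall>x. c * frechet_derivative f (at x) (axis i 1) = c * f' x)"
    using schwartz_partial_deriv[OF f, of i] unfolding partial_deriv_def by blast
qed (use assms in \<open>auto intro: rapidly_decaying_cmult schwartz_rapidly_decaying\<close>)

lemma schwartz_add: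
  assumes "schwartz f" "schwartz g" shows "schwartz (\<lambda>x. f x + g x)"
proof -
  have "schwartz ((\<lambda>p x. fst p x + snd p x) (f, g))"
  proof (rule schwartz_family[where Q="\<lambda>p. schwartz (fst p) \<and> schwartz (snd p)"
    and D="\<lambda>p x h. frechet_derivative (fst p) (at x) h + frechet_derivative (snd p) (at x) h"])
    fix p :: "'a cfun \<times> 'a cfun" and x assume p: "schwartz (fst p) \<and> schwartz (snd p)"
    then show "((\<lambda>x. fst p x + snd p x) has_derivative
        (\<lambda>h. frechet_derivative (fst p) (at x) h + frechet_derivative (snd p) (at x) h)) (at x)"
      by (intro has_derivative_add schwartz_has_derivative) auto
  next
    fix p :: "'a cfun \<times> 'a cfun" and i assume p: "schwartz (fst p) \<and> schwartz (snd p)"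
    then show "\<exists>p'. (schwartz (fst p') \<and> schwartz (snd p')) \<and>
        (\<forall>x. frechet_derivative (fst p) (at x) (axis i 1) + frechet_derivative (snd p) (at x) (axis i 1)
           = fst p' x + snd p' x)"
      by (intro exI[of _ "(partial_deriv i (fst p), partial_deriv i (snd p))"])
         (auto simp: schwartz_partial_deriv, simp add: partial_deriv_def)
  qed (use assms in \<open>auto intro: rapidly_decaying_add schwartz_rapidly_decaying\<close>)
  then show ?thesis by simp
qed

lemma has_derivative_coord: "((\<lambda>x::real^'d::finite. of_real (x $ j) :: complex) has_derivative (\<lambda>h. of_real (h $ j))) (at x)"
  by (intro has_derivative_of_real bounded_linear_imp_has_derivative bounded_linear_vec_nth)

lemma rapidly_decaying_coord:
  "rapidly_decaying f \<Longrightarrow> rapidly_decaying (\<lambda>x. of_real (x $ j) * f x)"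
proof (rule rapidly_decaying_mult[where k=1])
  fix x :: "real^'a"
  show "cmod (of_real (x $ j)) \<le> (1 + norm x) ^ 1"
    using component_le_norm_cart[of x j] by (auto simp: intro: order_trans[of _ "norm x"])
qed auto

text \<open>The functions \<open>x\<^sub>j f(x)\<close> alone are not closed under partial derivatives, as the product rule also produces
  \<open>f\<close>; the functions \<open>f\<^sub>1(x) + x\<^sub>j f\<^sub>2(x)\<close> are.\<close>

lemma schwartz_mult_coord:
  assumes "schwartz f" shows "schwartz (\<lambda>x. of_real (x $ j) * f x)"
proof -
  let ?F = "\<lambda>p x. fst p x + of_real (x $ j) * snd p x"
  \<comment> \<open>The zero function is written as a multiple of \<open>f\<close>, which makes it an instance of \<open>schwartz_cmult\<close>.\<close>
  have "schwartz (?F (\<lambda>x. 0 * f x, f))"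
  proof (rule schwartz_family[where Q="\<lambda>p. schwartz (fst p) \<and> schwartz (snd p)"
    and D="\<lambda>p x h. frechet_derivative (fst p) (at x) h +
      (of_real (x $ j) * frechet_derivative (snd p) (at x) h + of_real (h $ j) * snd p x)"])
    show "schwartz (fst (\<lambda>x. 0 * f x, f)) \<and> schwartz (snd (\<lambda>x. 0 * f x, f))"
      unfolding fst_conv snd_conv using assms schwartz_cmult by blast
  next
    fix p :: "'a cfun \<times> 'a cfun" and x assume p: "schwartz (fst p) \<and> schwartz (snd p)"
    then show "(?F p has_derivative (\<lambda>h. frechet_derivative (fst p) (at x) h +
      (of_real (x $ j) * frechet_derivative (snd p) (at x) h + of_real (h $ j) * snd p x))) (at x)"
      by (intro has_derivative_add has_derivative_mult has_derivative_coord schwartz_has_derivative) auto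
  next
    fix p :: "'a cfun \<times> 'a cfun" and i assume p: "schwartz (fst p) \<and> schwartz (snd p)"
    have "schwartz (\<lambda>x. partial_deriv i (fst p) x + of_real (axis i 1 $ j) * snd p x)"
      by (intro schwartz_add schwartz_cmult schwartz_partial_deriv) (use p in auto)
    moreover have "schwartz (partial_deriv i (snd p))" using p schwartz_partial_deriv by blast
    ultimately show "\<exists>p'. (schwartz (fst p') \<and> schwartz (snd p')) \<and> (\<forall>x. frechet_derivative (fst p) (at x) (axis i 1) +
      (of_real (x $ j) * frechet_derivative (snd p) (at x) (axis i 1) + of_real (axis i 1 $ j) * snd p x) = ?F p' x)"
      by (intro exI[of _ "(\<lambda>x. partial_deriv i (fst p) x + of_real (axis i 1 $ j) * snd p x, partial_deriv i (snd p))"])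
         (auto simp: partial_deriv_def)
  next
    fix p :: "'a cfun \<times> 'a cfun" assume p: "schwartz (fst p) \<and> schwartz (snd p)"
    show "rapidly_decaying (?F p)"
      by (intro rapidly_decaying_add rapidly_decaying_coord schwartz_rapidly_decaying) (use p in auto)
  qed
  then show ?thesis by simp
qed

lemma schwartz_translation:
  assumes "schwartz f" shows "schwartz (translation y f)"
proof (rule schwartz_family[where F="translation y" and Q=schwartz
    and D="\<lambda>f x h. frechet_derivative f (at (x - y)) h"])
  fix f :: "'a cfun" and x assume f: "schwartz f"
  show "(translation y f has_derivative (\<lambda>h. frechet_derivative f (at (x - y)) h)) (at x)"
    unfolding translation_def
    by (rule has_derivative_compose[of "\<lambda>t. t - y" "\<lambda>h. h" x UNIV f])
       (auto intro!: derivative_eq_intros schwartz_has_derivative f)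
next
  fix f :: "'a cfun" and i assume f: "schwartz f"
  then show "\<exists>f'. schwartz f' \<and> (\<forall>x. frechet_derivative f (at (x - y)) (axis i 1) = translation y f' x)"
    by (intro exI[of _ "partial_deriv i f"]) (auto simp: partial_deriv_def translation_def
        intro: schwartz_partial_deriv[unfolded partial_deriv_def])
qed (use assms in \<open>auto intro: rapidly_decaying_translation schwartz_rapidly_decaying\<close>)

lemma schwartz_reflect:
  assumes "schwartz f" shows "schwartz (\<lambda>x. f (- x))"
proof (rule schwartz_family[where F="\<lambda>f x. f (- x)" and Q=schwartz
    and D="\<lambda>f x h. frechet_derivative f (at (- x)) (- h)"])
  fix f :: "'a cfun" and x assume f: "schwartz f"
  show "((\<lambda>x. f (- x)) has_derivative (\<lambda>h. frechet_derivative f (at (- x)) (- h))) (at x)"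
    by (rule has_derivative_compose[of uminus "\<lambda>h. - h" x UNIV f])
       (auto intro!: derivative_eq_intros schwartz_has_derivative f)
next
  fix f :: "'a cfun" and i assume f: "schwartz f"
  have "frechet_derivative f (at (- x)) (- axis i 1) = - 1 * partial_deriv i f (- x)" for x
    using has_derivative_linear[OF schwartz_has_derivative[OF f]] by (simp add: linear_neg partial_deriv_def)
  then show "\<exists>f'. schwartz f' \<and> (\<forall>x. frechet_derivative f (at (- x)) (- axis i 1) = f' (- x))"
    by (intro exI[of _ "\<lambda>x. - 1 * partial_deriv i f x"] conjI schwartz_cmult schwartz_partial_deriv f) simp
qed (use assms in \<open>auto intro: rapidly_decaying_reflect schwartz_rapidly_decaying\<close>)

subsection \<open>Characters\<close>

definition ch :: "real \<Rightarrow> complex" where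
  "ch t = exp (2 * of_real pi * \<i> * of_real t)"

lemma ch_add: "ch (s + t) = ch s * ch t"
  by (simp add: ch_def distrib_left exp_add)

lemma ch_0 [simp]: "ch 0 = 1"
  by (simp add: ch_def)

lemma norm_ch [simp]: "cmod (ch t) = 1"
  by (simp add: ch_def norm_exp_eq_Re)

lemma ch_minus: "ch (- t) = cnj (ch t)"
  by (simp add: ch_def exp_cnj)

lemma ch_of_int [simp]: "ch (of_int k) = 1"
  unfolding ch_def using exp_eq_1[of "2 * of_real pi * \<i> * of_real (of_int k)"] by auto

lemma continuous_on_ch [continuous_intros]:
  fixes f :: "'a::topological_space \<Rightarrow> real"
  shows "continuous_on A f \<Longrightarrow> continuous_on A (\<lambda>x. ch (f x))"
  unfolding ch_def by (intro continuous_intros)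

lemma borel_measurable_ch [measurable]: "ch \<in> borel_measurable borel"
  by (intro borel_measurable_continuous_onI continuous_intros)

lemma has_derivative_cexp:
  fixes g :: "'a::real_normed_vector \<Rightarrow> complex"
  assumes "(g has_derivative g') (at x)"
  shows "((\<lambda>x. exp (g x)) has_derivative (\<lambda>h. g' h * exp (g x))) (at x)"
  using has_derivative_compose[OF assms DERIV_exp[of "g x", unfolded has_field_derivative_def]]
  by (simp add: mult.commute)

lemma has_derivative_ch_inner:
  "((\<lambda>x::real^'d::finite. ch (w \<bullet> x)) has_derivative
     (\<lambda>h. 2 * of_real pi * \<i> * of_real (w \<bullet> h) * ch (w \<bullet> x))) (at x)"
proof -
  have "((\<lambda>x. 2 * of_real pi * \<i> * of_real (w \<bullet> x)) has_derivative
      (\<lambda>h. 2 * of_real pi * \<i> * of_real (w \<bullet> h))) (at x)"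
    by (intro has_derivative_mult_right has_derivative_of_real has_derivative_inner_right has_derivative_ident)
  from has_derivative_cexp[OF this] show ?thesis unfolding ch_def .
qed

lemma modulation_ch: "modulation w f = (\<lambda>t. ch (w \<bullet> t) * f t)"
  by (simp add: modulation_def ch_def)

lemma fourier_ch: "fourier f = (\<lambda>w. LINT x|lebesgue. f x * ch (- (x \<bullet> w)))"
  by (simp add: fourier_def ch_def)

lemma schwartz_modulation:
  assumes "schwartz f" shows "schwartz (modulation w f)"
proof (rule schwartz_family[where F="modulation w" and Q=schwartz
    and D="\<lambda>f x h. ch (w \<bullet> x) * frechet_derivative f (at x) h +
      2 * of_real pi * \<i> * of_real (w \<bullet> h) * ch (w \<bullet> x) * f x"])
  fix f :: "'a cfun" and x assume f: "schwartz f"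
  show "(modulation w f has_derivative (\<lambda>h. ch (w \<bullet> x) * frechet_derivative f (at x) h +
      2 * of_real pi * \<i> * of_real (w \<bullet> h) * ch (w \<bullet> x) * f x)) (at x)"
    unfolding modulation_ch
    by (intro has_derivative_mult has_derivative_ch_inner schwartz_has_derivative f)
next
  fix f :: "'a cfun" and i assume f: "schwartz f"
  show "\<exists>f'. schwartz f' \<and> (\<forall>x. ch (w \<bullet> x) * frechet_derivative f (at x) (axis i 1) +
      2 * of_real pi * \<i> * of_real (w \<bullet> axis i 1) * ch (w \<bullet> x) * f x = modulation w f' x)"
  proof (intro exI conjI)
    show "schwartz (\<lambda>x. partial_deriv i f x + 2 * of_real pi * \<i> * of_real (w \<bullet> axis i 1) * f x)"
      by (intro schwartz_add schwartz_cmult schwartz_partial_deriv f)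
  qed (simp add: modulation_ch partial_deriv_def distrib_left)
next
  fix f :: "'a cfun" assume "schwartz f"
  then show "rapidly_decaying (modulation w f)"
    unfolding modulation_ch by (intro rapidly_decaying_mult[where k=0] schwartz_rapidly_decaying) auto
qed (rule assms)

subsection \<open>Gaussians\<close>

text \<open>The products of polynomials with one fixed Gaussian form the closed class that contains the Gaussian.\<close>

inductive_set gauss_poly :: "real \<Rightarrow> 'd::finite cfun set" for a where
  base: "(\<lambda>x. exp (of_real (- a * (x \<bullet> x)))) \<in> gauss_poly a"
| add: "f \<in> gauss_poly a \<Longrightarrow> g \<in> gauss_poly a \<Longrightarrow> (\<lambda>x. f x + g x) \<in> gauss_poly a"
| cmult: "f \<in> gauss_poly a \<Longrightarrow> (\<lambda>x. c * f x) \<in> gauss_poly a"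
| coord: "f \<in> gauss_poly a \<Longrightarrow> (\<lambda>x. of_real (x $ j) * f x) \<in> gauss_poly a"

lemma rapidly_decaying_gaussian:
  assumes "a > 0" shows "rapidly_decaying (\<lambda>x::real^'d::finite. exp (of_real (- a * (x \<bullet> x))))"
  unfolding rapidly_decaying_def
proof
  fix N
  \<comment> \<open>\<open>exp t\<close> dominates \<open>t\<^sup>N / N!\<close>; this is used with \<open>t = a (1 + r\<^sup>2)\<close>, since \<open>1 + r \<le> 2 (1 + r\<^sup>2)\<close>.\<close>
  have "(1 + norm x) ^ N * cmod (exp (of_real (- a * (x \<bullet> x)))) \<le> exp a * (fact N * (2 / a) ^ N)" for x :: "real^'d"
  proof -
    let ?r = "norm x"
    have "(1 + ?r) ^ N \<le> (2 * (1 + ?r\<^sup>2)) ^ N"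
    proof (rule power_mono)
      have "0 \<le> (?r - 1)\<^sup>2 + ?r\<^sup>2 + ?r" by simp
      then show "1 + ?r \<le> 2 * (1 + ?r\<^sup>2)" by (simp add: power2_diff)
    qed simp
    also have "\<dots> = (2 / a) ^ N * (a * (1 + ?r\<^sup>2)) ^ N" using assms by (simp flip: power_mult_distrib)
    also have "(a * (1 + ?r\<^sup>2)) ^ N \<le> fact N * exp (a * (1 + ?r\<^sup>2))"
    proof -
      have "(a * (1 + ?r\<^sup>2)) ^ N /\<^sub>R fact N \<le> exp (a * (1 + ?r\<^sup>2))"
        using sum_le_suminf[OF summable_exp_generic, of "{N}" "a * (1 + ?r\<^sup>2)"] assms
        by (simp add: exp_def)
      then show ?thesis by (simp add: field_simps)
    qed
    finally have "(1 + ?r) ^ N \<le> (2 / a) ^ N * (fact N * exp (a * (1 + ?r\<^sup>2)))"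
      using assms by (simp add: mult_left_mono)
    then have "(1 + ?r) ^ N * exp (- a * ?r\<^sup>2) \<le> (2 / a) ^ N * (fact N * exp (a * (1 + ?r\<^sup>2))) * exp (- a * ?r\<^sup>2)"
      by (rule mult_right_mono) simp
    also have "\<dots> = exp a * (fact N * (2 / a) ^ N)"
      by (simp add: mult_ac flip: exp_add) (simp add: algebra_simps)
    finally show ?thesis by (simp add: dot_square_norm norm_exp_eq_Re)
  qed
  then show "\<exists>c. \<forall>x::real^'d. (1 + norm x) ^ N * cmod (exp (of_real (- a * (x \<bullet> x)))) \<le> c"
    by blast
qed

lemma gauss_poly_derivative:
  fixes f :: "'d::finite cfun"
  assumes "f \<in> gauss_poly a"
  shows "(\<forall>x. f differentiable (at x)) \<and> (\<forall>i. partial_deriv i f \<in> gauss_poly a)"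
  using assms
proof induction
  case base
  have der: "((\<lambda>x::real^'d. exp (of_real (- a * (x \<bullet> x))) :: complex) has_derivative
      (\<lambda>h. of_real (- 2 * a * (x \<bullet> h)) * exp (of_real (- a * (x \<bullet> x))))) (at x)" for x
  proof -
    have "((\<lambda>x::real^'d. of_real (- a * (x \<bullet> x)) :: complex) has_derivative
        (\<lambda>h. of_real (- a * (x \<bullet> h + h \<bullet> x)))) (at x)"
      by (intro has_derivative_of_real has_derivative_mult_right has_derivative_inner has_derivative_ident)
    from has_derivative_cexp[OF this] show ?thesis by (simp add: inner_commute mult_ac)
  qed
  have "partial_deriv i (\<lambda>x::real^'d. exp (of_real (- a * (x \<bullet> x))))
      = (\<lambda>x. of_real (- 2 * a) * (of_real (x $ i) * exp (of_real (- a * (x \<bullet> x)))))" for i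
    unfolding partial_deriv_eqI[OF der] by (simp add: inner_axis mult_ac)
  moreover have "(\<lambda>x::real^'d. of_real (- 2 * a) * (of_real (x $ i) * exp (of_real (- a * (x \<bullet> x))))) \<in> gauss_poly a" for i
    by (intro gauss_poly.intros)
  ultimately show ?case using differentiableI[OF der] by auto
next
  case (add f g)
  have "partial_deriv i (\<lambda>x. f x + g x) = (\<lambda>x. partial_deriv i f x + partial_deriv i g x)" for i
    unfolding partial_deriv_def[of i f] partial_deriv_def[of i g]
    by (rule partial_deriv_eqI) (use add in \<open>intro has_derivative_add; simp add: frechet_derivative_works[symmetric]\<close>)
  then show ?case using add gauss_poly.add[of "partial_deriv _ f" a "partial_deriv _ g"] by (auto intro!: differentiable_add)
next
  case (cmult f c)
  have "partial_deriv i (\<lambda>x. c * f x) = (\<lambda>x. c * partial_deriv i f x)" for i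
    unfolding partial_deriv_def[of i f]
    by (rule partial_deriv_eqI) (use cmult in \<open>intro has_derivative_mult_right; simp add: frechet_derivative_works[symmetric]\<close>)
  then show ?case using cmult gauss_poly.cmult[of "partial_deriv _ f" a c] by (auto intro!: differentiable_mult)
next
  case (coord f j)
  have "partial_deriv i (\<lambda>x. of_real (x $ j) * f x) =
     (\<lambda>x. of_real (x $ j) * partial_deriv i f x + of_real (axis i 1 $ j) * f x)" for i
    unfolding partial_deriv_def[of i f]
    by (rule partial_deriv_eqI) (intro has_derivative_mult has_derivative_coord,
        use coord in \<open>simp add: frechet_derivative_works[symmetric]\<close>)
  moreover have "(\<lambda>x. of_real (x $ j) * partial_deriv i f x + of_real (axis i 1 $ j) * f x) \<in> gauss_poly a" for i
    by (intro gauss_poly.add gauss_poly.cmult gauss_poly.coord) (use coord in auto)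
  moreover have "(\<lambda>x. of_real (x $ j) * f x) differentiable (at x)" for x
    by (intro differentiable_mult differentiableI[OF has_derivative_coord]) (use coord in auto)
  ultimately show ?case by simp
qed

lemma schwartz_gaussian:
  assumes "a > 0" shows "schwartz (\<lambda>x::real^'d::finite. exp (of_real (- a * (x \<bullet> x))))"
proof (rule schwartz_coinduct[OF gauss_poly.base])
  fix f :: "'d cfun" assume "f \<in> gauss_poly a"
  then show "rapidly_decaying f"
  proof induction
    case base show ?case by (rule rapidly_decaying_gaussian[OF assms])
  qed (intro rapidly_decaying_add rapidly_decaying_cmult rapidly_decaying_coord; assumption)+
qed (use gauss_poly_derivative in auto)

section \<open>Lebesgue measure on real vectors\<close>

definition decay :: "nat \<Rightarrow> 'a::real_normed_vector \<Rightarrow> real" where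
  "decay M z = 1 / (1 + norm z) ^ M"

lemma decay_pos: "0 < decay M z"
  by (simp add: decay_def add_pos_nonneg)

lemma decay_nonneg [simp]: "0 \<le> decay M z"
  using decay_pos less_imp_le by blast

lemma borel_measurable_decay [measurable]: "decay M \<in> borel_measurable (borel :: 'a::euclidean_space measure)"
  unfolding decay_def by measurable

lemma one_plus_norm_pos: "0 < 1 + norm (x::'a::real_normed_vector)"
  by (simp add: add_pos_nonneg)

text \<open>This moderateness is what allows the value at one point to be compared with the mean over a bounded
  neighbourhood of it.\<close>

lemma decay_shift: "decay M x \<le> (1 + norm y) ^ M * decay M (x + y :: 'a::real_normed_vector)"
proof -
  have "(1 + norm (x + y)) ^ M \<le> (1 + norm x) ^ M * (1 + norm y) ^ M"
    unfolding power_mult_distrib[symmetric] by (intro power_mono one_plus_norm_add_le) auto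
  then show ?thesis unfolding decay_def
    using one_plus_norm_pos[of x] one_plus_norm_pos[of "x + y"]
    by (simp add: field_simps)
qed

text \<open>The shell \<open>k \<le> \<bar>z\<bar> < k + 1\<close> lies in a ball of volume proportional to \<open>(k + 1)\<^sup>n\<close>, where \<open>n\<close> is the dimension,
  so that the exponent \<open>n + 2\<close> leaves the convergent series of the \<open>(k + 1)\<^sup>-\<^sup>2\<close>.\<close>

lemma integrable_decay:
  assumes M: "M \<ge> DIM('a) + 2"
  shows "integrable lborel (decay M :: 'a::euclidean_space \<Rightarrow> real)"
proof (rule integrableI_bounded)
  let ?V = "unit_ball_vol (real DIM('a))"
  let ?c = "\<lambda>k::nat. ennreal (1 / (1 + real k) ^ M)"
  let ?B = "\<lambda>k::nat. ball (0::'a) (real k + 1)"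
  have V: "0 \<le> ?V" by simp
  have pt: "ennreal (norm (decay M z)) \<le> (\<Sum>k. ?c k * indicator (?B k) z)" for z :: 'a
  proof -
    define k where "k = nat \<lfloor>norm z\<rfloor>"
    have k: "real k \<le> norm z" "norm z < real k + 1"
      unfolding k_def using norm_ge_zero[of z] floor_correct[of "norm z"] by auto
    have "decay M z \<le> 1 / (1 + real k) ^ M"
      unfolding decay_def using k by (intro divide_left_mono power_mono mult_pos_pos) auto
    then have "ennreal (norm (decay M z)) \<le> ?c k * indicator (?B k) z"
      using k by (simp add: ennreal_leI dist_norm)
    also have "\<dots> \<le> (\<Sum>k. ?c k * indicator (?B k) z)"
      using sum_le_suminf[of "\<lambda>k. ?c k * indicator (?B k) z" "{k}"] by (simp del: sum_mult_indicator)
    finally show ?thesis .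
  qed
  have sm: "summable (\<lambda>k::nat. ?V * (1 / (real k + 1)\<^sup>2))"
    using inverse_squares_sums by (intro summable_mult) (auto simp: sums_iff add.commute)
  have "(\<integral>\<^sup>+ z. ennreal (norm (decay M z)) \<partial>(lborel :: 'a measure)) \<le> (\<integral>\<^sup>+ z. (\<Sum>k. ?c k * indicator (?B k) z) \<partial>lborel)"
    by (intro nn_integral_mono pt)
  also have "\<dots> = (\<Sum>k. ?c k * emeasure lborel (?B k))"
    by (subst nn_integral_suminf) (auto simp: nn_integral_cmult_indicator intro!: borel_measurable_times_ennreal borel_measurable_indicator)
  also have "\<dots> \<le> (\<Sum>k. ennreal (?V * (1 / (real k + 1)\<^sup>2)))"
  proof (intro suminf_le allI summableI)
    fix k :: nat
    have "1 / (1 + real k) ^ M * (?V * (real k + 1) ^ DIM('a)) \<le> ?V * (1 / (real k + 1)\<^sup>2)"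
    proof -
      have "(real k + 1) ^ DIM('a) * (real k + 1)\<^sup>2 \<le> (real k + 1) ^ M"
        unfolding power_add[symmetric] using M by (intro power_increasing) auto
      then have "(real k + 1) ^ DIM('a) / (1 + real k) ^ M \<le> 1 / (real k + 1)\<^sup>2"
        by (simp add: field_simps)
      from mult_left_mono[OF this V] show ?thesis by (simp add: mult_ac)
    qed
    then show "?c k * emeasure lborel (?B k) \<le> ennreal (?V * (1 / (real k + 1)\<^sup>2))"
      using V by (simp add: emeasure_ball ennreal_mult[symmetric] ennreal_leI)
  qed
  also have "\<dots> = ennreal (\<Sum>k. ?V * (1 / (real k + 1)\<^sup>2))"
    by (rule suminf_ennreal2) (use sm in auto)
  also have "\<dots> < \<infinity>" by simp
  finally show "(\<integral>\<^sup>+ z. ennreal (norm (decay M z)) \<partial>(lborel :: 'a measure)) < \<infinity>" .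
qed measurable

subsection \<open>Affine changes of variables\<close>

lemma lborel_integrable_translation:
  fixes f :: "'a::euclidean_space \<Rightarrow> 'b::{banach, second_countable_topology}"
  assumes "integrable lborel f" shows "integrable lborel (\<lambda>x. f (a + x))"
proof -
  have "integrable (distr lborel borel ((+) a)) f" using assms by (simp add: lborel_distr_plus)
  then show ?thesis by (subst (asm) integrable_distr_eq) (use assms in auto)
qed

lemma lborel_integral_translation:
  fixes f :: "'a::euclidean_space \<Rightarrow> 'b::{banach, second_countable_topology}"
  assumes "f \<in> borel_measurable borel" shows "(LBINT x. f (a + x)) = (LBINT x. f x)"
  using assms by (subst (2) lborel_distr_plus[symmetric, of a]) (simp add: integral_distr)

lemma integrable_scaleR_iff:
  fixes f :: "'a \<Rightarrow> 'b::{banach, second_countable_topology}"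
  assumes "c \<noteq> (0::real)" shows "integrable M (\<lambda>x. c *\<^sub>R f x) \<longleftrightarrow> integrable M f"
proof
  assume "integrable M (\<lambda>x. c *\<^sub>R f x)"
  then have "integrable M (\<lambda>x. inverse c *\<^sub>R c *\<^sub>R f x)" by (rule integrable_scaleR_right)
  then show "integrable M f" using assms by simp
qed simp

lemma
  fixes f :: "'a::euclidean_space \<Rightarrow> 'b::{banach, second_countable_topology}"
  assumes f: "f \<in> borel_measurable borel" and c: "c \<noteq> 0"
  shows lborel_integral_scale: "(LBINT x. f x) = \<bar>c\<bar> ^ DIM('a) *\<^sub>R (LBINT x. f (c *\<^sub>R x))"
    and lborel_integrable_scale: "integrable lborel (\<lambda>x. f (c *\<^sub>R x)) \<longleftrightarrow> integrable lborel f"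
proof -
  have eq: "(lborel :: 'a measure) = density (distr lborel borel (\<lambda>x. c *\<^sub>R x)) (\<lambda>_. \<bar>c\<bar> ^ DIM('a))"
    using lborel_affine[OF c, of "0::'a"] by simp
  show "(LBINT x. f x) = \<bar>c\<bar> ^ DIM('a) *\<^sub>R (LBINT x. f (c *\<^sub>R x))"
    by (subst eq) (use f in \<open>simp add: integral_density integral_distr\<close>)
  show "integrable lborel (\<lambda>x. f (c *\<^sub>R x)) \<longleftrightarrow> integrable lborel f"
    by (subst (2) eq, subst integrable_density) (use f c in \<open>simp_all add: integrable_distr_eq integrable_scaleR_iff\<close>)
qed

lemma lborel_integral_reflect:
  fixes f :: "'a::euclidean_space \<Rightarrow> 'b::{banach, second_countable_topology}"
  assumes f: "f \<in> borel_measurable borel"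
  shows "(LBINT x. f (- x)) = (LBINT x. f x)"
  using lborel_integral_scale[OF f, of "-1"] by simp

lemma prod_Basis_vec: "(\<Prod>b\<in>Basis. f b) = (\<Prod>i\<in>UNIV. f (axis i (1::real) :: real^'n::finite))"
  by (simp add: Basis_vec_def UNION_singleton_eq_range prod.reindex inj_on_def axis_eq_axis)

lemma emeasure_lborel_box_vec:
  fixes l u :: "real^'n::finite"
  assumes "\<And>i. l $ i \<le> u $ i"
  shows "emeasure lborel (box l u) = ennreal (\<Prod>i\<in>UNIV. u $ i - l $ i)"
proof -
  have "\<And>b. b \<in> Basis \<Longrightarrow> l \<bullet> b \<le> u \<bullet> b" using assms by (auto simp: Basis_vec_def inner_axis)
  then show ?thesis by (simp add: prod_Basis_vec inner_axis)
qed

text \<open>One coordinate is split off so that it can be integrated first.\<close>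

lemma nn_integral_lborel_slice:
  fixes H :: "'a::euclidean_space \<Rightarrow> ennreal"
  assumes [measurable]: "H \<in> borel_measurable borel" and e: "e \<in> Basis"
  shows "(\<integral>\<^sup>+ x. H x \<partial>lborel) =
    (\<integral>\<^sup>+ f. (\<integral>\<^sup>+ t. H (t *\<^sub>R e + (\<Sum>b\<in>Basis - {e}. f b *\<^sub>R b)) \<partial>lborel) \<partial>(\<Pi>\<^sub>M b\<in>Basis - {e}. lborel))"
proof -
  interpret product_sigma_finite "\<lambda>b::'a. lborel :: real measure" ..
  have ins: "insert e (Basis - {e}) = Basis" using e by auto
  have "(\<integral>\<^sup>+ x. H x \<partial>lborel) = (\<integral>\<^sup>+ f. H (\<Sum>b\<in>Basis. f b *\<^sub>R b) \<partial>(\<Pi>\<^sub>M b\<in>insert e (Basis - {e}). lborel))"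
    unfolding ins by (subst lborel_eq) (simp add: nn_integral_distr)
  also have "\<dots> = (\<integral>\<^sup>+ f. (\<integral>\<^sup>+ t. H (\<Sum>b\<in>Basis. (f(e := t)) b *\<^sub>R b) \<partial>lborel) \<partial>(\<Pi>\<^sub>M b\<in>Basis - {e}. lborel))"
    by (rule product_nn_integral_insert) (auto simp: ins)
  also have "\<dots> = (\<integral>\<^sup>+ f. (\<integral>\<^sup>+ t. H (t *\<^sub>R e + (\<Sum>b\<in>Basis - {e}. f b *\<^sub>R b)) \<partial>lborel) \<partial>(\<Pi>\<^sub>M b\<in>Basis - {e}. lborel))"
    by (simp add: sum.remove[OF finite_Basis e])
  finally show ?thesis .
qed

text \<open>A shear translates every line in the direction of the \<open>m\<close>-th axis by an amount that is constant along that line.\<close>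

lemma nn_integral_lborel_shear:
  fixes H :: "real^'n::finite \<Rightarrow> ennreal"
  assumes [measurable]: "H \<in> borel_measurable borel" and "m \<noteq> n"
  shows "(\<integral>\<^sup>+ x. H (\<chi> i. if i = m then x $ m + x $ n else x $ i) \<partial>lborel) = (\<integral>\<^sup>+ x. H x \<partial>lborel)"
proof -
  let ?e = "axis m 1 :: real^'n"
  have e: "?e \<in> Basis" by (auto simp: Basis_vec_def)
  have sh: "(\<chi> i. if i = m then x $ m + x $ n else x $ i) = x + x $ n *\<^sub>R ?e" for x :: "real^'n"
    by (simp add: vec_eq_iff axis_def)
  have meas: "(\<lambda>x. H (x + x $ n *\<^sub>R ?e)) \<in> borel_measurable borel"
    by measurable
  have en: "?e $ n = 0" using \<open>m \<noteq> n\<close> by (simp add: axis_def)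
  have "(\<integral>\<^sup>+ t. H (t *\<^sub>R ?e + y + (t *\<^sub>R ?e + y) $ n *\<^sub>R ?e) \<partial>lborel) = (\<integral>\<^sup>+ t. H (t *\<^sub>R ?e + y) \<partial>lborel)" for y
  proof -
    have "(\<integral>\<^sup>+ t. H (t *\<^sub>R ?e + y) \<partial>lborel) = (\<integral>\<^sup>+ t. H ((y $ n + 1 * t) *\<^sub>R ?e + y) \<partial>lborel)"
      using nn_integral_real_affine[of "\<lambda>t. H (t *\<^sub>R ?e + y)" 1 "y $ n"] by simp
    then show ?thesis using en by (simp add: algebra_simps)
  qed
  then show ?thesis
    unfolding sh nn_integral_lborel_slice[OF meas e] nn_integral_lborel_slice[OF assms(1) e] by (simp only:)
qed

lemma nn_integral_lborel_swap:
  fixes H :: "real^'n::finite \<Rightarrow> ennreal"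
  assumes H: "H \<in> borel_measurable borel"
  shows "(\<integral>\<^sup>+ x. H (\<chi> i. x $ Transposition.transpose m n i) \<partial>lborel) = (\<integral>\<^sup>+ x. H x \<partial>lborel)"
proof -
  let ?p = "Transposition.transpose m n"
  let ?T = "\<lambda>x::real^'n. \<chi> i. x $ ?p i"
  have T: "?T \<in> borel_measurable borel"
    by (intro borel_measurable_continuous_onI continuous_intros)
  have "lborel = distr lborel borel ?T"
  proof (rule lborel_eqI)
    fix l u :: "real^'n" assume le: "\<And>b. b \<in> Basis \<Longrightarrow> l \<bullet> b \<le> u \<bullet> b"
    have le': "l $ i \<le> u $ i" for i using le[of "axis i 1"] by (auto simp: Basis_vec_def inner_axis)
    have "x \<in> ?T -` box l u \<longleftrightarrow> x \<in> box (?T l) (?T u)" for x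
      unfolding vimage_eq mem_box_cart by simp (metis transpose_involutory)
    then have "?T -` box l u = box (?T l) (?T u)" by blast
    then have "emeasure (distr lborel borel ?T) (box l u) = emeasure lborel (box (?T l) (?T u))"
      using T by (simp add: emeasure_distr)
    also have "\<dots> = (\<Prod>i\<in>UNIV. (u - l) $ ?p i)"
      using le' by (simp add: emeasure_lborel_box_vec)
    also have "(\<Prod>i\<in>UNIV. (u - l) $ ?p i) = (\<Prod>i\<in>UNIV. (u - l) $ i)"
      using prod.permute[OF permutes_swap_id, of m UNIV n "\<lambda>i. (u - l) $ i"] by (simp add: o_def)
    finally show "emeasure (distr lborel borel ?T) (box l u) = (\<Prod>b\<in>Basis. (u - l) \<bullet> b)"
      by (simp add: prod_Basis_vec inner_axis)
  qed simp
  then show ?thesis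
    using nn_integral_distr[of ?T lborel borel H] T H by simp
qed

lemma nn_integral_lborel_diagonal:
  fixes H :: "real^'n::finite \<Rightarrow> ennreal"
  assumes H: "H \<in> borel_measurable borel" and c: "\<And>i. c i \<noteq> 0"
  shows "ennreal \<bar>\<Prod>i\<in>UNIV. c i\<bar> * (\<integral>\<^sup>+ x. H (\<chi> i. c i * x $ i) \<partial>lborel) = (\<integral>\<^sup>+ x. H x \<partial>lborel)"
proof -
  let ?c = "\<lambda>b::real^'n. b \<bullet> (\<chi> i. c i)"
  let ?T = "\<lambda>x::real^'n. \<chi> i. c i * x $ i"
  have cB: "?c (axis i 1) = c i" for i by (simp add: inner_axis')
  have nz: "?c j \<noteq> 0" if "j \<in> Basis" for j using that c by (auto simp: Basis_vec_def cB)
  have T: "?T = (\<lambda>x. 0 + (\<Sum>j\<in>Basis. (?c j * (x \<bullet> j)) *\<^sub>R j))"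
  proof
    fix x :: "real^'n"
    show "?T x = 0 + (\<Sum>j\<in>Basis. (?c j * (x \<bullet> j)) *\<^sub>R j)"
    proof (rule euclidean_eqI)
      fix b :: "real^'n" assume b: "b \<in> Basis"
      then obtain k where k: "b = axis k 1" by (auto simp: Basis_vec_def)
      show "?T x \<bullet> b = (0 + (\<Sum>j\<in>Basis. (?c j * (x \<bullet> j)) *\<^sub>R j)) \<bullet> b"
        using b by (simp only: add_0_left inner_sum_left_Basis) (simp add: k inner_axis cB)
    qed
  qed
  have eq: "lborel = density (distr lborel borel ?T) (\<lambda>_. ennreal (\<Prod>j\<in>Basis. \<bar>?c j\<bar>))"
    unfolding T by (rule lborel_affine_euclidean) (rule nz)
  have Tm: "?T \<in> borel_measurable borel"
    by (intro borel_measurable_continuous_onI continuous_intros)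
  have "(\<integral>\<^sup>+ x. H x \<partial>lborel) = (\<Prod>j\<in>Basis. \<bar>?c j\<bar>) * (\<integral>\<^sup>+ x. H (?T x) \<partial>lborel)"
    by (subst eq) (use H Tm in \<open>simp add: nn_integral_density nn_integral_distr nn_integral_cmult\<close>)
  then show ?thesis by (simp add: prod_Basis_vec cB abs_prod)
qed

lemma linear_borel_measurable:
  fixes f :: "'a::euclidean_space \<Rightarrow> 'b::euclidean_space"
  shows "linear f \<Longrightarrow> f \<in> borel_measurable borel"
  by (intro borel_measurable_continuous_onI linear_continuous_on) (simp add: linear_conv_bounded_linear)

text \<open>Both sides are compatible with composition, and every linear map is a composition of maps with a vanishing
  coordinate (which are singular), diagonal maps, transpositions of coordinates and shears. No order on the index
  type enters; this matters because the coordinates of phase space are indexed by a sum type.\<close>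

proposition nn_integral_lborel_linear:
  fixes f :: "real^'n::finite \<Rightarrow> real^'n"
  assumes "linear f" and "det (matrix f) \<noteq> 0" and "H \<in> borel_measurable borel"
  shows "ennreal \<bar>det (matrix f)\<bar> * (\<integral>\<^sup>+ x. H (f x) \<partial>lborel) = (\<integral>\<^sup>+ x. H x \<partial>lborel)"
proof -
  let ?P = "\<lambda>f. det (matrix f) \<noteq> 0 \<longrightarrow> (\<forall>H\<in>borel_measurable borel.
    ennreal \<bar>det (matrix f)\<bar> * (\<integral>\<^sup>+ x. H (f x) \<partial>lborel) = (\<integral>\<^sup>+ x. H x \<partial>lborel))"
  have "?P f"
  proof (rule induct_linear_elementary[OF \<open>linear f\<close>])
    fix f g :: "real^'n \<Rightarrow> real^'n" assume lin: "linear f" "linear g" and P: "?P f" "?P g"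
    have d: "det (matrix (f \<circ> g)) = det (matrix f) * det (matrix g)"
      by (simp add: matrix_compose[OF lin(2,1)] det_mul)
    show "?P (f \<circ> g)"
    proof (intro impI ballI)
      fix H :: "real^'n \<Rightarrow> ennreal" assume nz: "det (matrix (f \<circ> g)) \<noteq> 0" and H: "H \<in> borel_measurable borel"
      have "(\<lambda>x. H (f x)) \<in> borel_measurable borel"
        using H linear_borel_measurable[OF lin(1)] by simp
      then have "ennreal \<bar>det (matrix g)\<bar> * (\<integral>\<^sup>+ x. H (f (g x)) \<partial>lborel) = (\<integral>\<^sup>+ x. H (f x) \<partial>lborel)"
        using P(2) nz d by auto
      moreover have "ennreal \<bar>det (matrix f)\<bar> * (\<integral>\<^sup>+ x. H (f x) \<partial>lborel) = (\<integral>\<^sup>+ x. H x \<partial>lborel)"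
        using P(1) nz d H by auto
      ultimately show "ennreal \<bar>det (matrix (f \<circ> g))\<bar> * (\<integral>\<^sup>+ x. H ((f \<circ> g) x) \<partial>lborel) = (\<integral>\<^sup>+ x. H x \<partial>lborel)"
        by (simp add: d abs_mult ennreal_mult mult.assoc)
    qed
  next
    fix f :: "real^'n \<Rightarrow> real^'n" and i assume lin: "linear f" and z: "\<And>x. f x $ i = 0"
    have "\<not> surj f" using z by (metis axis_nth surjD zero_neq_one)
    then have "\<not> inj f" using linear_injective_imp_surjective[OF lin] by blast
    then show "?P f" using det_nz_iff_inj[OF lin] by blast
  next
    fix c :: "'n \<Rightarrow> real"
    have det: "det (matrix (\<lambda>x. \<chi> i. c i * x $ i)) = (\<Prod>i\<in>UNIV. c i)"
      by (subst det_diagonal) (auto simp: matrix_def axis_def)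
    show "?P (\<lambda>x. \<chi> i. c i * x $ i)"
      unfolding det using nn_integral_lborel_diagonal[of _ c] by (simp add: prod_zero_iff)
  next
    fix m n :: 'n
    let ?h = "\<lambda>x::real^'n. \<chi> i. x $ Transposition.transpose m n i"
    have "matrix ?h = transpose (\<chi> i j. mat 1 $ i $ Transposition.transpose m n j)"
      by (auto simp: transpose_def axis_def mat_def matrix_def vec_eq_iff)
    then have "\<bar>det (matrix ?h)\<bar> = 1"
      by (simp add: det_permute_columns permutes_swap_id sign_swap_id abs_mult)
    then show "?P ?h" using nn_integral_lborel_swap[of _ m n] by (simp only: ennreal_1 mult_1_left) blast
  next
    fix m n :: 'n assume mn: "m \<noteq> n"
    let ?h = "\<lambda>x::real^'n. \<chi> i. if i = m then x $ m + x $ n else x $ i"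
    have "matrix ?h = (\<chi> k. if k = m then row m (mat 1) + 1 *s row n (mat 1) else row k (mat 1))"
      by (auto simp: matrix_def axis_def mat_def vec_eq_iff row_def)
    then have "det (matrix ?h) = 1"
      using det_row_operation[OF mn, of "mat 1" 1] by simp
    then show "?P ?h" using nn_integral_lborel_shear[OF _ mn] by simp
  qed
  then show ?thesis using assms by blast
qed

lemma lborel_eq_density_distr_matrix:
  fixes L :: "real^'n^'n::finite"
  assumes "invertible L"
  shows "lborel = density (distr lborel borel ((*v) L)) (\<lambda>_. ennreal \<bar>det L\<bar>)"
proof (rule measure_eqI)
  fix A :: "(real^'n) set" assume "A \<in> sets lborel"
  then have A: "A \<in> sets borel" by simp
  have m: "(*v) L \<in> borel_measurable borel" by (intro linear_borel_measurable) simp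
  have "emeasure lborel A = (\<integral>\<^sup>+ x. indicator A x \<partial>lborel)" using A by simp
  also have "\<dots> = ennreal \<bar>det L\<bar> * (\<integral>\<^sup>+ x. indicator A (L *v x) \<partial>lborel)"
    using nn_integral_lborel_linear[of "(*v) L" "indicator A"] assms A
    by (simp add: invertible_det_nz)
  also have "(\<integral>\<^sup>+ x. indicator A (L *v x) \<partial>lborel) = emeasure (distr lborel borel ((*v) L)) A"
    using nn_integral_distr[of "(*v) L" lborel borel "indicator A"] A m by simp
  also have "ennreal \<bar>det L\<bar> * \<dots> = emeasure (density (distr lborel borel ((*v) L)) (\<lambda>_. ennreal \<bar>det L\<bar>)) A"
    using A by (simp add: emeasure_density nn_integral_cmult_indicator)
  finally show "emeasure lborel A = emeasure (density (distr lborel borel ((*v) L)) (\<lambda>_. ennreal \<bar>det L\<bar>)) A" .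
qed simp

proposition
  fixes f :: "real^'n::finite \<Rightarrow> 'b::{banach, second_countable_topology}"
  assumes L: "invertible L" and f: "f \<in> borel_measurable borel"
  shows lborel_integral_matrix: "(LBINT x. f x) = \<bar>det L\<bar> *\<^sub>R (LBINT x. f (L *v x))"
    and lborel_integrable_matrix: "integrable lborel (\<lambda>x. f (L *v x)) \<longleftrightarrow> integrable lborel f"
proof -
  have m: "(*v) L \<in> borel_measurable borel" by (intro linear_borel_measurable) simp
  have nz: "det L \<noteq> 0" using L by (simp add: invertible_det_nz)
  show "(LBINT x. f x) = \<bar>det L\<bar> *\<^sub>R (LBINT x. f (L *v x))"
    by (subst lborel_eq_density_distr_matrix[OF L]) (use f m in \<open>simp add: integral_density integral_distr\<close>)
  show "integrable lborel (\<lambda>x. f (L *v x)) \<longleftrightarrow> integrable lborel f"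
    by (subst (2) lborel_eq_density_distr_matrix[OF L])
       (subst integrable_density, use f m nz in \<open>simp_all add: integrable_distr_eq integrable_scaleR_iff\<close>)
qed

subsection \<open>Phase space as a product\<close>

definition join :: "(real^'d) \<times> (real^'d) \<Rightarrow> real^('d + 'd::finite)" where
  "join p = (\<chi> i. case i of Inl a \<Rightarrow> fst p $ a | Inr b \<Rightarrow> snd p $ b)"

lemma pos_join [simp]: "pos (join p) = fst p"
  and freq_join [simp]: "freq (join p) = snd p"
  by (simp_all add: pos_def freq_def join_def)

lemma continuous_on_join: "continuous_on A join"
  unfolding join_def
proof (intro continuous_on_vec_lambda)
  fix i :: "'a + 'a"
  show "continuous_on A (\<lambda>p::(real^'a) \<times> (real^'a). case i of Inl a \<Rightarrow> fst p $ a | Inr b \<Rightarrow> snd p $ b)"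
    by (cases i) (auto intro!: continuous_intros)
qed

lemma borel_measurable_join [measurable]: "join \<in> borel_measurable borel"
  by (intro borel_measurable_continuous_onI continuous_on_join)

lemma lborel_distr_join: "distr lborel borel join = (lborel :: (real^('d + 'd::finite)) measure)"
proof (rule lborel_eqI[symmetric])
  fix l u :: "real^('d + 'd)" assume le: "\<And>b. b \<in> Basis \<Longrightarrow> l \<bullet> b \<le> u \<bullet> b"
  have le': "l $ i \<le> u $ i" for i using le[of "axis i 1"] by (auto simp: Basis_vec_def inner_axis)
  have "join -` box l u = box (pos l) (pos u) \<times> box (freq l) (freq u)"
    by (auto simp: mem_box_cart join_def pos_def freq_def split: sum.splits)
  then have "emeasure (distr lborel borel join) (box l u)
      = emeasure (lborel \<Otimes>\<^sub>M lborel) (box (pos l) (pos u) \<times> box (freq l) (freq u))"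
    by (simp add: emeasure_distr lborel_prod)
  also have "\<dots> = emeasure lborel (box (pos l) (pos u)) * emeasure lborel (box (freq l) (freq u))"
    by (rule lborel.emeasure_pair_measure_Times) auto
  also have "\<dots> = ennreal (\<Prod>i\<in>UNIV. (u - l) $ Inl i) * ennreal (\<Prod>i\<in>UNIV. (u - l) $ Inr i)"
    using le' by (simp add: emeasure_lborel_box_vec pos_def freq_def)
  also have "\<dots> = ennreal (\<Prod>i\<in>UNIV. (u - l) $ i)"
    using le' by (simp add: ennreal_mult[symmetric] prod_nonneg UNIV_Plus_UNIV[symmetric] prod.Plus
        del: UNIV_Plus_UNIV)
  finally show "emeasure (distr lborel borel join) (box l u) = (\<Prod>b\<in>Basis. (u - l) \<bullet> b)"
    by (simp add: prod_Basis_vec inner_axis)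
qed simp

lemma lborel_integral_join:
  fixes f :: "real^('d + 'd::finite) \<Rightarrow> 'b::{banach, second_countable_topology}"
  assumes "f \<in> borel_measurable borel"
  shows "(LBINT z. f z) = (\<integral>p. f (join p) \<partial>(lborel \<Otimes>\<^sub>M lborel))"
  unfolding lborel_prod by (subst lborel_distr_join[symmetric]) (use assms in \<open>simp add: integral_distr\<close>)

section \<open>Sums over the integer lattice\<close>

lemma infinite_int_vec: "infinite (UNIV :: (int^'n::finite) set)"
proof
  assume "finite (UNIV :: (int^'n) set)"
  moreover have "inj (\<lambda>k::int. (\<chi> i. k) :: int^'n)" by (auto simp: inj_def vec_eq_iff)
  ultimately have "finite (UNIV :: int set)" by (meson finite_imageD finite_subset subset_UNIV)
  then show False by (simp add: infinite_UNIV_char_0)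
qed

lemma summable_on_norm_iff_bounded:
  fixes f :: "'a \<Rightarrow> real"
  assumes "\<And>x. 0 \<le> f x" and "\<And>F. finite F \<Longrightarrow> sum f F \<le> K"
  shows "f summable_on UNIV"
  using assms by (intro nonneg_bdd_above_summable_on) (auto simp: bdd_above_def)

text \<open>Absolute convergence makes the order of summation immaterial, so that an enumeration of the index set reduces
  unordered sums to series.\<close>

lemma
  fixes f :: "'i \<Rightarrow> 'a \<Rightarrow> 'b::{banach, second_countable_topology}"
  assumes I: "infinite (UNIV :: 'i set)" "countable (UNIV :: 'i set)"
    and int: "\<And>i. integrable M (f i)"
    and pt: "\<And>x. (\<lambda>i. norm (f i x)) summable_on UNIV"
    and sm: "(\<lambda>i. \<integral>x. norm (f i x) \<partial>M) summable_on UNIV"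
  shows integrable_infsum: "integrable M (\<lambda>x. \<Sum>\<^sub>\<infinity>i. f i x)"
    and has_sum_integral: "((\<lambda>i. \<integral>x. f i x \<partial>M) has_sum (\<integral>x. (\<Sum>\<^sub>\<infinity>i. f i x) \<partial>M)) UNIV"
proof -
  obtain e :: "nat \<Rightarrow> 'i" where e: "bij_betw e UNIV UNIV"
    using bij_betw_from_nat_into[OF I(2,1)] by blast
  have pt': "summable (\<lambda>n. norm (f (e n) x))" for x
    using pt[of x] summable_on_reindex_bij_betw[OF e, of "\<lambda>i. norm (f i x)"]
    by (intro summable_on_imp_summable) simp
  have sm': "summable (\<lambda>n. \<integral>x. norm (f (e n) x) \<partial>M)"
    using sm summable_on_reindex_bij_betw[OF e, of "\<lambda>i. \<integral>x. norm (f i x) \<partial>M"]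
    by (intro summable_on_imp_summable) simp
  have inf: "(\<Sum>\<^sub>\<infinity>i. f i x) = (\<Sum>n. f (e n) x)" for x
  proof -
    have "(\<Sum>\<^sub>\<infinity>i. f i x) = (\<Sum>\<^sub>\<infinity>n. f (e n) x)"
      using infsum_reindex_bij_betw[OF e, of "\<lambda>i. f i x"] by simp
    also have "\<dots> = (\<Sum>n. f (e n) x)"
      using norm_summable_imp_has_sum[OF pt'[of x] summable_sums[OF summable_norm_cancel[OF pt'[of x]]]]
      by (rule infsumI)
    finally show ?thesis .
  qed
  show "integrable M (\<lambda>x. \<Sum>\<^sub>\<infinity>i. f i x)"
    unfolding inf by (rule integrable_suminf) (use int pt' sm' in auto)
  have sums: "(\<lambda>n. \<integral>x. f (e n) x \<partial>M) sums (\<integral>x. (\<Sum>n. f (e n) x) \<partial>M)"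
    by (rule sums_integral) (use int pt' sm' in auto)
  have "summable (\<lambda>n. norm (\<integral>x. f (e n) x \<partial>M))"
    by (rule summable_comparison_test'[OF sm', of 0]) (simp add: integral_norm_bound)
  from norm_summable_imp_has_sum[OF this sums]
  show "((\<lambda>i. \<integral>x. f i x \<partial>M) has_sum (\<integral>x. (\<Sum>\<^sub>\<infinity>i. f i x) \<partial>M)) UNIV"
    unfolding inf using has_sum_reindex_bij_betw[OF e, of "\<lambda>i. \<integral>x. f i x \<partial>M"] by simp
qed

subsection \<open>The unit cube as a fundamental domain\<close>

text \<open>The cube is half-open so that its integer translates are disjoint and cover the space.\<close>

definition unit_cube :: "(real^'n::finite) set" where
  "unit_cube = {y. \<forall>i. - (1/2) \<le> y $ i \<and> y $ i < 1/2}"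

definition nearest :: "real^'n::finite \<Rightarrow> int^'n" where
  "nearest z = (\<chi> i. \<lfloor>z $ i + 1/2\<rfloor>)"

lemma int_vec_nth [simp]: "int_vec k $ i = of_int (k $ i)"
  by (simp add: int_vec_def)

lemma int_vec_add: "int_vec (k + l) = int_vec k + int_vec l"
  and int_vec_diff: "int_vec (k - l) = int_vec k - int_vec l"
  and int_vec_0 [simp]: "int_vec 0 = 0"
  and int_vec_axis: "int_vec (axis i 1) = axis i 1"
  by (simp_all add: vec_eq_iff axis_def)

lemma diff_int_vec_in_cube_iff:
  fixes z :: "real^'n::finite"
  shows "z - int_vec k \<in> unit_cube \<longleftrightarrow> nearest z = k"
proof -
  have "(- (1/2) \<le> z $ i - of_int (k $ i) \<and> z $ i - of_int (k $ i) < 1/2) \<longleftrightarrow> \<lfloor>z $ i + 1/2\<rfloor> = k $ i" for i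
    by (auto simp: floor_eq_iff)
  then show ?thesis by (simp add: unit_cube_def nearest_def vec_eq_iff)
qed

lemma unit_cube_subset_cbox: "unit_cube \<subseteq> cbox (- (\<chi> i. 1/2)) ((\<chi> i. 1/2) :: real^'n::finite)"
  unfolding unit_cube_def mem_box_cart subset_iff mem_Collect_eq by (force intro: less_imp_le)

lemma borel_unit_cube [measurable]: "unit_cube \<in> sets (borel :: (real^'n::finite) measure)"
proof -
  have "unit_cube = (\<Inter>i. {y :: real^'n. - (1/2) \<le> y $ i \<and> y $ i < 1/2})"
    by (auto simp: unit_cube_def)
  also have "\<dots> \<in> sets borel" by measurable
  finally show ?thesis .
qed

lemma emeasure_unit_cube: "emeasure lborel (unit_cube :: (real^'n::finite) set) = 1"
proof (rule antisym)
  let ?a = "- (\<chi> i. 1/2) :: real^'n" and ?b = "(\<chi> i. 1/2) :: real^'n"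
  have le: "?a \<bullet> b \<le> ?b \<bullet> b" if "b \<in> Basis" for b
    using that by (auto simp: Basis_vec_def inner_axis)
  have 1: "(\<Prod>b\<in>Basis. (?b - ?a) \<bullet> b) = 1"
    by (intro prod.neutral) (auto simp: Basis_vec_def inner_axis)
  have "emeasure lborel (unit_cube :: (real^'n) set) \<le> emeasure lborel (cbox ?a ?b)"
    by (intro emeasure_mono unit_cube_subset_cbox) auto
  then show "emeasure lborel (unit_cube :: (real^'n) set) \<le> 1"
    using 1 by (simp add: emeasure_lborel_cbox[OF le])
  have "emeasure lborel (box ?a ?b) \<le> emeasure lborel (unit_cube :: (real^'n) set)"
    by (intro emeasure_mono) (auto simp: unit_cube_def mem_box_cart intro: less_imp_le)
  then show "1 \<le> emeasure lborel (unit_cube :: (real^'n) set)"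
    using 1 by (simp add: emeasure_lborel_box[OF le])
qed

lemma integrable_indicator_cube: "integrable lborel (indicator unit_cube :: real^'n::finite \<Rightarrow> real)"
  and integral_indicator_cube: "(\<integral>y. indicator unit_cube y \<partial>(lborel :: (real^'n::finite) measure)) = (1::real)"
  by (simp_all add: emeasure_unit_cube measure_def)

lemma norm_unit_cube_le:
  assumes "y \<in> (unit_cube :: (real^'n::finite) set)" shows "norm y \<le> real CARD('n)"
proof -
  have "norm y \<le> (\<Sum>i\<in>UNIV. \<bar>y $ i\<bar>)" by (rule norm_le_l1_cart)
  also have "\<dots> \<le> (\<Sum>i\<in>(UNIV::'n set). 1)"
  proof (rule sum_mono)
    fix i show "\<bar>y $ i\<bar> \<le> 1" using assms by (auto simp: unit_cube_def abs_le_iff) (smt (verit) field_sum_of_halves)+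
  qed
  finally show ?thesis by simp
qed

text \<open>The weights \<open>w i\<close> are the indicator functions of the parts of a countable partition whose part containing \<open>z\<close> has
  index \<open>idx z\<close>. The space is partitioned in this way by the translates of the unit cube, and the unit cube by the
  translates of a shifted cube.\<close>

lemma has_sum_integral_partition:
  fixes f :: "'a \<Rightarrow> 'b::{banach, second_countable_topology}"
  assumes I: "infinite (UNIV :: 'i set)" "countable (UNIV :: 'i set)"
    and f: "integrable M f"
    and w [measurable]: "\<And>i. w i \<in> borel_measurable M"
    and idx: "\<And>i z. w i z = (if i = idx z then 1 else (0::real))"
  shows "((\<lambda>i::'i. \<integral>z. w i z *\<^sub>R f z \<partial>M) has_sum (\<integral>z. f z \<partial>M)) UNIV"
proof -
  have fm [measurable]: "f \<in> borel_measurable M" using f by auto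
  have one: "((\<lambda>k. if k = l then c else 0) has_sum c) UNIV"
    for l :: 'i and c :: "'c::{t2_space,topological_comm_monoid_add}"
    by (rule has_sum_finite_neutralI[of "{l}"]) auto
  have g: "w i z *\<^sub>R f z = (if i = idx z then f z else 0)"
    and ng: "norm (w i z *\<^sub>R f z) = (if i = idx z then norm (f z) else 0)" for i z
    by (simp_all add: idx)
  have int: "integrable M (\<lambda>z. w i z *\<^sub>R f z)" for i
    by (rule Bochner_Integration.integrable_bound[OF f]) (measurable, simp add: idx)
  have sm: "(\<lambda>i. \<integral>z. norm (w i z *\<^sub>R f z) \<partial>M) summable_on UNIV"
  proof (rule summable_on_norm_iff_bounded)
    fix F :: "'i set" assume F: "finite F"
    have "(\<Sum>i\<in>F. \<integral>z. norm (w i z *\<^sub>R f z) \<partial>M) = (\<integral>z. (\<Sum>i\<in>F. norm (w i z *\<^sub>R f z)) \<partial>M)"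
      by (rule Bochner_Integration.integral_sum[symmetric]) (rule integrable_norm[OF int])
    also have "\<dots> \<le> (\<integral>z. norm (f z) \<partial>M)"
    proof (rule integral_mono)
      fix z show "(\<Sum>i\<in>F. norm (w i z *\<^sub>R f z)) \<le> norm (f z)"
        unfolding ng using F by (simp add: sum.delta)
    next
      show "integrable M (\<lambda>z. \<Sum>i\<in>F. norm (w i z *\<^sub>R f z))"
        by (rule Bochner_Integration.integrable_sum) (rule integrable_norm[OF int])
    qed (use f in auto)
    finally show "(\<Sum>i\<in>F. \<integral>z. norm (w i z *\<^sub>R f z) \<partial>M) \<le> (\<integral>z. norm (f z) \<partial>M)" .
  qed simp
  have "((\<lambda>i. \<integral>z. w i z *\<^sub>R f z \<partial>M) has_sum (\<integral>z. (\<Sum>\<^sub>\<infinity>i. w i z *\<^sub>R f z) \<partial>M)) UNIV"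
  proof (rule has_sum_integral[OF I int _ sm])
    show "(\<lambda>i. norm (w i z *\<^sub>R f z)) summable_on UNIV" for z
      unfolding ng using one has_sum_imp_summable by blast
  qed
  moreover have "(\<Sum>\<^sub>\<infinity>i. w i z *\<^sub>R f z) = f z" for z
    unfolding g by (rule infsumI[OF one])
  ultimately show ?thesis by simp
qed

lemma indicator_cube_diff: "indicator unit_cube (z - int_vec k) = (if k = nearest z then 1 else (0::real))"
  using diff_int_vec_in_cube_iff by (auto simp: indicator_def)

proposition has_sum_cube_tiling:
  fixes f :: "real^'n::finite \<Rightarrow> 'b::{banach, second_countable_topology}"
  assumes f: "integrable lborel f"
  shows "((\<lambda>k. (LBINT y. indicator unit_cube y *\<^sub>R f (y + int_vec k))) has_sum (LBINT y. f y)) UNIV"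
proof -
  have [measurable]: "f \<in> borel_measurable borel" using f by auto
  have "(LBINT z. indicat_real unit_cube (z - int_vec k) *\<^sub>R f z)
      = (LBINT y. indicator unit_cube y *\<^sub>R f (y + int_vec k))" for k
    using lborel_integral_translation[of "\<lambda>z. indicat_real unit_cube (z - int_vec k) *\<^sub>R f z" "int_vec k"]
    by (simp add: add.commute)
  moreover have "((\<lambda>k. (LBINT z. indicat_real unit_cube (z - int_vec k) *\<^sub>R f z)) has_sum (LBINT y. f y)) UNIV"
    by (rule has_sum_integral_partition[OF infinite_int_vec _ f, where idx=nearest])
       (simp, measurable, rule indicator_cube_diff)
  ultimately show ?thesis by simp
qed

text \<open>By moderateness each term is at most a constant times the mean of \<open>decay M\<close> over the cell of the lattice point,
  and the cells tile the space. The bound is thus a multiple of the integral of \<open>decay M\<close>, whatever the translation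
  \<open>p\<close> is.\<close>

lemma lattice_decay_sum_bounded:
  fixes L :: "real^'n::finite^'n"
  assumes L: "invertible L" and M: "M \<ge> CARD('n) + 2"
  obtains K where "\<And>p F. finite F \<Longrightarrow> (\<Sum>k\<in>F. decay M (L *v int_vec k + p)) \<le> K"
proof -
  obtain B where B: "\<And>y. norm (L *v y) \<le> B * norm y"
    using linear_bounded[of "(*v) L"] by auto
  define B' where "B' = \<bar>B\<bar> * real CARD('n)"
  have B': "norm (L *v y) \<le> B'" if "y \<in> unit_cube" for y
  proof -
    have "norm (L *v y) \<le> B * norm y" by (rule B)
    also have "\<dots> \<le> \<bar>B\<bar> * norm y" by (intro mult_right_mono) auto
    also have "\<dots> \<le> B'" unfolding B'_def by (intro mult_left_mono norm_unit_cube_le[OF that]) auto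
    finally show ?thesis .
  qed
  let ?c = "(1 + B') ^ M"
  have c: "0 \<le> ?c" by (simp add: B'_def)
  have int: "integrable lborel (\<lambda>y::real^'n. decay M (L *v y + p))" for p
  proof -
    have "integrable lborel (\<lambda>z. decay M (p + z :: real^'n))"
      by (rule lborel_integrable_translation[OF integrable_decay]) (use M in simp)
    then have "integrable lborel (\<lambda>y. decay M (p + L *v y))"
      by (subst lborel_integrable_matrix[OF L, of "\<lambda>z. decay M (p + z)"]) auto
    then show ?thesis by (simp add: add.commute)
  qed
  have val: "(LBINT y. decay M (L *v y + p)) = (LBINT z. decay M (z::real^'n)) / \<bar>det L\<bar>" for p
  proof -
    have "(LBINT z. decay M (z::real^'n)) = (LBINT z. decay M (p + z))"
      by (rule lborel_integral_translation[symmetric]) simp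
    also have "\<dots> = \<bar>det L\<bar> * (LBINT y. decay M (p + L *v y))"
      using lborel_integral_matrix[OF L, of "\<lambda>z. decay M (p + z)"] by simp
    finally show ?thesis using L by (simp add: invertible_det_nz add.commute)
  qed
  show thesis
  proof (rule that)
    fix p :: "real^'n" and F :: "(int^'n) set" assume F: "finite F"
    have int': "integrable lborel (\<lambda>y. indicator unit_cube y *\<^sub>R decay M (L *v (y + int_vec k) + p))" for k
    proof (rule integrable_mult_indicator[where 'b=real])
      have "(\<lambda>y. decay M (L *v (y + int_vec k) + p)) = (\<lambda>y. decay M (L *v y + (L *v int_vec k + p)))"
        by (simp add: matrix_vector_right_distrib add.assoc)
      then show "integrable lborel (\<lambda>y. decay M (L *v (y + int_vec k) + p))" using int by simp
    qed simp
    have le: "decay M (L *v int_vec k + p) \<le> ?c * (LBINT y. indicator unit_cube y *\<^sub>R decay M (L *v (y + int_vec k) + p))" for k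
    proof -
      have "decay M (L *v int_vec k + p) = (LBINT y. decay M (L *v int_vec k + p) * indicator unit_cube (y :: real^'n))"
        by (simp add: integral_indicator_cube emeasure_unit_cube measure_def)
      also have "\<dots> \<le> (LBINT y. ?c * (indicator unit_cube y *\<^sub>R decay M (L *v (y + int_vec k) + p)))"
      proof (rule integral_mono)
        fix y :: "real^'n"
        show "decay M (L *v int_vec k + p) * indicator unit_cube y
            \<le> ?c * (indicator unit_cube y *\<^sub>R decay M (L *v (y + int_vec k) + p))"
        proof (cases "y \<in> unit_cube")
          case True
          have "decay M (L *v int_vec k + p) \<le> (1 + norm (L *v y)) ^ M * decay M (L *v int_vec k + p + L *v y)"
            by (rule decay_shift)
          also have "\<dots> \<le> ?c * decay M (L *v int_vec k + p + L *v y)"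
            by (intro mult_right_mono power_mono add_left_mono B' True) auto
          finally show ?thesis using True by (simp add: matrix_vector_right_distrib add_ac)
        qed simp
      qed (use int' integrable_indicator_cube in \<open>auto intro!: integrable_mult_right\<close>)
      finally show ?thesis by simp
    qed
    have "(\<Sum>k\<in>F. decay M (L *v int_vec k + p))
        \<le> ?c * (\<Sum>k\<in>F. (LBINT y. indicator unit_cube y *\<^sub>R decay M (L *v (y + int_vec k) + p)))"
      unfolding sum_distrib_left by (intro sum_mono le)
    also have "(\<Sum>k\<in>F. (LBINT y. indicator unit_cube y *\<^sub>R decay M (L *v (y + int_vec k) + p)))
        \<le> (LBINT y. decay M (L *v y + p))"
      by (rule finite_sum_le_has_sum[OF has_sum_cube_tiling[OF int]]) (use F in auto)
    finally show "(\<Sum>k\<in>F. decay M (L *v int_vec k + p)) \<le> ?c * ((LBINT z. decay M (z::real^'n)) / \<bar>det L\<bar>)"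
      using c by (simp add: val mult_left_mono)
  qed
qed

section \<open>Poisson summation\<close>

lemma integrable_bounded_mult:
  fixes f g :: "'a \<Rightarrow> complex"
  assumes f: "integrable M f" and g: "g \<in> borel_measurable M" and b: "\<And>x. cmod (g x) \<le> 1"
  shows "integrable M (\<lambda>x. f x * g x)"
proof (rule Bochner_Integration.integrable_bound[OF f])
  show "AE x in M. norm (f x * g x) \<le> norm (f x)"
    using b by (auto simp: norm_mult mult_left_le)
qed (use f g in auto)

text \<open>A trigonometric polynomial with values in \<open>[0, 1]\<close> that attains the value 1 on the cube only at its centre. It is an
  average over the coordinates so that multiplication by it shifts frequencies by unit vectors only.\<close>

definition bump :: "real^'n::finite \<Rightarrow> real" where
  "bump y = (\<Sum>i\<in>UNIV. (1 + cos (2 * pi * (y $ i))) / 2) / real CARD('n)"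

lemma bump_bounds: "0 \<le> bump y" "bump y \<le> 1"
proof -
  have s: "0 \<le> (1 + cos t) / 2" "(1 + cos t) / 2 \<le> 1" for t :: real
    using cos_ge_minus_one[of t] cos_le_one[of t] by (intro divide_nonneg_nonneg; linarith) simp
  show "0 \<le> bump y" unfolding bump_def by (intro divide_nonneg_nonneg sum_nonneg s) simp
  have "(\<Sum>i\<in>UNIV. (1 + cos (2 * pi * (y $ i))) / 2) \<le> (\<Sum>i\<in>(UNIV :: 'a set). 1)" by (intro sum_mono s)
  then show "bump y \<le> 1" unfolding bump_def by (simp add: divide_le_eq)
qed

lemma bump_eq_1D:
  assumes "bump y = 1" and "\<And>i. \<bar>y $ i\<bar> \<le> 1/2" shows "y = (0 :: real^'n::finite)"
proof -
  let ?s = "\<lambda>i. (1 + cos (2 * pi * (y $ i))) / 2"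
  have "y $ i = 0" for i
  proof -
    have "(\<Sum>i\<in>UNIV. 1 - ?s i) = 0"
      using assms(1) by (simp add: bump_def sum_subtractf)
    moreover have "0 \<le> 1 - ?s i" for i using cos_le_one[of "2 * pi * (y $ i)"] by auto
    ultimately have "1 - ?s i = 0" using sum_nonneg_eq_0_iff[of UNIV "\<lambda>i. 1 - ?s i"] by simp
    then have "cos (2 * pi * (y $ i)) = 1" by simp
    then obtain n :: int where "2 * pi * (y $ i) = real_of_int n * 2 * pi" using cos_one_2pi_int[THEN iffD1] by blast
    then have n: "y $ i = n" by simp
    then have "\<bar>n\<bar> < 1" using assms(2)[of i] by linarith
    then show ?thesis using n by simp
  qed
  then show ?thesis by (simp add: vec_eq_iff)
qed

lemma bump_0 [simp]: "bump 0 = 1"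
  by (simp add: bump_def)

lemma continuous_on_bump: "continuous_on A bump"
  unfolding bump_def by (intro continuous_intros) auto

lemma borel_measurable_bump [measurable]: "bump \<in> borel_measurable borel"
  by (intro borel_measurable_continuous_onI continuous_on_bump)

lemma cos_ch: "of_real (cos (2 * pi * t)) = (ch t + ch (- t)) / 2"
proof -
  have "ch t = cis (2 * pi * t)" by (simp add: ch_def cis_conv_exp mult_ac)
  then show ?thesis by (simp add: ch_minus complex_eq_iff)
qed

lemma bump_ch:
  "of_real (bump y) = (\<Sum>i\<in>UNIV. 2 + ch (int_vec (axis i 1) \<bullet> y) + ch (int_vec (- axis i 1) \<bullet> y)) / of_nat (4 * CARD('n))"
  for y :: "real^'n::finite"
proof -
  have a: "int_vec (axis i 1) \<bullet> y = y $ i" "int_vec (- axis i 1) \<bullet> y = - (y $ i)" for i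
    using int_vec_diff[of 0 "axis i 1"] by (simp_all add: int_vec_axis inner_axis' inner_axis inner_commute)
  have "of_real (bump y) = (\<Sum>i\<in>UNIV. (1 + (ch (y $ i) + ch (- (y $ i))) / 2) / 2) / of_nat CARD('n)"
    by (simp add: bump_def cos_ch)
  also have "(\<Sum>i\<in>UNIV. (1 + (ch (y $ i) + ch (- (y $ i))) / 2) / 2)
     = (\<Sum>i\<in>UNIV. (2 + ch (y $ i) + ch (- (y $ i)))) / 4"
    by (simp add: sum_divide_distrib add_divide_distrib add.assoc)
  finally show ?thesis by (simp add: a)
qed

lemma trig_moments_zero:
  fixes D :: "real^'n::finite \<Rightarrow> complex"
  assumes D: "integrable lborel D"
    and zero: "\<And>k. (LBINT y. D y * ch (int_vec k \<bullet> y)) = 0"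
  shows "(LBINT y. D y * ch (int_vec k \<bullet> y) * of_real (bump y) ^ N) = 0"
proof (induction N arbitrary: k)
  case 0 show ?case using zero by simp
next
  case (Suc N)
  let ?g = "\<lambda>k y. D y * ch (int_vec k \<bullet> y) * of_real (bump y) ^ N"
  have int: "integrable lborel (?g k)" for k
    unfolding mult.assoc
    by (rule integrable_bounded_mult[OF D]) (auto simp: norm_mult norm_power bump_bounds power_le_one abs_of_nonneg)
  have "D y * ch (int_vec k \<bullet> y) * of_real (bump y) ^ Suc N
     = (\<Sum>i\<in>UNIV. 2 * ?g k y + ?g (k + axis i 1) y + ?g (k - axis i 1) y) / of_nat (4 * CARD('n))" for y
  proof -
    have e: "ch (int_vec (k + l) \<bullet> y) = ch (int_vec k \<bullet> y) * ch (int_vec l \<bullet> y)" for l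
      by (simp add: int_vec_add inner_add_left ch_add)
    define B where "B = complex_of_real (bump y) ^ N"
    let ?F = "\<lambda>i. D y * ch (int_vec k \<bullet> y) * B * (2 + ch (int_vec (axis i 1) \<bullet> y) + ch (int_vec (- axis i 1) \<bullet> y))"
    have "D y * ch (int_vec k \<bullet> y) * of_real (bump y) ^ Suc N = D y * ch (int_vec k \<bullet> y) * B * of_real (bump y)"
      by (simp add: B_def mult_ac)
    also have "\<dots> = (\<Sum>i\<in>UNIV. ?F i) / of_nat (4 * CARD('n))"
      unfolding bump_ch by (simp only: times_divide_eq_right sum_distrib_left)
    finally have 1: "D y * ch (int_vec k \<bullet> y) * of_real (bump y) ^ Suc N = (\<Sum>i\<in>UNIV. ?F i) / of_nat (4 * CARD('n))" .
    have 2: "?F i = 2 * ?g k y + ?g (k + axis i 1) y + ?g (k - axis i 1) y" for i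
      unfolding diff_conv_add_uminus e B_def[symmetric] by (simp only: distrib_left mult_ac)
    show ?thesis by (simp only: 1 2)
  qed
  note step = this
  have hb: "has_bochner_integral lborel (?g k) 0" for k
    using int Suc.IH by (simp add: has_bochner_integral_iff)
  have "has_bochner_integral lborel
      (\<lambda>y. (\<Sum>i\<in>UNIV. 2 * ?g k y + ?g (k + axis i 1) y + ?g (k - axis i 1) y) / of_nat (4 * CARD('n)))
      ((\<Sum>i\<in>(UNIV::'n set). 2 * 0 + 0 + 0) / of_nat (4 * CARD('n)))"
    by (intro has_bochner_integral_divide_zero has_bochner_integral_sum has_bochner_integral_add
        has_bochner_integral_mult_right hb)
  then show ?case
    unfolding step using has_bochner_integral_integral_eq by force
qed

text \<open>Rudin's argument: the trigonometric polynomial \<open>bump\<close> equals 1 only at the centre of the cube,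
  so its powers concentrate there, and a function orthogonal to all of them vanishes at 0.\<close>

proposition fourier_coefficients_zero_imp_zero:
  fixes D :: "real^'n::finite \<Rightarrow> complex"
  defines "K \<equiv> cbox (- (\<chi> i. 1/2)) ((\<chi> i. 1/2) :: real^'n)"
  assumes cont: "continuous_on K D"
    and zero: "\<And>k. (LBINT y. indicator unit_cube y *\<^sub>R (D y * ch (int_vec k \<bullet> y))) = 0"
  shows "D 0 = 0"
proof (rule ccontr)
  assume "D 0 \<noteq> 0"
  let ?Q = "unit_cube :: (real^'n) set"
  define r where "r y = Re (cnj (D 0) * D y)" for y
  have QK: "?Q \<subseteq> K" unfolding K_def by (rule unit_cube_subset_cbox)
  have KD: "\<bar>y $ i\<bar> \<le> 1/2" if "y \<in> K" for y i
    using that[unfolded K_def mem_box_cart, THEN spec, of i] by (simp add: abs_if)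
  have K: "compact K" "0 \<in> K" unfolding K_def by (auto simp: mem_box_cart)
  have r0: "r 0 > 0" using \<open>D 0 \<noteq> 0\<close> by (simp add: r_def complex_neq_0 power2_eq_square)
  have rc: "continuous_on K r" unfolding r_def by (intro continuous_intros cont)
  have "bounded (r ` K)" "bounded (D ` K)"
    using rc cont K by (auto intro!: compact_imp_bounded compact_continuous_image)
  then obtain B B' where B: "\<And>y. y \<in> K \<Longrightarrow> \<bar>r y\<bar> \<le> B" and B': "\<And>y. y \<in> K \<Longrightarrow> cmod (D y) \<le> B'"
    by (auto simp: bounded_iff)
  have "0 \<le> B" using B[OF K(2)] by simp
  \<comment> \<open>The real function \<open>r\<close> is positive at 0 and, like \<open>D\<close>, orthogonal on the cube to all powers of \<open>bump\<close>.\<close>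
  define E where "E y = indicator ?Q y *\<^sub>R D y" for y
  have Em: "E \<in> borel_measurable borel"
  proof -
    have "(\<lambda>y. indicator K y *\<^sub>R D y) \<in> borel_measurable borel"
      using cont borel_measurable_continuous_on_indicator[of K D] K by (simp add: K_def)
    then have "(\<lambda>y. indicator ?Q y *\<^sub>R (indicator K y *\<^sub>R D y)) \<in> borel_measurable borel" by measurable
    moreover have "indicator ?Q y *\<^sub>R (indicator K y *\<^sub>R D y) = E y" for y
      using QK by (auto simp: E_def indicator_def)
    ultimately show ?thesis by simp
  qed
  have Ei: "integrable lborel E"
  proof (rule Bochner_Integration.integrable_bound)
    show "integrable lborel (\<lambda>y. B' * indicator ?Q y :: real)"
      by (intro integrable_mult_right integrable_indicator_cube)
    show "AE y in lborel. norm (E y) \<le> norm (B' * indicator ?Q y :: real)"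
      using B' QK by (auto simp: E_def indicator_def intro!: AE_I2) (meson abs_ge_self order_trans subsetD)
  qed (use Em in simp)
  have "(LBINT y. E y * ch (int_vec 0 \<bullet> y) * of_real (bump y) ^ N) = 0" for N
    by (rule trig_moments_zero[OF Ei]) (use zero in \<open>simp add: E_def mult.assoc\<close>)
  then have E0: "(LBINT y. E y * of_real (bump y) ^ N) = 0" for N by simp
  have EiN: "integrable lborel (\<lambda>y. E y * of_real (bump y) ^ N)" for N
    by (rule integrable_bounded_mult[OF Ei]) (auto simp: norm_power bump_bounds power_le_one abs_of_nonneg)
  have mom: "integrable lborel (\<lambda>y. indicator ?Q y * (r y * bump y ^ N))"
    "(LBINT y. indicator ?Q y * (r y * bump y ^ N)) = 0" for N
  proof -
    have eq: "indicator ?Q y * (r y * bump y ^ N) = Re (cnj (D 0) * (E y * of_real (bump y) ^ N))" for y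
      by (simp add: r_def E_def indicator_def algebra_simps flip: of_real_power)
    show "integrable lborel (\<lambda>y. indicator ?Q y * (r y * bump y ^ N))"
      unfolding eq by (intro integrable_Re integrable_mult_right EiN)
    show "(LBINT y. indicator ?Q y * (r y * bump y ^ N)) = 0"
      unfolding eq using EiN[of N] E0[of N]
      by (subst integral_Re) (auto intro: integrable_mult_right)
  qed
  obtain \<delta> where \<delta>: "\<delta> > 0" "\<And>y. y \<in> K \<Longrightarrow> norm y < \<delta> \<Longrightarrow> r y > r 0 / 2"
  proof -
    obtain d where d: "d > 0" "\<And>y. y \<in> K \<Longrightarrow> dist y 0 < d \<Longrightarrow> dist (r y) (r 0) < r 0 / 2"
      using rc[unfolded continuous_on_iff, rule_format, OF K(2), of "r 0 / 2"] r0 by auto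
    have "r y > r 0 / 2" if "y \<in> K" "norm y < d" for y
    proof -
      have "\<bar>r y - r 0\<bar> < r 0 / 2" using d(2)[of y] that by (simp add: dist_real_def)
      then show ?thesis unfolding abs_less_iff by linarith
    qed
    with d(1) show thesis by (rule that)
  qed
  \<comment> \<open>Away from 0 the cube is compact, which turns \<open>bump y < 1\<close> into a uniform bound.\<close>
  obtain \<rho> where \<rho>: "0 \<le> \<rho>" "\<rho> < 1" "\<And>y. y \<in> K \<Longrightarrow> \<not> norm y < \<delta> \<Longrightarrow> bump y \<le> \<rho>"
  proof (cases "K - ball 0 \<delta> = {}")
    case True
    then have "y \<in> K \<Longrightarrow> norm y < \<delta>" for y by auto
    then show thesis by (intro that[of 0]) auto
  next
    case False
    have "compact (K - ball 0 \<delta>)" using K by (intro compact_diff) auto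
    then obtain x where x: "x \<in> K - ball 0 \<delta>" "\<And>y. y \<in> K - ball 0 \<delta> \<Longrightarrow> bump y \<le> bump x"
      using continuous_attains_sup[OF _ False continuous_on_bump] by blast
    have "x \<noteq> 0" using x(1) \<delta>(1) by auto
    then have "bump x \<noteq> 1" using bump_eq_1D[of x] KD[of x] x(1) by auto
    then have "bump x < 1" using bump_bounds(2)[of x] by simp
    then show thesis using that[of "bump x"] x(2) bump_bounds by auto
  qed
  \<comment> \<open>Any number strictly between \<open>\<rho>\<close> and 1 would do: near 0 the powers of \<open>bump\<close> exceed those away from 0 by a factor
    of at least \<open>(\<rho>' / \<rho>)\<^sup>N\<close>.\<close>
  define \<rho>' where "\<rho>' = (1 + \<rho>) / 2"
  have \<rho>': "\<rho> < \<rho>'" "0 < \<rho>'" "\<rho>' < 1" using \<rho> by (auto simp: \<rho>'_def)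
  obtain \<eta> where \<eta>: "0 < \<eta>" "\<eta> \<le> \<delta>" "\<eta> \<le> 1/2" "\<And>y::real^'n. norm y < \<eta> \<Longrightarrow> bump y > \<rho>'"
  proof -
    obtain d where d: "d > 0" "\<And>y::real^'n. dist y 0 < d \<Longrightarrow> dist (bump y) (bump 0) < 1 - \<rho>'"
      using continuous_on_bump[of UNIV, unfolded continuous_on_iff, rule_format, of 0 "1 - \<rho>'"] \<rho>'(3) by auto
    have "bump y > \<rho>'" if "norm y < d" for y :: "real^'n"
      using d(2)[of y] that by (simp add: dist_real_def abs_less_iff)
    then show thesis using that[of "min d (min \<delta> (1/2))"] d(1) \<delta>(1) by auto
  qed
  have ballQ: "ball 0 \<eta> \<subseteq> ?Q"
  proof
    fix y :: "real^'n" assume "y \<in> ball 0 \<eta>"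
    then have "\<bar>y $ i\<bar> < 1/2" for i using component_le_norm_cart[of y i] \<eta>(3) by simp
    then have "- (1/2) \<le> y $ i \<and> y $ i < 1/2" for i by (smt (verit))
    then show "y \<in> ?Q" unfolding unit_cube_def by blast
  qed
  define V where "V = measure lborel (ball (0::real^'n) \<eta>)"
  have V: "V > 0" unfolding V_def using content_ball_pos[OF \<eta>(1)] by simp
  have ineq: "(r 0 / 2) * V \<le> B * (\<rho> / \<rho>') ^ N" for N
  proof -
    have pt: "(r 0 / 2) * \<rho>' ^ N * indicator (ball 0 \<eta>) y - B * \<rho> ^ N * indicator ?Q y
        \<le> indicator ?Q y * (r y * bump y ^ N)" for y
    proof (cases "y \<in> ?Q")
      case False then show ?thesis using ballQ by (auto simp: indicator_def)
    next
      case True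
      then have yK: "y \<in> K" using QK by auto
      have Bn: "0 \<le> B * \<rho> ^ N" using \<open>0 \<le> B\<close> \<rho>(1) by simp
      have bn: "0 \<le> bump y ^ N" using bump_bounds(1)[of y] by simp
      consider "norm y < \<eta>" | "\<not> norm y < \<eta>" "norm y < \<delta>" | "\<not> norm y < \<delta>" by linarith
      then show ?thesis
      proof cases
        case 1
        then have "r y \<ge> r 0 / 2" using \<delta>(2)[OF yK] \<eta>(2) by simp
        moreover have "bump y ^ N \<ge> \<rho>' ^ N" using \<eta>(4)[OF 1] \<rho>'(2) by (intro power_mono) auto
        ultimately have "(r 0 / 2) * \<rho>' ^ N \<le> r y * bump y ^ N"
          using r0 \<rho>'(2) by (intro mult_mono) auto
        then show ?thesis using True 1 Bn by (simp add: indicator_def)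
      next
        case 2
        then have "r y \<ge> 0" using \<delta>(2)[OF yK] r0 by simp
        then have "0 \<le> r y * bump y ^ N" using bn by simp
        then show ?thesis using True 2 Bn by (simp add: indicator_def)
      next
        case 3
        have "- (r y * bump y ^ N) \<le> \<bar>r y\<bar> * bump y ^ N"
          using mult_right_mono[OF abs_ge_minus_self[of "r y"] bn] by simp
        also have "\<dots> \<le> B * \<rho> ^ N"
          using B[OF yK] \<rho>(3)[OF yK 3] bump_bounds(1)[of y] \<open>0 \<le> B\<close> by (intro mult_mono power_mono) auto
        finally show ?thesis using True 3 \<eta>(2) by (simp add: indicator_def)
      qed
    qed
    have ib: "integrable lborel (indicat_real (ball (0::real^'n) \<eta>))"
      by (intro integrable_real_indicator) (use emeasure_lborel_ball_finite[of "0::real^'n" \<eta>] in auto)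
    have "(r 0 / 2) * \<rho>' ^ N * V - B * \<rho> ^ N
        = (LBINT y. (r 0 / 2) * \<rho>' ^ N * indicator (ball 0 \<eta>) y - B * \<rho> ^ N * indicator ?Q y)"
      using ib integrable_indicator_cube[where 'n='n] integral_indicator_cube[where 'n='n]
      by (subst Bochner_Integration.integral_diff) (auto simp: V_def)
    also have "\<dots> \<le> (LBINT y. indicator ?Q y * (r y * bump y ^ N))"
      by (intro integral_mono pt mom) (use ib integrable_indicator_cube[where 'n='n] in auto)
    also have "\<dots> = 0" by (rule mom)
    finally have "(r 0 / 2) * V * \<rho>' ^ N \<le> B * \<rho> ^ N" by (simp add: mult_ac)
    then show ?thesis using \<rho>'(2) by (simp add: power_divide le_divide_eq)
  qed
  have "(\<lambda>N. B * (\<rho> / \<rho>') ^ N) \<longlonglongrightarrow> B * 0"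
    using \<rho>(1) \<rho>'(1,2) by (intro tendsto_mult LIMSEQ_power_zero tendsto_const) simp
  then have "(r 0 / 2) * V \<le> B * 0"
    using ineq by (intro LIMSEQ_le_const[of "\<lambda>N. B * (\<rho> / \<rho>') ^ N"]) auto
  then show False using r0 V by (simp add: mult_le_0_iff)
qed

lemma inner_int_vec: "int_vec k \<bullet> int_vec l = of_int (\<Sum>i\<in>UNIV. k $ i * l $ i)"
  by (simp add: inner_vec_def)

lemma ch_inner_add_int_vec: "ch (int_vec k \<bullet> (y + int_vec l)) = ch (int_vec k \<bullet> y)"
  by (simp add: inner_add_right ch_add inner_int_vec del: of_int_sum)

lemma int_vec_minus: "int_vec (- k) = - int_vec k"
  by (simp add: vec_eq_iff)

text \<open>For \<open>k \<noteq> 0\<close> there is a vector \<open>a\<close> with \<open>k \<bullet> a = 1/2\<close>. Translation by \<open>a\<close> changes the sign of the character, but,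
  by periodicity, not its integral over the cube.\<close>

lemma cube_character_orthogonality:
  "(\<integral>y. indicator unit_cube y *\<^sub>R ch (int_vec k \<bullet> y) \<partial>(lborel :: (real^'n::finite) measure)) = (if k = 0 then 1 else 0)"
proof (cases "k = 0")
  case True
  then show ?thesis by (simp add: emeasure_unit_cube measure_def)
next
  case False
  let ?Q = "unit_cube :: (real^'n) set"
  let ?f = "\<lambda>y::real^'n. indicator ?Q y *\<^sub>R ch (int_vec k \<bullet> y)"
  let ?I = "(LBINT y. ?f y)"
  from False obtain i where i: "k $ i \<noteq> 0" by (auto simp: vec_eq_iff)
  define a where "a = axis i (1 / (2 * real_of_int (k $ i)))"
  have "int_vec k \<bullet> a = 1/2" using i by (simp add: a_def inner_axis)
  moreover have "ch (1/2) = - 1" by (simp add: ch_def)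
  ultimately have "ch (int_vec k \<bullet> a) = - 1" by (simp only:)
  then have a: "ch (int_vec k \<bullet> (a + y)) = - ch (int_vec k \<bullet> y)" for y
    by (simp add: inner_add_right ch_add)
  have fi: "integrable lborel ?f"
    by (rule Bochner_Integration.integrable_bound[OF integrable_indicator_cube[where 'n='n]])
       (auto simp: indicator_def)
  have fm: "?f \<in> borel_measurable borel" using fi by auto
  \<comment> \<open>The integral over the cube translated by \<open>a\<close> is \<open>- ?I\<close> by translation and \<open>?I\<close> by cutting that cube along the
      integer translates of \<open>?Q\<close>.\<close>
  define \<phi> where "\<phi> z = indicator ?Q (z - a) *\<^sub>R ch (int_vec k \<bullet> z)" for z
  have \<phi>m: "\<phi> \<in> borel_measurable borel" unfolding \<phi>_def by measurable
  have \<phi>a: "\<phi> (a + y) = - ?f y" for y by (simp add: \<phi>_def a)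
  have "integrable lborel (\<lambda>y. \<phi> (a + (- a + y)))"
    by (rule lborel_integrable_translation[of "\<lambda>y. \<phi> (a + y)"]) (use fi in \<open>simp add: \<phi>a\<close>)
  then have \<phi>i: "integrable lborel \<phi>" by simp
  have "(LBINT z. \<phi> z) = - ?I"
    using lborel_integral_translation[OF \<phi>m, of a] by (simp add: \<phi>a)
  then have 1: "((\<lambda>l. (LBINT y. indicator ?Q y *\<^sub>R \<phi> (y + int_vec l))) has_sum - ?I) UNIV"
    using has_sum_cube_tiling[OF \<phi>i] by simp
  have per: "ch (int_vec k \<bullet> (y + int_vec l)) = ch (int_vec k \<bullet> y)" for y l
    by (rule ch_inner_add_int_vec)
  have idx: "indicator ?Q (y + int_vec l - a) = (if l = - nearest (y - a) then 1 else (0::real))" for y l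
  proof -
    have "y + int_vec l - a = (y - a) - int_vec (- l)" by (simp add: int_vec_minus)
    then show ?thesis
      using indicator_cube_diff[of "y - a" "- l"] minus_equation_iff[of l] by (simp only:) force
  qed
  have "((\<lambda>l. (LBINT y. indicator ?Q (y + int_vec l - a) *\<^sub>R ?f y)) has_sum ?I) UNIV"
  proof (rule has_sum_integral_partition[OF infinite_int_vec _ fi, where w="\<lambda>l y. indicator ?Q (y + int_vec l - a)"
        and idx="\<lambda>y. - nearest (y - a)"])
    show "(\<lambda>y. indicat_real ?Q (y + int_vec l - a)) \<in> borel_measurable lborel" for l by measurable
  qed (simp, rule idx)
  moreover have "indicator ?Q (y + int_vec l - a) *\<^sub>R ?f y = indicator ?Q y *\<^sub>R \<phi> (y + int_vec l)" for y l
    by (simp add: \<phi>_def per)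
  ultimately have "?I = - ?I" using has_sum_unique[OF 1] by simp
  then show ?thesis using False by simp
qed

text \<open>The periodization of \<open>f\<close> and the series \<open>\<Sum>\<^sub>k c\<^sub>k e\<^bsup>2\<pi>ik\<bullet>y\<^esup>\<close> converge uniformly on the cube, owing to the
  majorants \<open>W\<close> and \<open>\<bar>c\<bar>\<close>, and have the same Fourier coefficients. Hence they agree at the origin.\<close>

theorem poisson_summation_cube:
  fixes f :: "real^'n::finite \<Rightarrow> complex"
  defines "K \<equiv> cbox (- (\<chi> i. 1/2)) ((\<chi> i. 1/2) :: real^'n)"
  assumes cont: "continuous_on UNIV f" and int: "integrable lborel f"
    and W: "W summable_on UNIV" and bound: "\<And>y k. y \<in> K \<Longrightarrow> cmod (f (y + int_vec k)) \<le> W k"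
    and c: "\<And>k. c k = (LBINT y. f y * ch (- (int_vec k \<bullet> y)))"
    and cs: "(\<lambda>k. cmod (c k)) summable_on UNIV"
  shows "((\<lambda>k. f (int_vec k)) has_sum (\<Sum>\<^sub>\<infinity>k. c k)) UNIV"
proof -
  let ?Q = "unit_cube :: (real^'n) set"
  have fm [measurable]: "f \<in> borel_measurable borel" using int by auto
  have QK: "?Q \<subseteq> K" unfolding K_def by (rule unit_cube_subset_cbox)
  have K0: "0 \<in> K" unfolding K_def by (auto simp: mem_box_cart)
  have Wn: "0 \<le> W k" for k using bound[OF K0, of k] norm_ge_zero order_trans by blast
  define P where "P y = (\<Sum>\<^sub>\<infinity>k. f (y + int_vec k))" for y
  define R where "R y = (\<Sum>\<^sub>\<infinity>k. c k * ch (int_vec k \<bullet> y))" for y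
  have Pabs: "(\<lambda>k. cmod (f (y + int_vec k))) summable_on UNIV" if "y \<in> K" for y
    by (rule summable_on_comparison_test[OF W]) (use bound[OF that] in auto)
  have Rabs: "(\<lambda>k. cmod (c k * ch (int_vec k \<bullet> y))) summable_on UNIV" for y
    using cs by (simp add: norm_mult)
  have Pc: "continuous_on K P"
  proof (rule uniform_limit_theorem)
    show "uniform_limit K (\<lambda>X y. \<Sum>k\<in>X. f (y + int_vec k)) P (finite_subsets_at_top UNIV)"
      unfolding P_def by (rule Weierstrass_m_test_general[OF bound W])
    show "\<forall>\<^sub>F X in finite_subsets_at_top UNIV. continuous_on K (\<lambda>y. \<Sum>k\<in>X. f (y + int_vec k))"
      by (intro always_eventually allI continuous_on_sum continuous_on_compose2[OF cont] continuous_intros) auto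
  qed (rule finite_subsets_at_top_neq_bot)
  have Rc: "continuous_on K R"
  proof (rule uniform_limit_theorem)
    show "uniform_limit K (\<lambda>X y. \<Sum>k\<in>X. c k * ch (int_vec k \<bullet> y)) R (finite_subsets_at_top UNIV)"
      unfolding R_def by (rule Weierstrass_m_test_general[OF _ cs]) (simp add: norm_mult)
    show "\<forall>\<^sub>F X in finite_subsets_at_top UNIV. continuous_on K (\<lambda>y. \<Sum>k\<in>X. c k * ch (int_vec k \<bullet> y))"
      by (intro always_eventually allI continuous_intros)
  qed (rule finite_subsets_at_top_neq_bot)
  have indsum: "(\<Sum>\<^sub>\<infinity>k. indicator ?Q y *\<^sub>R g k) = indicator ?Q y *\<^sub>R (\<Sum>\<^sub>\<infinity>k. g k)" for y and g :: "int^'n \<Rightarrow> complex"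
    by (simp add: indicator_def)
  \<comment> \<open>Characters with integer frequencies are periodic, so the integral over the cube unfolds to one over the whole space.\<close>
  have coeffP: "(LBINT y. indicator ?Q y *\<^sub>R (P y * ch (int_vec m \<bullet> y))) = c (- m)"
    and intP: "integrable lborel (\<lambda>y. indicator ?Q y *\<^sub>R (P y * ch (int_vec m \<bullet> y)))" for m
  proof -
    let ?h = "\<lambda>y. f y * ch (int_vec m \<bullet> y)"
    have hi: "integrable lborel ?h" by (rule integrable_bounded_mult[OF int]) auto
    let ?g = "\<lambda>k y. indicator ?Q y *\<^sub>R ?h (y + int_vec k)"
    have le: "norm (?g k y) \<le> W k * indicator ?Q y" for k y
      using bound[of y k] QK by (auto simp: norm_mult indicator_def)
    have gi: "integrable lborel (?g k)" for k
    proof (rule Bochner_Integration.integrable_bound)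
      show "integrable lborel (\<lambda>y. W k * indicator ?Q y)"
        by (intro integrable_mult_right integrable_indicator_cube)
      show "AE y in lborel. norm (?g k y) \<le> norm (W k * indicator ?Q y)"
        using le order_trans[OF le abs_ge_self] by (intro AE_I2) (simp only: real_norm_def)
    qed measurable
    have gs: "(\<lambda>k. norm (?g k y)) summable_on UNIV" for y
      by (rule summable_on_comparison_test[OF summable_on_cmult_left[OF W, of "indicator ?Q y"]]) (use le in auto)
    have gis: "(\<lambda>k. (LBINT y. norm (?g k y))) summable_on UNIV"
    proof (rule summable_on_comparison_test[OF W])
      fix k
      have "(LBINT y. norm (?g k y)) \<le> (LBINT y. W k * indicator ?Q y)"
        by (rule integral_mono[OF integrable_norm[OF gi] integrable_mult_right le]) (rule integrable_indicator_cube)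
      then show "(LBINT y. norm (?g k y)) \<le> W k"
        by (simp add: integral_indicator_cube emeasure_unit_cube measure_def)
    qed simp
    have eq: "(\<Sum>\<^sub>\<infinity>k. ?g k y) = indicator ?Q y *\<^sub>R (P y * ch (int_vec m \<bullet> y))" for y
      unfolding indsum ch_inner_add_int_vec infsum_cmult_left' P_def ..
    show "integrable lborel (\<lambda>y. indicator ?Q y *\<^sub>R (P y * ch (int_vec m \<bullet> y)))"
      using integrable_infsum[OF infinite_int_vec _ gi gs gis] unfolding eq by simp
    have "((\<lambda>k. (LBINT y. ?g k y)) has_sum (LBINT y. indicator ?Q y *\<^sub>R (P y * ch (int_vec m \<bullet> y)))) UNIV"
      using has_sum_integral[OF infinite_int_vec _ gi gs gis] unfolding eq by simp
    from has_sum_unique[OF this has_sum_cube_tiling[OF hi]]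
    show "(LBINT y. indicator ?Q y *\<^sub>R (P y * ch (int_vec m \<bullet> y))) = c (- m)"
      by (simp add: c int_vec_minus)
  qed
  have coeffR: "(LBINT y. indicator ?Q y *\<^sub>R (R y * ch (int_vec m \<bullet> y))) = c (- m)"
    and intR: "integrable lborel (\<lambda>y. indicator ?Q y *\<^sub>R (R y * ch (int_vec m \<bullet> y)))" for m
  proof -
    let ?g = "\<lambda>k y. c k * (indicator ?Q y *\<^sub>R ch (int_vec (k + m) \<bullet> y))"
    have ci: "integrable lborel (\<lambda>y. indicator ?Q y *\<^sub>R ch (int_vec k \<bullet> y))" for k
      by (rule Bochner_Integration.integrable_bound[OF integrable_indicator_cube[where 'n='n]])
         (auto simp: indicator_def)
    have gi: "integrable lborel (?g k)" for k by (intro integrable_mult_right ci)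
    have nrm: "norm (?g k y) = cmod (c k) * indicator ?Q y" for k y by (simp add: norm_mult indicator_def)
    have gs: "(\<lambda>k. norm (?g k y)) summable_on UNIV" for y
      unfolding nrm by (rule summable_on_cmult_left[OF cs])
    have gis: "(\<lambda>k. (LBINT y. norm (?g k y))) summable_on UNIV"
      unfolding nrm using cs by (simp add: emeasure_unit_cube measure_def)
    have eq: "(\<Sum>\<^sub>\<infinity>k. ?g k y) = indicator ?Q y *\<^sub>R (R y * ch (int_vec m \<bullet> y))" for y
    proof -
      have "?g k y = indicator ?Q y *\<^sub>R (c k * ch (int_vec k \<bullet> y) * ch (int_vec m \<bullet> y))" for k
        by (simp add: int_vec_add inner_add_left ch_add)
      then have "(\<Sum>\<^sub>\<infinity>k. ?g k y) = (\<Sum>\<^sub>\<infinity>k. indicator ?Q y *\<^sub>R (c k * ch (int_vec k \<bullet> y) * ch (int_vec m \<bullet> y)))"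
        by (simp only:)
      then show ?thesis unfolding indsum infsum_cmult_left' R_def[symmetric] .
    qed
    show "integrable lborel (\<lambda>y. indicator ?Q y *\<^sub>R (R y * ch (int_vec m \<bullet> y)))"
      using integrable_infsum[OF infinite_int_vec _ gi gs gis] unfolding eq by simp
    have 1: "((\<lambda>k. (LBINT y. ?g k y)) has_sum (LBINT y. indicator ?Q y *\<^sub>R (R y * ch (int_vec m \<bullet> y)))) UNIV"
      using has_sum_integral[OF infinite_int_vec _ gi gs gis] unfolding eq by simp
    have val: "(LBINT y. ?g k y) = (if k = - m then c (- m) else 0)" for k
    proof -
      have "k = - m \<longleftrightarrow> k + m = 0" by (rule eq_neg_iff_add_eq_0)
      then show ?thesis unfolding integral_mult_right_zero cube_character_orthogonality by (cases "k + m = 0") simp_all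
    qed
    have "((\<lambda>k. if k = - m then c (- m) else 0) has_sum c (- m)) UNIV"
      by (rule has_sum_finite_neutralI[of "{- m}"]) auto
    from has_sum_unique[OF 1[unfolded val] this]
    show "(LBINT y. indicator ?Q y *\<^sub>R (R y * ch (int_vec m \<bullet> y))) = c (- m)" .
  qed
  have "P 0 - R 0 = 0"
  proof (rule fourier_coefficients_zero_imp_zero[of "\<lambda>y. P y - R y"])
    show "continuous_on (cbox (- (\<chi> i. 1/2)) ((\<chi> i. 1/2) :: real^'n)) (\<lambda>y. P y - R y)"
      using Pc Rc unfolding K_def by (intro continuous_on_diff)
    show "(LBINT y. indicator ?Q y *\<^sub>R ((P y - R y) * ch (int_vec k \<bullet> y))) = 0" for k
      using intP[of k] intR[of k] coeffP[of k] coeffR[of k]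
      by (simp add: left_diff_distrib scaleR_diff_right)
  qed
  moreover have "((\<lambda>k. f (int_vec k)) has_sum P 0) UNIV"
    using Pabs[OF K0] has_sum_infsum[OF abs_summable_summable, of "\<lambda>k. f (int_vec k)"]
    by (simp add: P_def)
  ultimately show ?thesis by (simp add: R_def)
qed

lemma matrix_inv_left_eq:
  assumes "invertible L" shows "matrix_inv L ** L = mat 1"
  using someI_ex[OF assms[unfolded invertible_def]] unfolding matrix_inv_def by blast

text \<open>The formula for the unit lattice applies to \<open>x \<mapsto> F (L x)\<close>. Since the majorant \<open>V\<close> is moderate, its
  values at the lattice points control \<open>F\<close> on whole cells.\<close>

lemma poisson_summation_lattice:
  fixes F :: "real^'n::finite \<Rightarrow> complex" and L :: "real^'n^'n"
  assumes L: "invertible L" and cont: "continuous_on UNIV F" and int: "integrable lborel F"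
    and FV: "\<And>z. cmod (F z) \<le> V z"
    and mod: "\<And>z x. V (z + x) \<le> (1 + norm x) ^ M * V z"
    and bdd: "\<And>S. finite S \<Longrightarrow> (\<Sum>k\<in>S. V (L *v int_vec k)) \<le> B"
    and c: "\<And>k. c k = (LBINT z. F z * ch (- (int_vec k \<bullet> (matrix_inv L *v z)))) / of_real \<bar>det L\<bar>"
    and cs: "(\<lambda>k. cmod (c k)) summable_on UNIV"
  shows "((\<lambda>k. F (L *v int_vec k)) has_sum (\<Sum>\<^sub>\<infinity>k. c k)) UNIV"
proof -
  let ?K = "cbox (- (\<chi> i. 1/2)) ((\<chi> i. 1/2) :: real^'n)"
  have Fm [measurable]: "F \<in> borel_measurable borel" using int by auto
  have V0: "0 \<le> V z" for z using FV[of z] norm_ge_zero order_trans by blast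
  have Lc: "continuous_on A ((*v) L)" for A by (intro linear_continuous_on matrix_vector_mul_bounded_linear)
  have Lm [measurable]: "(*v) L \<in> borel_measurable borel" "(*v) (matrix_inv L) \<in> borel_measurable borel"
    by (intro linear_borel_measurable, simp)+
  have inv: "matrix_inv L *v (L *v x) = x" for x
    using matrix_inv_left_eq[OF L] by (simp add: matrix_vector_mul_assoc)
  have "bounded ((*v) L ` ?K)"
    by (intro compact_imp_bounded compact_continuous_image Lc compact_cbox)
  then obtain b where b: "\<And>x. x \<in> ?K \<Longrightarrow> norm (L *v x) \<le> b" by (auto simp: bounded_iff)
  show ?thesis
  proof (rule poisson_summation_cube[of "\<lambda>x. F (L *v x)"])
    show "continuous_on UNIV (\<lambda>x. F (L *v x))"
      by (rule continuous_on_compose2[OF cont Lc]) simp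
    show "integrable lborel (\<lambda>x. F (L *v x))"
      using lborel_integrable_matrix[OF L Fm] int by simp
    have "(\<lambda>k. V (L *v int_vec k)) summable_on UNIV"
      by (rule summable_on_norm_iff_bounded[OF V0 bdd])
    then show "(\<lambda>k. (1 + b) ^ M * V (L *v int_vec k)) summable_on UNIV"
      by (rule summable_on_cmult_right)
    show "cmod (F (L *v (y + int_vec k))) \<le> (1 + b) ^ M * V (L *v int_vec k)" if "y \<in> ?K" for y k
    proof -
      have "cmod (F (L *v (y + int_vec k))) \<le> V (L *v int_vec k + L *v y)"
        using FV[of "L *v (y + int_vec k)"] by (simp add: matrix_vector_right_distrib add.commute)
      also have "\<dots> \<le> (1 + norm (L *v y)) ^ M * V (L *v int_vec k)" by (rule mod)
      also have "\<dots> \<le> (1 + b) ^ M * V (L *v int_vec k)"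
        using b[OF that] by (intro mult_right_mono power_mono V0) auto
      finally show ?thesis .
    qed
    show "c k = (LBINT y. F (L *v y) * ch (- (int_vec k \<bullet> y)))" for k
    proof -
      have "(LBINT z. F z * ch (- (int_vec k \<bullet> (matrix_inv L *v z))))
          = \<bar>det L\<bar> *\<^sub>R (LBINT y. F (L *v y) * ch (- (int_vec k \<bullet> y)))"
        by (subst lborel_integral_matrix[OF L]) (measurable, simp add: inv)
      then show ?thesis using L by (simp add: c scaleR_conv_of_real invertible_det_nz)
    qed
  qed (rule cs)
qed

section \<open>The Fourier transform of Schwartz functions\<close>

lemma schwartz_le_decay:
  assumes "schwartz f"
  obtains c where "0 \<le> c" "\<And>x. cmod (f x) \<le> c * decay M x"
proof -
  obtain c where c: "\<forall>x. (1 + norm x) ^ M * cmod (f x) \<le> c"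
    using schwartz_rapidly_decaying[OF assms] unfolding rapidly_decaying_def by blast
  show thesis
  proof (rule that)
    show "0 \<le> c" using c[rule_format, of 0] by (simp add: order_trans[OF norm_ge_zero])
    show "cmod (f x) \<le> c * decay M x" for x
      using c[rule_format, of x] one_plus_norm_pos[of x] by (simp add: decay_def field_simps)
  qed
qed

lemma schwartz_integrable_weight:
  fixes f :: "'d::finite cfun"
  assumes f: "schwartz f"
  shows "integrable lborel (\<lambda>x. (1 + norm x) ^ k * cmod (f x))"
proof -
  let ?M = "DIM(real^'d) + 2"
  obtain c where c: "0 \<le> c" "\<And>x. cmod (f x) \<le> c * decay (?M + k) x"
    using schwartz_le_decay[OF f, of "?M + k"] by auto
  show ?thesis
  proof (rule Bochner_Integration.integrable_bound)
    show "integrable lborel (\<lambda>x::real^'d. c * decay ?M x)"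
      by (intro integrable_mult_right integrable_decay) simp
    have "(1 + norm x) ^ k * cmod (f x) \<le> c * decay ?M x" for x
    proof -
      have "(1 + norm x) ^ k * cmod (f x) \<le> (1 + norm x) ^ k * (c * decay (?M + k) x)"
        by (intro mult_left_mono c) simp
      also have "\<dots> = c * decay ?M x"
        unfolding decay_def power_add using one_plus_norm_pos[of x] by simp
      finally show ?thesis .
    qed
    then show "AE x in lborel. norm ((1 + norm x) ^ k * cmod (f x)) \<le> norm (c * decay ?M x)"
      using c(1) by (intro AE_I2) (simp add: abs_mult)
  qed (use schwartz_borel[OF f] in measurable)
qed

lemma schwartz_integrable: "schwartz f \<Longrightarrow> integrable lborel f"
  using schwartz_integrable_weight[of f 0] schwartz_borel[of f] by (simp add: integrable_norm_iff)

lemma fourier_lborel: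
  assumes [measurable]: "f \<in> borel_measurable borel"
  shows "fourier f w = (LBINT x. f x * ch (- (x \<bullet> w)))"
  unfolding fourier_ch by (intro integral_completion) measurable

lemma integrable_mult_ch:
  assumes "integrable M f" and "g \<in> borel_measurable M"
  shows "integrable M (\<lambda>x. f x * ch (g x))"
  using assms by (intro integrable_bounded_mult) auto

lemma ch_taylor: "cmod (ch s - 1 - 2 * of_real pi * \<i> * of_real s) \<le> (2 * pi * s)\<^sup>2"
  using Taylor_exp[of "2 * of_real pi * \<i> * of_real s" 1]
  by (simp add: ch_def norm_mult power2_eq_square diff_diff_eq mult_ac)

text \<open>An integrable majorant for all difference quotients at once, by the mean value inequality and the moderateness of
  \<open>decay M\<close>.\<close>

lemma schwartz_difference_quotient_le:
  fixes f :: "'d::finite cfun"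
  assumes f: "schwartz f"
  obtains c where "\<And>x t. 0 < t \<Longrightarrow> t \<le> 1 \<Longrightarrow> cmod (f (x + t *\<^sub>R axis j 1) - f x) \<le> t * (c * decay M x)"
proof -
  let ?e = "axis j 1 :: real^'d"
  obtain c where c: "0 \<le> c" "\<And>x. cmod (partial_deriv j f x) \<le> c * decay M x"
    using schwartz_le_decay[OF schwartz_partial_deriv[OF f]] by blast
  show thesis
  proof (rule that)
    fix x :: "real^'d" and t :: real assume t: "0 < t" "t \<le> 1"
    have "norm (f (x + t *\<^sub>R ?e) - f (x + 0 *\<^sub>R ?e)) \<le> c * (2 ^ M * decay M x) * norm (t - 0)"
    proof (rule differentiable_bound[of "{0..t}"])
      fix s assume s: "s \<in> {0..t}"
      let ?D = "\<lambda>h. h *\<^sub>R partial_deriv j f (x + s *\<^sub>R ?e)"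
      have "((\<lambda>s. f (x + s *\<^sub>R ?e)) has_derivative (\<lambda>h. frechet_derivative f (at (x + s *\<^sub>R ?e)) (h *\<^sub>R ?e))) (at s within {0..t})"
        by (rule has_derivative_compose[of "\<lambda>s. x + s *\<^sub>R ?e" "\<lambda>h. h *\<^sub>R ?e" s "{0..t}" f])
           (auto intro!: derivative_eq_intros schwartz_has_derivative f)
      moreover have "linear (frechet_derivative f (at (x + s *\<^sub>R ?e)))"
        using has_derivative_linear[OF schwartz_has_derivative[OF f]] .
      ultimately show "((\<lambda>s. f (x + s *\<^sub>R ?e)) has_derivative ?D) (at s within {0..t})"
        by (simp add: linear_scale partial_deriv_def)
      have "decay M (x + s *\<^sub>R ?e) \<le> (1 + norm (- (s *\<^sub>R ?e))) ^ M * decay M (x + s *\<^sub>R ?e + - (s *\<^sub>R ?e))"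
        by (rule decay_shift)
      also have "\<dots> \<le> 2 ^ M * decay M x"
        using s t by (intro mult_mono power_mono) auto
      finally have "norm (partial_deriv j f (x + s *\<^sub>R ?e)) \<le> c * (2 ^ M * decay M x)"
        using c(2)[of "x + s *\<^sub>R ?e"] c(1) by (meson mult_left_mono order_trans)
      then show "onorm ?D \<le> c * (2 ^ M * decay M x)"
        by (intro onorm_le) (metis abs_ge_zero mult.commute mult_left_mono norm_scaleR real_norm_def)
    qed (use t in auto)
    then show "cmod (f (x + t *\<^sub>R ?e) - f x) \<le> t * (c * 2 ^ M * decay M x)" using t by (simp add: mult_ac)
  qed
qed

text \<open>Translation of \<open>f\<close> by \<open>-t\<close> along the \<open>j\<close>-th axis multiplies its Fourier transform by \<open>e\<^bsup>2\<pi>itw\<^sub>j\<^esup>\<close>. The claim is the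
  derivative of this identity at \<open>t = 0\<close>.\<close>

lemma fourier_partial_deriv:
  fixes f :: "'d::finite cfun"
  assumes f: "schwartz f"
  shows "fourier (partial_deriv j f) w = 2 * of_real pi * \<i> * of_real (w $ j) * fourier f w"
proof -
  let ?e = "axis j 1 :: real^'d"
  let ?M = "DIM(real^'d) + 2"
  have fm [measurable]: "f \<in> borel_measurable borel" by (rule schwartz_borel[OF f])
  have fi: "integrable lborel f" by (rule schwartz_integrable[OF f])
  define t where "t n = 1 / real (Suc n)" for n
  have t: "0 < t n" "t n \<le> 1" for n by (auto simp: t_def)
  have tn: "t \<longlonglongrightarrow> 0" unfolding t_def using LIMSEQ_Suc[OF lim_1_over_n] by simp
  define q where "q n x = (f (x + t n *\<^sub>R ?e) - f x) / of_real (t n)" for n x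
  obtain c where c: "\<And>x t. 0 < t \<Longrightarrow> t \<le> 1 \<Longrightarrow> cmod (f (x + t *\<^sub>R ?e) - f x) \<le> t * (c * decay ?M x)"
    using schwartz_difference_quotient_le[OF f] by blast
  have "(\<lambda>n. (LBINT x. q n x * ch (- (x \<bullet> w)))) \<longlonglongrightarrow> (LBINT x. partial_deriv j f x * ch (- (x \<bullet> w)))"
  proof (rule integral_dominated_convergence[where w="\<lambda>x. c * decay ?M x"])
    show "integrable lborel (\<lambda>x::real^'d. c * decay ?M x)"
      by (intro integrable_mult_right integrable_decay) simp
    show "AE x in lborel. (\<lambda>n. q n x * ch (- (x \<bullet> w))) \<longlonglongrightarrow> partial_deriv j f x * ch (- (x \<bullet> w))"
    proof (intro AE_I2 tendsto_mult tendsto_const)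
      fix x
      have lin: "linear (frechet_derivative f (at x))"
        using has_derivative_linear[OF schwartz_has_derivative[OF f]] .
      have "((\<lambda>h. norm (f (x + h) - f x - frechet_derivative f (at x) h) / norm h) \<longlongrightarrow> 0) (at 0)"
        using schwartz_has_derivative[OF f, of x] unfolding has_derivative_at by blast
      moreover have "filterlim (\<lambda>n. t n *\<^sub>R ?e) (at 0) sequentially"
        unfolding filterlim_at using t(1) tendsto_scaleR[OF tn tendsto_const[of ?e]]
        by (auto simp: axis_eq_0_iff less_imp_neq[THEN not_sym])
      ultimately have "(\<lambda>n. norm (f (x + t n *\<^sub>R ?e) - f x - frechet_derivative f (at x) (t n *\<^sub>R ?e)) / norm (t n *\<^sub>R ?e)) \<longlonglongrightarrow> 0"
        by (rule filterlim_compose)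
      moreover have "norm (f (x + t n *\<^sub>R ?e) - f x - frechet_derivative f (at x) (t n *\<^sub>R ?e)) / norm (t n *\<^sub>R ?e)
          = norm (q n x - partial_deriv j f x)" for n
      proof -
        have "q n x - partial_deriv j f x = (f (x + t n *\<^sub>R ?e) - f x - of_real (t n) * partial_deriv j f x) / of_real (t n)"
          using t(1)[of n] by (simp add: q_def field_simps)
        then show ?thesis using t(1)[of n] scaleR_conv_of_real[of "t n" "partial_deriv j f x"]
          by (simp add: norm_divide linear_scale[OF lin] partial_deriv_def)
      qed
      ultimately show "(\<lambda>n. q n x) \<longlonglongrightarrow> partial_deriv j f x"
        by (simp add: tendsto_norm_zero_iff LIM_zero_iff)
    qed
    show "AE x in lborel. norm (q n x * ch (- (x \<bullet> w))) \<le> c * decay ?M x" for n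
    proof (intro AE_I2)
      fix x
      show "norm (q n x * ch (- (x \<bullet> w))) \<le> c * decay ?M x"
        using c[OF t(1)[of n] t(2)[of n], of x] t(1)[of n] by (simp add: q_def norm_mult norm_divide divide_le_eq mult_ac)
    qed
    show "(\<lambda>x. partial_deriv j f x * ch (- (x \<bullet> w))) \<in> borel_measurable lborel"
      using schwartz_borel[OF schwartz_partial_deriv[OF f]] by measurable
    show "(\<lambda>x. q n x * ch (- (x \<bullet> w))) \<in> borel_measurable lborel" for n
      unfolding q_def by measurable
  qed
  moreover have "(LBINT x. q n x * ch (- (x \<bullet> w))) = (ch (t n * w $ j) - 1) / of_real (t n) * fourier f w" for n
  proof -
    have i: "integrable lborel (\<lambda>x. f x * ch (- (x \<bullet> w)))" by (intro integrable_mult_ch fi) measurable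
    have i2: "integrable lborel (\<lambda>x. f (x + t n *\<^sub>R ?e) * ch (- (x \<bullet> w)))"
      by (intro integrable_mult_ch) (use lborel_integrable_translation[OF fi, of "t n *\<^sub>R ?e"] in \<open>simp_all add: add.commute\<close>)
    have "(LBINT x. f (x + t n *\<^sub>R ?e) * ch (- (x \<bullet> w)))
        = (LBINT x. ch (t n * w $ j) * (f (t n *\<^sub>R ?e + x) * ch (- ((t n *\<^sub>R ?e + x) \<bullet> w))))"
    proof (rule Bochner_Integration.integral_cong[OF refl])
      fix x
      have "- (x \<bullet> w) = t n * w $ j + - ((t n *\<^sub>R ?e + x) \<bullet> w)"
        by (simp add: inner_add_left inner_axis')
      then show "f (x + t n *\<^sub>R ?e) * ch (- (x \<bullet> w))
          = ch (t n * w $ j) * (f (t n *\<^sub>R ?e + x) * ch (- ((t n *\<^sub>R ?e + x) \<bullet> w)))"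
        by (simp only: ch_add add.commute[of x] mult_ac)
    qed
    also have "\<dots> = ch (t n * w $ j) * fourier f w"
      using lborel_integral_translation[of "\<lambda>x. f x * ch (- (x \<bullet> w))" "t n *\<^sub>R ?e"]
      by (simp add: fourier_lborel)
    finally have "(LBINT x. f (x + t n *\<^sub>R ?e) * ch (- (x \<bullet> w)) - f x * ch (- (x \<bullet> w)))
        = (ch (t n * w $ j) - 1) * fourier f w"
      using i i2 by (simp add: fourier_lborel left_diff_distrib)
    moreover have "q n x * ch (- (x \<bullet> w)) = (f (x + t n *\<^sub>R ?e) * ch (- (x \<bullet> w)) - f x * ch (- (x \<bullet> w))) / of_real (t n)" for x
      by (simp add: q_def left_diff_distrib)
    ultimately show ?thesis by simp
  qed
  moreover have "(\<lambda>n. (ch (t n * w $ j) - 1) / of_real (t n)) \<longlonglongrightarrow> 2 * of_real pi * \<i> * of_real (w $ j)"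
  proof (rule LIM_zero_cancel, rule Lim_null_comparison)
    show "(\<lambda>n. (2 * pi * (w $ j))\<^sup>2 * t n) \<longlonglongrightarrow> 0"
      using tendsto_mult_right_zero[OF tn] by blast
    show "\<forall>\<^sub>F n in sequentially. norm ((ch (t n * w $ j) - 1) / of_real (t n) - 2 * of_real pi * \<i> * of_real (w $ j))
        \<le> (2 * pi * (w $ j))\<^sup>2 * t n"
    proof (intro always_eventually allI)
      fix n
      have "(ch (t n * w $ j) - 1) / of_real (t n) - 2 * of_real pi * \<i> * of_real (w $ j)
          = (ch (t n * w $ j) - 1 - 2 * of_real pi * \<i> * of_real (t n * w $ j)) / of_real (t n)"
        using t(1)[of n] by (simp add: field_simps)
      also have "norm \<dots> \<le> (2 * pi * (t n * w $ j))\<^sup>2 / t n"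
        using ch_taylor[of "t n * w $ j"] t(1)[of n] by (simp add: norm_divide divide_right_mono del: of_real_mult)
      also have "\<dots> = (2 * pi * (w $ j))\<^sup>2 * t n"
        using t(1)[of n] by (simp add: power2_eq_square)
      finally show "norm ((ch (t n * w $ j) - 1) / of_real (t n) - 2 * of_real pi * \<i> * of_real (w $ j))
        \<le> (2 * pi * (w $ j))\<^sup>2 * t n" .
    qed
  qed
  ultimately have "(\<lambda>n. (ch (t n * w $ j) - 1) / of_real (t n) * fourier f w) \<longlonglongrightarrow> fourier (partial_deriv j f) w"
    and "(\<lambda>n. (ch (t n * w $ j) - 1) / of_real (t n) * fourier f w) \<longlonglongrightarrow> 2 * of_real pi * \<i> * of_real (w $ j) * fourier f w"
    by (simp_all only: fourier_lborel[OF schwartz_borel[OF schwartz_partial_deriv[OF f]]] tendsto_mult_right)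
  then show ?thesis by (rule LIMSEQ_unique)
qed

lemma norm_integral_le:
  fixes f :: "'a \<Rightarrow> 'b::{banach, second_countable_topology}"
  assumes "integrable M f" "integrable M g" "\<And>x. norm (f x) \<le> g x"
  shows "norm (\<integral>x. f x \<partial>M) \<le> (\<integral>x. g x \<partial>M)"
  using integral_norm_bound[of M f] integral_mono[OF integrable_norm[OF assms(1)] assms(2,3)] by linarith

lemma schwartz_integrable_norm_power_mult:
  assumes "schwartz f" shows "integrable lborel (\<lambda>x. norm x ^ k * cmod (f x))"
proof (rule Bochner_Integration.integrable_bound[OF schwartz_integrable_weight[OF assms, of k]])
  show "AE x in lborel. norm (norm x ^ k * cmod (f x)) \<le> norm ((1 + norm x) ^ k * cmod (f x))"
    by (intro AE_I2) (auto simp: abs_mult intro!: mult_right_mono power_mono)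
qed (use schwartz_borel[OF assms] in measurable)

text \<open>The error of the linear approximation to \<open>e\<^bsup>-2\<pi>ix\<bullet>h\<^esup>\<close> is at most a constant times \<open>\<bar>x\<bar>\<^sup>2 \<bar>h\<bar>\<^sup>2\<close>, and
  \<open>\<bar>x\<bar>\<^sup>2 f(x)\<close> is integrable.\<close>

lemma has_derivative_fourier:
  fixes f :: "'d::finite cfun"
  assumes f: "schwartz f"
  shows "(fourier f has_derivative
    (\<lambda>h. (LBINT x. - (2 * of_real pi * \<i> * of_real (x \<bullet> h)) * f x * ch (- (x \<bullet> w))))) (at w)"
    (is "(_ has_derivative ?D) _")
proof -
  have fm [measurable]: "f \<in> borel_measurable borel" by (rule schwartz_borel[OF f])
  have fi: "integrable lborel (\<lambda>x. f x * ch (- (x \<bullet> w)))" for w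
    by (intro integrable_mult_ch schwartz_integrable f) measurable
  let ?g = "\<lambda>h x. - (2 * of_real pi * \<i> * of_real (x \<bullet> h)) * f x * ch (- (x \<bullet> w))"
  note i1 = schwartz_integrable_norm_power_mult[OF f, of 1, simplified]
  note i2 = schwartz_integrable_norm_power_mult[OF f, of 2]
  have gle: "norm (?g h x) \<le> 2 * pi * norm h * (norm x * cmod (f x))" for h x
  proof -
    have "norm (?g h x) = 2 * pi * \<bar>x \<bullet> h\<bar> * cmod (f x)" by (simp add: norm_mult)
    also have "\<dots> \<le> 2 * pi * (norm x * norm h) * cmod (f x)"
      by (intro mult_right_mono mult_left_mono Cauchy_Schwarz_ineq2) auto
    finally show ?thesis by (simp add: mult_ac)
  qed
  have gi: "integrable lborel (?g h)" for h
  proof (rule Bochner_Integration.integrable_bound[OF integrable_mult_right[OF i1, of "2 * pi * norm h"]])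
    show "AE x in lborel. norm (?g h x) \<le> norm (2 * pi * norm h * (norm x * cmod (f x)))"
      using order_trans[OF gle abs_ge_self] by (intro AE_I2) (simp only: real_norm_def)
  qed measurable
  have bl: "bounded_linear ?D"
  proof (rule bounded_linear_intro[where K="2 * pi * (LBINT x. norm x * cmod (f x))"])
    show "?D (a + b) = ?D a + ?D b" for a b
    proof -
      have "?g (a + b) x = ?g a x + ?g b x" for x by (simp add: inner_add_right algebra_simps)
      then have "?D (a + b) = (LBINT x. ?g a x + ?g b x)" by presburger
      then show ?thesis using Bochner_Integration.integral_add[OF gi gi] by presburger
    qed
    show "?D (r *\<^sub>R a) = r *\<^sub>R ?D a" for r a
    proof -
      have "?g (r *\<^sub>R a) x = r *\<^sub>R ?g a x" for x by (simp add: scaleR_conv_of_real[where 'a=complex])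
      then have "?D (r *\<^sub>R a) = (LBINT x. r *\<^sub>R ?g a x)" by presburger
      then show ?thesis using integral_scaleR_right[of lborel r "?g a"] gi by presburger
    qed
    show "norm (?D h) \<le> norm h * (2 * pi * (LBINT x. norm x * cmod (f x)))" for h
    proof -
      have "norm (?D h) \<le> (LBINT x. 2 * pi * norm h * (norm x * cmod (f x)))"
        by (rule norm_integral_le[OF gi integrable_mult_right[OF i1] gle])
      also have "\<dots> = norm h * (2 * pi * (LBINT x. norm x * cmod (f x)))"
        unfolding integral_mult_right_zero by (simp only: mult_ac)
      finally show ?thesis .
    qed
  qed
  define C where "C = (2 * pi)\<^sup>2 * (LBINT x. norm x ^ 2 * cmod (f x))"
  have C: "0 \<le> C" unfolding C_def by (intro mult_nonneg_nonneg integral_nonneg_AE) auto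
  have err: "norm (fourier f (w + h) - fourier f w - ?D h) \<le> C * (norm h)\<^sup>2" for h
  proof -
    have "fourier f (w + h) - fourier f w - ?D h
        = (LBINT x. f x * ch (- (x \<bullet> (w + h))) - f x * ch (- (x \<bullet> w)) - ?g h x)"
      using fi[of w] fi[of "w + h"] gi[of h] by (simp add: fourier_lborel)
    also have "norm \<dots> \<le> (LBINT x. (2 * pi)\<^sup>2 * (norm h)\<^sup>2 * (norm x ^ 2 * cmod (f x)))"
    proof (rule norm_integral_le)
      show "integrable lborel (\<lambda>x. f x * ch (- (x \<bullet> (w + h))) - f x * ch (- (x \<bullet> w)) - ?g h x)"
        by (intro Bochner_Integration.integrable_diff fi gi)
      show "integrable lborel (\<lambda>x. (2 * pi)\<^sup>2 * (norm h)\<^sup>2 * (norm x ^ 2 * cmod (f x)))"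
        by (intro integrable_mult_right i2)
      fix x
      have "- (x \<bullet> (w + h)) = - (x \<bullet> w) + - (x \<bullet> h)" by (simp add: inner_add_right)
      then have eq: "f x * ch (- (x \<bullet> (w + h))) - f x * ch (- (x \<bullet> w)) - ?g h x
          = f x * ch (- (x \<bullet> w)) * (ch (- (x \<bullet> h)) - 1 - 2 * of_real pi * \<i> * of_real (- (x \<bullet> h)))"
        by (simp only: ch_add) (simp add: algebra_simps)
      have "\<bar>x \<bullet> h\<bar> \<le> norm x * norm h" by (rule Cauchy_Schwarz_ineq2)
      then have "(2 * pi * (- (x \<bullet> h)))\<^sup>2 \<le> (2 * pi * (norm x * norm h))\<^sup>2"
        by (simp add: abs_le_square_iff[symmetric] abs_mult)
      then have le: "cmod (ch (- (x \<bullet> h)) - 1 - 2 * of_real pi * \<i> * of_real (- (x \<bullet> h))) \<le> (2 * pi * (norm x * norm h))\<^sup>2"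
        using ch_taylor[of "- (x \<bullet> h)"] by linarith
      have "(2 * pi)\<^sup>2 * (norm h)\<^sup>2 * (norm x ^ 2 * cmod (f x)) = cmod (f x) * (2 * pi * (norm x * norm h))\<^sup>2"
        by (simp only: power_mult_distrib mult_ac)
      then show "norm (f x * ch (- (x \<bullet> (w + h))) - f x * ch (- (x \<bullet> w)) - ?g h x)
          \<le> (2 * pi)\<^sup>2 * (norm h)\<^sup>2 * (norm x ^ 2 * cmod (f x))"
        unfolding eq norm_mult norm_ch mult_1_right using mult_left_mono[OF le norm_ge_zero[of "f x"]] by presburger
    qed
    also have "\<dots> = C * (norm h)\<^sup>2" unfolding C_def integral_mult_right_zero by (simp only: mult_ac)
    finally show ?thesis .
  qed
  have "((\<lambda>h. norm (fourier f (w + h) - fourier f w - ?D h) / norm h) \<longlongrightarrow> 0) (at 0)"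
  proof (rule Lim_null_comparison)
    show "((\<lambda>h::real^'d. C * norm h) \<longlongrightarrow> 0) (at 0)"
      by (rule tendsto_eq_intros | simp)+
    show "\<forall>\<^sub>F h in at 0. norm (norm (fourier f (w + h) - fourier f w - ?D h) / norm h) \<le> C * norm h"
      unfolding eventually_at_filter
    proof (intro always_eventually allI impI)
      fix h :: "real^'d" assume "h \<noteq> 0"
      then show "norm (norm (fourier f (w + h) - fourier f w - ?D h) / norm h) \<le> C * norm h"
        using err[of h] by (simp only: real_norm_def abs_divide abs_norm_cancel divide_le_eq) (simp add: power2_eq_square mult.assoc)
    qed
  qed
  with bl show ?thesis unfolding has_derivative_at by blast
qed

lemma partial_deriv_fourier:
  fixes f :: "'d::finite cfun"
  assumes f: "schwartz f"
  shows "partial_deriv j (fourier f) = fourier (\<lambda>x. - (2 * of_real pi * \<i>) * (of_real (x $ j) * f x))"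
proof -
  have fm [measurable]: "f \<in> borel_measurable borel" by (rule schwartz_borel[OF f])
  show ?thesis
    unfolding partial_deriv_eqI[OF has_derivative_fourier[OF f]]
    by (rule ext, subst fourier_lborel, measurable, intro Bochner_Integration.integral_cong)
       (simp_all add: inner_axis)
qed

lemma fourier_bounded:
  assumes "schwartz f" shows "cmod (fourier f w) \<le> (LBINT x. cmod (f x))"
proof -
  have "integrable lborel (\<lambda>x. f x * ch (- (x \<bullet> w)))"
    by (intro integrable_mult_ch schwartz_integrable assms) measurable
  then show ?thesis
    using integral_norm_bound[of lborel "\<lambda>x. f x * ch (- (x \<bullet> w))"]
    by (simp add: fourier_lborel[OF schwartz_borel[OF assms]] norm_mult)
qed

text \<open>One more power of decay of the transform of \<open>f\<close> comes from the decay of the transforms of the partial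
  derivatives of \<open>f\<close>, in which the frequency coordinates appear as factors.\<close>

lemma rapidly_decaying_fourier:
  fixes f :: "'d::finite cfun"
  assumes "schwartz f" shows "rapidly_decaying (fourier f)"
  unfolding rapidly_decaying_def
proof
  fix N
  show "\<exists>c. \<forall>w. (1 + norm w) ^ N * cmod (fourier f w) \<le> c"
    using assms
  proof (induction N arbitrary: f)
    case 0
    then show ?case using fourier_bounded by auto
  next
    case (Suc N)
    from Suc.IH[OF Suc.prems] obtain c where c: "\<forall>w. (1 + norm w) ^ N * cmod (fourier f w) \<le> c" by blast
    have "\<forall>j. \<exists>b. \<forall>w. (1 + norm w) ^ N * cmod (fourier (partial_deriv j f) w) \<le> b"
      using Suc.IH[OF schwartz_partial_deriv[OF Suc.prems]] by blast
    then obtain b where b: "\<And>j w. (1 + norm w) ^ N * cmod (fourier (partial_deriv j f) w) \<le> b j" by metis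
    have "(1 + norm w) ^ Suc N * cmod (fourier f w) \<le> c + (\<Sum>j\<in>UNIV. b j)" for w
    proof -
      let ?A = "(1 + norm w) ^ N"
      have A: "0 \<le> ?A" by simp
      have "norm w * (?A * cmod (fourier f w)) \<le> (\<Sum>j\<in>UNIV. \<bar>w $ j\<bar>) * (?A * cmod (fourier f w))"
        by (intro mult_right_mono norm_le_l1_cart) auto
      also have "\<dots> = (\<Sum>j\<in>UNIV. ?A * (\<bar>w $ j\<bar> * cmod (fourier f w)))"
        by (simp add: sum_distrib_left sum_distrib_right mult_ac)
      also have "\<dots> \<le> (\<Sum>j\<in>UNIV. b j)"
      proof (rule sum_mono)
        fix j
        have "\<bar>w $ j\<bar> * cmod (fourier f w) \<le> 2 * pi * (\<bar>w $ j\<bar> * cmod (fourier f w))"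
          using pi_ge_two mult_right_mono[of 1 "2 * pi" "\<bar>w $ j\<bar> * cmod (fourier f w)"] by simp
        also have "\<dots> = cmod (fourier (partial_deriv j f) w)"
          by (simp add: fourier_partial_deriv[OF Suc.prems] norm_mult)
        finally show "?A * (\<bar>w $ j\<bar> * cmod (fourier f w)) \<le> b j"
          using b[of w j] A by (meson mult_left_mono order_trans)
      qed
      finally have "norm w * (?A * cmod (fourier f w)) \<le> (\<Sum>j\<in>UNIV. b j)" .
      with c[rule_format, of w] show ?thesis by (simp add: algebra_simps)
    qed
    then show ?case by blast
  qed
qed

theorem schwartz_fourier:
  assumes "schwartz f" shows "schwartz (fourier f)"
proof (rule schwartz_coinduct[where K="fourier ` Collect schwartz"])
  fix h i assume "h \<in> fourier ` Collect schwartz"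
  then obtain f where f: "schwartz f" "h = fourier f" by auto
  have "schwartz (\<lambda>x. - (2 * of_real pi * \<i>) * (of_real (x $ i) * f x))"
    by (intro schwartz_cmult schwartz_mult_coord f)
  then show "partial_deriv i h \<in> fourier ` Collect schwartz"
    unfolding f(2) partial_deriv_fourier[OF f(1)] by blast
next
  fix h x assume "h \<in> fourier ` Collect schwartz"
  then show "h differentiable (at x)" using has_derivative_fourier differentiableI by blast
qed (use assms rapidly_decaying_fourier in auto)

section \<open>Fourier inversion\<close>

lemma mat_mult_vec: "mat r *v x = r *\<^sub>R (x :: real^'n::finite)"
  by (simp add: matrix_vector_mult_def mat_def vec_eq_iff if_distrib[of "\<lambda>a. a * _"] cong: if_cong)

lemma det_mat: "det (mat r :: real^'n^'n::finite) = r ^ CARD('n)"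
  by (subst det_diagonal) (auto simp: mat_def)

lemma invertible_mat: "r \<noteq> 0 \<Longrightarrow> invertible (mat r :: real^'n^'n::finite)"
  by (simp add: invertible_det_nz det_mat)

lemma matrix_inv_mat_mult_vec:
  assumes "r \<noteq> 0" shows "matrix_inv (mat r) *v x = (x /\<^sub>R r :: real^'n::finite)"
proof -
  have "matrix_inv (mat r) *v (mat r *v (x /\<^sub>R r)) = x /\<^sub>R r"
    using matrix_inv_left_eq[OF invertible_mat[OF assms, where 'n='n]] by (simp add: matrix_vector_mul_assoc)
  then show ?thesis using assms by (simp add: mat_mult_vec)
qed

lemma nearest_cube_add: "y \<in> unit_cube \<Longrightarrow> nearest (y + int_vec k) = k"
  using diff_int_vec_in_cube_iff[of "y + int_vec k" k] by simp

lemma norm_nearest_diff: "norm (z - int_vec (nearest z)) \<le> real CARD('n)" for z :: "real^'n::finite"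
  by (rule norm_unit_cube_le) (simp add: diff_int_vec_in_cube_iff)

lemma borel_measurable_int_vec_nearest [measurable]:
  "(\<lambda>z::real^'n::finite. int_vec (nearest z)) \<in> borel_measurable borel"
proof -
  have "int_vec (nearest z) = (\<Sum>i\<in>UNIV. of_int \<lfloor>z $ i + 1/2\<rfloor> *\<^sub>R axis i 1)" for z :: "real^'n"
    by (simp add: vec_eq_iff nearest_def axis_def if_distrib[of "\<lambda>a. _ * a"] cong: if_cong)
  then show ?thesis by simp
qed

lemma decay_scale_le: "1 \<le> r \<Longrightarrow> decay M (r *\<^sub>R x) \<le> decay M (x :: 'a::real_normed_vector)"
  unfolding decay_def
  by (intro divide_left_mono power_mono add_left_mono mult_pos_pos zero_less_power one_plus_norm_pos)
     (auto simp: mult_le_cancel_right1 dest: less_le_trans)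

lemma decay_minus [simp]: "decay M (- x) = decay M x"
  by (simp add: decay_def)

lemma norm_rounding_error:
  fixes x :: "real^'n::finite"
  assumes "r > 0"
  shows "norm (x - int_vec (nearest (r *\<^sub>R x)) /\<^sub>R r) \<le> real CARD('n) / r"
proof -
  have "x - int_vec (nearest (r *\<^sub>R x)) /\<^sub>R r = (r *\<^sub>R x - int_vec (nearest (r *\<^sub>R x))) /\<^sub>R r"
    using assms by (simp add: scaleR_right_diff_distrib)
  then have "norm (x - int_vec (nearest (r *\<^sub>R x)) /\<^sub>R r) = norm (r *\<^sub>R x - int_vec (nearest (r *\<^sub>R x))) / r"
    using assms by (simp add: divide_inverse mult.commute)
  with assms show ?thesis using norm_nearest_diff[of "r *\<^sub>R x"] by (simp add: divide_right_mono)
qed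

lemma decay_rounding_le:
  fixes x :: "real^'n::finite"
  assumes "r \<ge> 1"
  shows "decay M (int_vec (nearest (r *\<^sub>R x)) /\<^sub>R r) \<le> (1 + real CARD('n)) ^ M * decay M x"
proof -
  let ?a = "int_vec (nearest (r *\<^sub>R x)) /\<^sub>R r"
  have "real CARD('n) / r \<le> real CARD('n)" using assms by (simp add: divide_le_eq mult_le_cancel_left1)
  then have n: "norm (x - ?a) \<le> real CARD('n)" using norm_rounding_error[of r x] assms by linarith
  have "decay M ?a \<le> (1 + norm (x - ?a)) ^ M * decay M (?a + (x - ?a))" by (rule decay_shift)
  also have "\<dots> \<le> (1 + real CARD('n)) ^ M * decay M (?a + (x - ?a))"
    by (intro mult_right_mono power_mono add_left_mono n) auto
  finally show ?thesis by simp
qed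

text \<open>The Riemann sum with mesh \<open>1/r\<close> is the integral of the step function that evaluates \<open>k\<close> at the nearest
  point of the mesh.\<close>

lemma riemann_sum_integral:
  fixes k :: "real^'n::finite \<Rightarrow> complex"
  assumes km [measurable]: "k \<in> borel_measurable borel" and r: "r \<ge> 1"
    and si: "integrable lborel (\<lambda>x. k (int_vec (nearest (r *\<^sub>R x)) /\<^sub>R r))"
  shows "((\<lambda>m. k (int_vec m /\<^sub>R r) / of_real (r ^ CARD('n))) has_sum
    (LBINT x. k (int_vec (nearest (r *\<^sub>R x)) /\<^sub>R r))) UNIV"
proof -
  let ?g = "\<lambda>x::real^'n. k (int_vec (nearest x) /\<^sub>R r)"
  have r0: "r \<noteq> 0" using r by simp
  have gm: "?g \<in> borel_measurable borel" by measurable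
  have gi: "integrable lborel ?g" using lborel_integrable_scale[OF gm r0] si by simp
  have "(LBINT z. indicator unit_cube z *\<^sub>R ?g (z + int_vec m)) = k (int_vec m /\<^sub>R r)" for m
  proof -
    have "(\<lambda>z. indicator unit_cube z *\<^sub>R ?g (z + int_vec m)) = (\<lambda>z. indicator unit_cube z *\<^sub>R k (int_vec m /\<^sub>R r))"
      by (rule ext) (auto simp: nearest_cube_add indicator_def)
    then show ?thesis by (simp add: emeasure_unit_cube measure_def)
  qed
  then have "((\<lambda>m. k (int_vec m /\<^sub>R r)) has_sum (LBINT x. ?g x)) UNIV"
    using has_sum_cube_tiling[OF gi] by simp
  then have "((\<lambda>m. k (int_vec m /\<^sub>R r) / of_real (r ^ CARD('n))) has_sum (LBINT x. ?g x) / of_real (r ^ CARD('n))) UNIV"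
    by (rule has_sum_divide_const)
  moreover have "(LBINT x. ?g x) / of_real (r ^ CARD('n)) = (LBINT x. ?g (r *\<^sub>R x))"
    using lborel_integral_scale[OF gm r0] r by (simp add: scaleR_conv_of_real)
  ultimately show ?thesis by simp
qed

lemma riemann_sums_tendsto:
  fixes k :: "real^'n::finite \<Rightarrow> complex"
  assumes kc: "continuous_on UNIV k" and kd: "\<And>x. cmod (k x) \<le> c * decay (CARD('n) + 2) x" and c: "0 \<le> c"
  obtains I where "\<And>j. ((\<lambda>m. k (int_vec m /\<^sub>R real (Suc j)) / of_real (real (Suc j) ^ CARD('n))) has_sum I j) UNIV"
    and "I \<longlonglongrightarrow> (LBINT x. k x)"
proof -
  let ?M = "CARD('n) + 2"
  have km [measurable]: "k \<in> borel_measurable borel" by (rule borel_measurable_continuous_onI[OF kc])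
  define s where "s r x = k (int_vec (nearest (r *\<^sub>R x)) /\<^sub>R r)" for r x
  have sm [measurable]: "s r \<in> borel_measurable borel" for r unfolding s_def by measurable
  let ?D = "\<lambda>x::real^'n. c * ((1 + real CARD('n)) ^ ?M * decay ?M x)"
  have sbound: "norm (s r x) \<le> ?D x" if "r \<ge> 1" for r x
    unfolding s_def using order_trans[OF kd mult_left_mono[OF decay_rounding_le[OF that] c]] .
  have di: "integrable lborel ?D" by (intro integrable_mult_right integrable_decay) simp
  have si: "integrable lborel (s r)" if "r \<ge> 1" for r
    by (rule Bochner_Integration.integrable_bound[OF di])
       (use order_trans[OF sbound[OF that] abs_ge_self] in \<open>auto intro!: AE_I2\<close>)
  have "(\<lambda>j. (LBINT x. s (real (Suc j)) x)) \<longlonglongrightarrow> (LBINT x. k x)"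
  proof (rule integral_dominated_convergence[OF _ _ di])
    have kc': "isCont k x" for x using kc by (simp add: continuous_on_eq_continuous_at)
    show "AE x in lborel. (\<lambda>j. s (real (Suc j)) x) \<longlonglongrightarrow> k x"
    proof (rule AE_I2)
      fix x :: "real^'n"
      have "(\<lambda>j. real CARD('n) * (1 / real (Suc j))) \<longlonglongrightarrow> real CARD('n) * 0"
        using LIMSEQ_Suc[OF lim_1_over_n] by (intro tendsto_mult tendsto_const) simp
      then have "(\<lambda>j. real CARD('n) / real (Suc j)) \<longlonglongrightarrow> 0" by simp
      then have "(\<lambda>j. x - int_vec (nearest (real (Suc j) *\<^sub>R x)) /\<^sub>R real (Suc j)) \<longlonglongrightarrow> 0"
        by (rule Lim_null_comparison[rotated]) (intro always_eventually allI norm_rounding_error, simp)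
      then have "(\<lambda>j. x - (x - int_vec (nearest (real (Suc j) *\<^sub>R x)) /\<^sub>R real (Suc j))) \<longlonglongrightarrow> x - 0"
        by (intro tendsto_diff tendsto_const)
      then have "(\<lambda>j. int_vec (nearest (real (Suc j) *\<^sub>R x)) /\<^sub>R real (Suc j)) \<longlonglongrightarrow> x"
        by (simp only: diff_diff_eq2 add_diff_cancel_left' diff_0_right)
      then show "(\<lambda>j. s (real (Suc j)) x) \<longlonglongrightarrow> k x"
        unfolding s_def by (rule isCont_tendsto_compose[OF kc'])
    qed
    show "AE x in lborel. norm (s (real (Suc j)) x) \<le> ?D x" for j
      by (intro AE_I2 sbound) simp
  qed measurable
  moreover have "((\<lambda>m. k (int_vec m /\<^sub>R real (Suc j)) / of_real (real (Suc j) ^ CARD('n))) has_sum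
      (LBINT x. s (real (Suc j)) x)) UNIV" for j
    unfolding s_def by (rule riemann_sum_integral[OF km _ si[unfolded s_def]]) simp_all
  ultimately show thesis by (intro that)
qed

text \<open>Decay with one power more than summability requires yields a factor \<open>1 / (r - \<bar>y\<bar>)\<close> in front of the sum
  over all nonzero lattice points, where \<open>r\<close> is the mesh.\<close>

lemma sparse_lattice_sums_tendsto:
  fixes f :: "real^'n::finite \<Rightarrow> complex"
  assumes c: "0 \<le> c" "\<And>x. cmod (f x) \<le> c * decay (CARD('n) + 3) x"
    and S: "\<And>j. ((\<lambda>m. f (y + real (Suc j) *\<^sub>R int_vec m)) has_sum S j) UNIV"
  shows "S \<longlonglongrightarrow> f y"
proof -
  let ?M = "CARD('n) + 2"
  have dS: "decay (CARD('n) + 3) x = decay ?M x / (1 + norm x)" for x :: "real^'n"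
    by (simp add: decay_def numeral_3_eq_3)
  obtain B where B: "\<And>p F. finite F \<Longrightarrow> (\<Sum>m\<in>F. decay ?M (mat 1 *v int_vec m + (p::real^'n))) \<le> B"
    using lattice_decay_sum_bounded[OF invertible_mat[of 1], of ?M] by auto
  define A where "A = c * (1 + norm y) ^ ?M * B"
  have tail: "norm (S j - f y) \<le> A / (r - norm y)" if r: "r = real (Suc j)" "r > norm y" for j r
  proof -
    have r1: "1 \<le> r" using r by simp
    have hs: "((\<lambda>m. f (y + r *\<^sub>R int_vec m)) has_sum (S j - f y)) (UNIV - {0})"
      unfolding r(1) by (rule has_sum_Diff[OF S[of j]]) (auto intro: has_sum_finiteI)
    let ?W = "\<lambda>m. c * (1 + norm y) ^ ?M / (r - norm y) * decay ?M (mat 1 *v int_vec m + (0::real^'n))"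
    have le: "cmod (f (y + r *\<^sub>R int_vec m)) \<le> ?W m" if "m \<noteq> 0" for m :: "int^'n"
    proof -
      let ?z = "y + r *\<^sub>R int_vec m :: real^'n"
      from that obtain i where i: "m $ i \<noteq> 0" by (auto simp: vec_eq_iff)
      have "1 \<le> \<bar>int_vec m $ i\<bar>" using i by simp
      also have "\<dots> \<le> norm (int_vec m)" by (rule component_le_norm_cart)
      finally have "r \<le> norm (r *\<^sub>R int_vec m)" using r1 by (simp add: mult_le_cancel_left1)
      then have z: "r - norm y \<le> 1 + norm ?z" using norm_diff_ineq[of "r *\<^sub>R int_vec m" y] by (simp add: add.commute)
      have "decay ?M ?z \<le> (1 + norm (- y)) ^ ?M * decay ?M (?z + - y)" by (rule decay_shift)
      also have "\<dots> = (1 + norm y) ^ ?M * decay ?M (r *\<^sub>R int_vec m)" by simp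
      also have "\<dots> \<le> (1 + norm y) ^ ?M * decay ?M (int_vec m)"
        by (intro mult_left_mono decay_scale_le r1) simp
      finally have d: "decay ?M ?z \<le> (1 + norm y) ^ ?M * decay ?M (int_vec m)" .
      have "cmod (f ?z) \<le> c * (decay ?M ?z / (1 + norm ?z))" using c(2)[of ?z] unfolding dS .
      also have "\<dots> \<le> c * (((1 + norm y) ^ ?M * decay ?M (int_vec m)) / (r - norm y))"
        by (intro mult_left_mono frac_le d z c(1)) (use r in auto)
      finally show ?thesis by (simp add: mat_mult_vec)
    qed
    have sumW: "(\<Sum>m\<in>F. ?W m) \<le> A / (r - norm y)" if "finite F" for F
    proof -
      have "(\<Sum>m\<in>F. ?W m) \<le> c * (1 + norm y) ^ ?M / (r - norm y) * B"
        unfolding sum_distrib_left[symmetric] using c(1) r by (intro mult_left_mono B that) auto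
      then show ?thesis by (simp add: A_def)
    qed
    have W0: "0 \<le> ?W m" for m using c(1) r by simp
    have sW: "?W summable_on UNIV" by (rule summable_on_norm_iff_bounded[OF W0 sumW])
    have "norm (S j - f y) \<le> (\<Sum>\<^sub>\<infinity>m\<in>UNIV - {0}. ?W m)"
      by (rule norm_infsum_le[OF hs has_sum_infsum[OF summable_on_subset[OF sW]]]) (use le in auto)
    also have "\<dots> \<le> A / (r - norm y)"
      by (rule infsum_le_finite_sums[OF summable_on_subset[OF sW]]) (use sumW in auto)
    finally show ?thesis .
  qed
  have top: "filterlim (\<lambda>j. - norm y + real (Suc j)) at_top sequentially"
    by (intro filterlim_tendsto_add_at_top[OF tendsto_const]
        filterlim_compose[OF filterlim_real_sequentially filterlim_Suc])
  have lim: "(\<lambda>j. A / (- norm y + real (Suc j))) \<longlonglongrightarrow> 0"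
    by (intro tendsto_divide_0[OF tendsto_const] filterlim_at_top_imp_at_infinity top)
  have ev: "\<forall>\<^sub>F j in sequentially. 0 < - norm y + real (Suc j)"
    using top unfolding filterlim_at_top_dense by blast
  have "\<forall>\<^sub>F j in sequentially. norm (S j - f y) \<le> A / (- norm y + real (Suc j))"
    using ev by eventually_elim (use tail in \<open>simp del: of_nat_Suc\<close>)
  then have "(\<lambda>j. S j - f y) \<longlonglongrightarrow> 0" by (rule Lim_null_comparison[OF _ lim])
  then show ?thesis by (rule LIM_zero_cancel)
qed

text \<open>Poisson summation for the lattice \<open>r \<int>\<^sup>d\<close> and the translate of \<open>f\<close> by \<open>y\<close>: the dual side is the Riemann sum with mesh
  \<open>1/r\<close> of the inversion integral.\<close>

lemma poisson_summation_scaled: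
  fixes f :: "'d::finite cfun"
  assumes f: "schwartz f" and r: "r > 0"
    and I: "((\<lambda>k. fourier f (int_vec k /\<^sub>R r) * ch ((int_vec k /\<^sub>R r) \<bullet> y) / of_real (r ^ CARD('d))) has_sum I) UNIV"
  shows "((\<lambda>k. f (y + r *\<^sub>R int_vec k)) has_sum I) UNIV"
proof -
  let ?n = "CARD('d)"
  let ?M = "?n + 2"
  let ?c = "\<lambda>k. fourier f (int_vec k /\<^sub>R r) * ch ((int_vec k /\<^sub>R r) \<bullet> y) / of_real (r ^ ?n)"
  have fm [measurable]: "f \<in> borel_measurable borel" by (rule schwartz_borel[OF f])
  have r0: "r \<noteq> 0" using r by simp
  obtain c where c: "0 \<le> c" "\<And>x. cmod (f x) \<le> c * decay ?M x" using schwartz_le_decay[OF f] by blast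
  obtain c' where c': "0 \<le> c'" "\<And>x. cmod (fourier f x) \<le> c' * decay ?M x"
    using schwartz_le_decay[OF schwartz_fourier[OF f]] by blast
  obtain B where B: "\<And>p F. finite F \<Longrightarrow> (\<Sum>k\<in>F. decay ?M (mat r *v int_vec k + (p::real^'d))) \<le> B"
    using lattice_decay_sum_bounded[OF invertible_mat[OF r0], of ?M] by auto
  have inv: "invertible (mat (1 / r) :: real^'d^'d)" using r by (intro invertible_mat) simp
  obtain B' where "\<And>p F. finite F \<Longrightarrow> (\<Sum>k\<in>F. decay ?M (mat (1 / r) *v int_vec k + (p::real^'d))) \<le> B'"
    using lattice_decay_sum_bounded[OF inv, of ?M] by auto
  from this[of _ 0] have B': "finite F \<Longrightarrow> (\<Sum>k\<in>F. decay ?M (int_vec k /\<^sub>R r :: real^'d)) \<le> B'" for F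
    by (simp only: mat_mult_vec add_0_right inverse_eq_divide)
  have "((\<lambda>k. (\<lambda>x. f (y + x)) (mat r *v int_vec k)) has_sum (\<Sum>\<^sub>\<infinity>k. ?c k)) UNIV"
  proof (rule poisson_summation_lattice[where V="\<lambda>x. c * decay ?M (x + y)" and M="?M" and B="c * B"])
    show "invertible (mat r :: real^'d^'d)" by (rule invertible_mat[OF r0])
    show "continuous_on UNIV (\<lambda>x. f (y + x))"
      by (intro continuous_on_compose2[OF schwartz_continuous_on[OF f, of UNIV]] continuous_intros) auto
    show "integrable lborel (\<lambda>x. f (y + x))" by (intro lborel_integrable_translation schwartz_integrable f)
    show "cmod (f (y + z)) \<le> c * decay ?M (z + y)" for z
      using c(2)[of "y + z"] by (simp only: add.commute[of y])
    show "c * decay ?M (z + x + y) \<le> (1 + norm x) ^ ?M * (c * decay ?M (z + y))" for z x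
    proof -
      have "decay ?M (z + x + y) \<le> (1 + norm (- x)) ^ ?M * decay ?M (z + x + y + - x)" by (rule decay_shift)
      also have "z + x + y + - x = z + y" by simp
      finally show ?thesis using mult_left_mono[OF _ c(1)] by (simp only: norm_minus_cancel mult.left_commute)
    qed
    show "(\<Sum>k\<in>S. c * decay ?M (mat r *v int_vec k + y)) \<le> c * B" if "finite S" for S
      unfolding sum_distrib_left[symmetric] by (intro mult_left_mono B that c)
    show "?c k = (LBINT z. f (y + z) * ch (- (int_vec k \<bullet> (matrix_inv (mat r) *v z)))) / of_real \<bar>det (mat r :: real^'d^'d)\<bar>" for k
    proof -
      let ?w = "int_vec k /\<^sub>R r"
      have "f (y + z) * ch (- (int_vec k \<bullet> (matrix_inv (mat r) *v z))) = ch (?w \<bullet> y) * (f (y + z) * ch (- ((y + z) \<bullet> ?w)))" for z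
      proof -
        have "- (int_vec k \<bullet> (matrix_inv (mat r) *v z)) = ?w \<bullet> y + - ((y + z) \<bullet> ?w)"
          unfolding matrix_inv_mat_mult_vec[OF r0]
          by (simp add: inner_add_left inner_commute[of y] inner_commute[of z] distrib_left)
        then show ?thesis by (simp only: ch_add mult_ac)
      qed
      then have "(LBINT z. f (y + z) * ch (- (int_vec k \<bullet> (matrix_inv (mat r) *v z))))
         = ch (?w \<bullet> y) * (LBINT z. f (y + z) * ch (- ((y + z) \<bullet> ?w)))" by (simp only: integral_mult_right_zero)
      also have "(LBINT z. f (y + z) * ch (- ((y + z) \<bullet> ?w))) = fourier f ?w"
        using lborel_integral_translation[of "\<lambda>z. f z * ch (- (z \<bullet> ?w))" y] by (simp add: fourier_lborel)
      finally show ?thesis using r by (simp add: det_mat)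
    qed
    show "(\<lambda>k. cmod (?c k)) summable_on UNIV"
    proof (rule summable_on_norm_iff_bounded)
      fix F :: "(int^'d) set" assume F: "finite F"
      have "(\<Sum>k\<in>F. cmod (?c k)) \<le> (\<Sum>k\<in>F. c' * decay ?M (int_vec k /\<^sub>R r) / r ^ ?n)"
      proof (rule sum_mono)
        fix k
        have "cmod (?c k) = cmod (fourier f (int_vec k /\<^sub>R r)) / r ^ ?n"
          unfolding norm_divide norm_mult norm_ch norm_of_real using r by simp
        also have "\<dots> \<le> c' * decay ?M (int_vec k /\<^sub>R r) / r ^ ?n"
          using r by (intro divide_right_mono c') simp
        finally show "cmod (?c k) \<le> c' * decay ?M (int_vec k /\<^sub>R r) / r ^ ?n" .
      qed
      also have "\<dots> \<le> c' * B' / r ^ ?n"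
        unfolding sum_divide_distrib[symmetric] sum_distrib_left[symmetric] using c'(1) r
        by (intro divide_right_mono mult_left_mono B' F) auto
      finally show "(\<Sum>k\<in>F. cmod (?c k)) \<le> c' * B' / r ^ ?n" .
    qed simp
  qed
  then show ?thesis using infsumI[OF I] by (simp only: mat_mult_vec)
qed

text \<open>As \<open>r \<rightarrow> \<infinity>\<close> in the previous formula, only the term of the origin survives on one side, and the Riemann sums on the other
  side converge to the inversion integral.\<close>

theorem fourier_inversion:
  fixes f :: "'d::finite cfun"
  assumes f: "schwartz f"
  shows "(LBINT w. fourier f w * ch (w \<bullet> y)) = f y"
proof -
  obtain c where c: "0 \<le> c" "\<And>x. cmod (f x) \<le> c * decay (CARD('d) + 3) x" using schwartz_le_decay[OF f] by blast
  obtain c' where c': "0 \<le> c'" "\<And>x. cmod (fourier f x) \<le> c' * decay (CARD('d) + 2) x"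
    using schwartz_le_decay[OF schwartz_fourier[OF f]] by blast
  obtain I where I: "\<And>j. ((\<lambda>m. fourier f (int_vec m /\<^sub>R real (Suc j)) * ch ((int_vec m /\<^sub>R real (Suc j)) \<bullet> y)
        / of_real (real (Suc j) ^ CARD('d))) has_sum I j) UNIV"
    and lim: "I \<longlonglongrightarrow> (LBINT w. fourier f w * ch (w \<bullet> y))"
  proof (rule riemann_sums_tendsto[of "\<lambda>w. fourier f w * ch (w \<bullet> y)" c'])
    show "continuous_on UNIV (\<lambda>w. fourier f w * ch (w \<bullet> y))"
      by (intro continuous_intros schwartz_continuous_on schwartz_fourier f)
    show "cmod (fourier f x * ch (x \<bullet> y)) \<le> c' * decay (CARD('d) + 2) x" for x
      using c'(2)[of x] by (simp only: norm_mult norm_ch mult_1_right)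
  qed (use c' in auto)
  have "I \<longlonglongrightarrow> f y"
    by (rule sparse_lattice_sums_tendsto[OF c poisson_summation_scaled[OF f _ I]]) simp
  with lim show ?thesis by (rule LIMSEQ_unique)
qed

section \<open>Functions with integrable Fourier transform\<close>

lemma integrable_pair_mult:
  fixes a :: "'a::euclidean_space \<Rightarrow> complex" and b :: "'b::euclidean_space \<Rightarrow> complex"
  assumes a: "integrable lborel a" and b: "integrable lborel b"
  shows "integrable (lborel \<Otimes>\<^sub>M lborel) (\<lambda>p. a (fst p) * b (snd p))"
proof -
  have [measurable]: "a \<in> borel_measurable borel" "b \<in> borel_measurable borel" using a b by auto
  have "integrable (lborel \<Otimes>\<^sub>M lborel) (\<lambda>(x, y). a x * b y)"
  proof (rule lborel_pair.Fubini_integrable)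
    have "(LBINT y. norm (case (x, y) of (x, y) \<Rightarrow> a x * b y)) = cmod (a x) * (LBINT y. cmod (b y))" for x
      by (simp add: norm_mult)
    then show "integrable lborel (\<lambda>x. (LBINT y. norm (case (x, y) of (x, y) \<Rightarrow> a x * b y)))"
      using a by simp
    show "AE x in lborel. integrable lborel (\<lambda>y. case (x, y) of (x, y) \<Rightarrow> a x * b y)"
      using b by (intro AE_I2) simp
  qed measurable
  then show ?thesis by (simp add: case_prod_beta')
qed

text \<open>Double integrals in which an integrable product is multiplied by a bounded factor, mostly a product of characters.\<close>

lemma
  fixes a :: "'a::euclidean_space \<Rightarrow> complex" and b :: "'b::euclidean_space \<Rightarrow> complex"
  assumes a: "integrable lborel a" and b: "integrable lborel b"
    and \<Phi>: "\<Phi> \<in> borel_measurable (lborel \<Otimes>\<^sub>M lborel)" and le: "\<And>p. cmod (\<Phi> p) \<le> B"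
  shows integrable_pair_bounded: "integrable (lborel \<Otimes>\<^sub>M lborel) (\<lambda>p. a (fst p) * b (snd p) * \<Phi> p)"
    and Fubini_bounded: "(LBINT x. (LBINT y. a x * b y * \<Phi> (x, y))) = (LBINT y. (LBINT x. a x * b y * \<Phi> (x, y)))"
    and integral_pair_bounded: "(\<integral>p. a (fst p) * b (snd p) * \<Phi> p \<partial>(lborel \<Otimes>\<^sub>M lborel)) = (LBINT x. (LBINT y. a x * b y * \<Phi> (x, y)))"
proof -
  show int: "integrable (lborel \<Otimes>\<^sub>M lborel) (\<lambda>p. a (fst p) * b (snd p) * \<Phi> p)"
  proof (rule Bochner_Integration.integrable_bound[OF integrable_mult_left[OF integrable_norm[OF integrable_pair_mult[OF a b]], of B]])
    show "AE p in lborel \<Otimes>\<^sub>M lborel. norm (a (fst p) * b (snd p) * \<Phi> p) \<le> norm (norm (a (fst p) * b (snd p)) * B)"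
    proof (rule AE_I2)
      fix p
      have "norm (a (fst p) * b (snd p) * \<Phi> p) \<le> norm (a (fst p) * b (snd p)) * B"
        unfolding norm_mult[of _ "\<Phi> p"] by (intro mult_left_mono le) simp
      then show "norm (a (fst p) * b (snd p) * \<Phi> p) \<le> norm (norm (a (fst p) * b (snd p)) * B)"
        by simp
    qed
  next
    have [measurable]: "a \<in> borel_measurable borel" "b \<in> borel_measurable borel" using a b by auto
    note \<Phi>[measurable]
    show "(\<lambda>p. a (fst p) * b (snd p) * \<Phi> p) \<in> borel_measurable (lborel \<Otimes>\<^sub>M lborel)" by measurable
  qed
  then have int': "integrable (lborel \<Otimes>\<^sub>M lborel) (\<lambda>(x, y). a x * b y * \<Phi> (x, y))"
    by (simp add: case_prod_beta')
  show "(LBINT x. (LBINT y. a x * b y * \<Phi> (x, y))) = (LBINT y. (LBINT x. a x * b y * \<Phi> (x, y)))"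
    using lborel_pair.Fubini_integral[OF int'] by simp
  show "(\<integral>p. a (fst p) * b (snd p) * \<Phi> p \<partial>(lborel \<Otimes>\<^sub>M lborel)) = (LBINT x. (LBINT y. a x * b y * \<Phi> (x, y)))"
    using lborel_pair.integral_fst'[OF int] by simp
qed

text \<open>Products of the completed measure are not complete; the arguments with double integrals therefore use Borel
  representatives.\<close>

lemma borel_version:
  fixes f :: "real^'d::finite \<Rightarrow> complex"
  assumes f: "f \<in> borel_measurable lebesgue"
  obtains f' where "f' \<in> borel_measurable borel" "AE x in lebesgue. f x = f' x"
proof -
  have "(\<lambda>x. Re (f x)) \<in> borel_measurable lebesgue" using f by measurable
  from completion_ex_borel_measurable_real[OF this]
  obtain u where u: "u \<in> borel_measurable lborel" "AE x in lborel. Re (f x) = u x" by blast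
  have "(\<lambda>x. Im (f x)) \<in> borel_measurable lebesgue" using f by measurable
  from completion_ex_borel_measurable_real[OF this]
  obtain v where v: "v \<in> borel_measurable lborel" "AE x in lborel. Im (f x) = v x" by blast
  show thesis
  proof (rule that)
    show "(\<lambda>x. Complex (u x) (v x)) \<in> borel_measurable borel"
      using u(1) v(1) unfolding Complex_eq by simp
    show "AE x in lebesgue. f x = Complex (u x) (v x)"
      using AE_completion[OF u(2)] AE_completion[OF v(2)] by eventually_elim (simp add: complex_eq_iff)
  qed
qed

text \<open>The sets over which \<open>m\<close> has integral 0 form a \<open>\<lambda>\<close>-system. If it contains the closed sets, it contains all Borel
  sets, among them the sets where \<open>m\<close> is positive or negative.\<close>

lemma AE_zero_if_closed_integrals_zero:
  fixes m :: "'a::euclidean_space \<Rightarrow> real"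
  assumes m: "integrable lborel m"
    and C: "\<And>C. closed C \<Longrightarrow> (LBINT x. indicator C x * m x) = 0"
  shows "AE x in lborel. m x = 0"
proof -
  have mm [measurable]: "m \<in> borel_measurable borel" using m by auto
  have mi: "integrable lborel (\<lambda>x. indicator A x * m x)" if "A \<in> sets borel" for A
    using integrable_mult_indicator[OF _ m, of A] that by simp
  have all: "(LBINT x. indicator A x * m x) = 0" if "A \<in> sets borel" for A
  proof -
    have stab: "Int_stable (Collect closed :: 'a set set)" by (auto simp: Int_stable_def)
    have "A \<in> sigma_sets UNIV (Collect closed)"
      using that by (simp add: borel_eq_closed)
    with stab subset_UNIV[of "Collect closed", folded Pow_UNIV] show ?thesis
    proof (induction rule: sigma_sets_induct_disjoint)
      case (basic A) then show ?case using C by simp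
    next
      case empty then show ?case by simp
    next
      case (compl A)
      then have A: "A \<in> sets borel" by (simp add: borel_eq_closed)
      have eq: "indicator (UNIV - A) x * m x = indicator UNIV x * m x - indicator A x * m x" for x
        by (auto simp: indicator_def)
      show ?case unfolding eq using mi[OF A] m compl(2) C[of UNIV] by simp
    next
      case (union A)
      then have A: "range A \<subseteq> sets borel" by (auto simp: borel_eq_closed)
      have "(\<integral>x\<in>(\<Union>i. A i). m x \<partial>lborel) = (\<Sum>i. \<integral>x\<in>A i. m x \<partial>lborel)"
      proof (rule lebesgue_integral_countable_add)
        show "A i \<inter> A j = {}" if "i \<noteq> j" for i j using union(1) that by (auto simp: disjoint_family_on_def)
        show "set_integrable lborel (\<Union>i. A i) m"
          unfolding set_integrable_def using A by (intro integrable_mult_indicator m) auto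
      qed (use A in auto)
      then show ?case using union by (simp add: set_lebesgue_integral_def)
    qed
  qed
  have half: "AE x in lborel. \<not> (P x)" if P: "\<And>x. P x \<Longrightarrow> m' x > 0" "\<And>x. \<not> P x \<Longrightarrow> m' x \<le> 0" and m': "m' = m \<or> m' = (\<lambda>x. - m x)" for P m'
  proof -
    have m'm: "m' \<in> borel_measurable borel" using m' by auto
    have Pm': "P x \<longleftrightarrow> 0 < m' x" for x using P[of x] by (meson not_less)
    let ?A = "{x. P x}"
    have A: "?A \<in> sets borel" using m'm unfolding Pm' by measurable
    have i: "integrable lborel (\<lambda>x. indicator ?A x * m' x)" "(LBINT x. indicator ?A x * m' x) = 0"
      using mi[OF A] all[OF A] m' by auto
    have "AE x in lborel. indicator ?A x * m' x = 0"
      using integral_nonneg_eq_0_iff_AE[OF i(1)] i(2) P(1) by (auto simp: indicator_def less_imp_le)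
    then show ?thesis
    proof eventually_elim
      case (elim x)
      then show ?case using P(1)[of x] by (auto simp: indicator_def)
    qed
  qed
  have "AE x in lborel. \<not> (m x > 0)" by (rule half[of _ m]) auto
  moreover have "AE x in lborel. \<not> (- m x > 0)" by (rule half[of _ "\<lambda>x. - m x"]) auto
  ultimately show ?thesis by eventually_elim auto
qed

definition gauss :: "real \<Rightarrow> 'd::finite cfun" where
  "gauss a = (\<lambda>x. exp (of_real (- a * (x \<bullet> x))))"

lemma schwartz_gauss: "a > 0 \<Longrightarrow> schwartz (gauss a)"
  unfolding gauss_def by (rule schwartz_gaussian)

lemma gauss_of_real: "gauss a x = of_real (exp (- a * (x \<bullet> x)))"
  unfolding gauss_def by (simp only: exp_of_real)

lemma gauss_scale: "gauss 1 (r *\<^sub>R x) = gauss (r\<^sup>2) x"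
  by (simp add: gauss_def power2_eq_square mult.assoc)

text \<open>The functions \<open>t \<mapsto> n\<^sup>d \<integral> f(u) e\<^bsup>-n\<^sup>2|t-u|\<^sup>2\<^esup> du\<close> are uniformly bounded and converge to a multiple of \<open>f\<close>. Being
  superpositions of Gaussians, they are orthogonal to \<open>m\<close>.\<close>

lemma integral_continuous_zero_if_gauss_zero:
  fixes m f :: "'d::finite cfun"
  assumes m: "integrable lborel m"
    and zero: "\<And>a u. a > 0 \<Longrightarrow> (LBINT t. m t * gauss a (t - u)) = 0"
    and f: "continuous_on UNIV f" and f1: "\<And>x. cmod (f x) \<le> 1"
  shows "(LBINT t. m t * f t) = 0"
proof -
  let ?G = "gauss 1 :: 'd cfun"
  have [measurable]: "m \<in> borel_measurable borel" using m by auto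
  have [measurable]: "f \<in> borel_measurable borel" by (rule borel_measurable_continuous_onI[OF f])
  have Gm [measurable]: "gauss a \<in> borel_measurable borel" if "a > 0" for a
    by (rule schwartz_borel[OF schwartz_gauss[OF that]])
  have G1m [measurable]: "?G \<in> borel_measurable borel" by (rule Gm) simp
  have Gi: "integrable lborel ?G" by (rule schwartz_integrable[OF schwartz_gauss]) simp
  let ?I = "(LBINT s. ?G s)"
  have I0: "?I \<noteq> 0"
  proof
    assume "?I = 0"
    have ri: "integrable lborel (\<lambda>s::real^'d. exp (- 1 * (s \<bullet> s)))"
      using integrable_norm[OF Gi] by (simp add: gauss_of_real)
    have "?I = of_real (\<integral>s. exp (- 1 * (s \<bullet> s)) \<partial>(lborel :: (real^'d) measure))"
      unfolding gauss_of_real by (rule integral_complex_of_real)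
    then have z: "(\<integral>s. exp (- 1 * (s \<bullet> s)) \<partial>(lborel :: (real^'d) measure)) = 0" using \<open>?I = 0\<close> by simp
    have "(\<integral>s. exp (- 1 * (s \<bullet> s)) \<partial>(lborel :: (real^'d) measure)) = 0
        \<longleftrightarrow> (AE s in (lborel :: (real^'d) measure). exp (- 1 * (s \<bullet> s)) = 0)"
      by (rule integral_nonneg_eq_0_iff_AE[OF ri]) simp
    with z have "AE s in (lborel :: (real^'d) measure). False" by simp
    then show False by (simp only: eventually_False ae_filter_eq_bot_iff) simp
  qed
  \<comment> \<open>After the substitution \<open>s = n (t - u)\<close> the average has a fixed kernel, and the limit \<open>n \<rightarrow> \<infinity>\<close> can be taken under
    the integral.\<close>
  let ?r = "\<lambda>n. real (Suc n)"
  define h where "h n t = (LBINT s. f (t - s /\<^sub>R ?r n) * ?G s)" for n t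
  have hb: "cmod (h n t) \<le> (LBINT s. cmod (?G s))" for n t
    unfolding h_def
  proof (rule norm_integral_le)
    have m1: "(\<lambda>s. f (t - s /\<^sub>R ?r n)) \<in> borel_measurable lborel" by measurable
    show "integrable lborel (\<lambda>s. f (t - s /\<^sub>R ?r n) * ?G s)"
      using integrable_bounded_mult[OF Gi m1] f1 by (simp only: mult.commute)
    show "norm (f (t - s /\<^sub>R ?r n) * ?G s) \<le> cmod (?G s)" for s
      using f1 by (simp add: norm_mult mult_left_le_one_le)
  qed (use Gi in auto)
  have lim: "(\<lambda>n. h n t) \<longlonglongrightarrow> f t * ?I" for t
  proof -
    have "(\<lambda>n. (LBINT s. f (t - s /\<^sub>R ?r n) * ?G s)) \<longlonglongrightarrow> (LBINT s. f t * ?G s)"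
    proof (rule integral_dominated_convergence[where w="\<lambda>s. cmod (?G s)"])
      show "AE s in lborel. (\<lambda>n. f (t - s /\<^sub>R ?r n) * ?G s) \<longlonglongrightarrow> f t * ?G s"
      proof (intro AE_I2 tendsto_mult tendsto_const)
        fix s
        have "(\<lambda>n. t - (1 / ?r n) *\<^sub>R s) \<longlonglongrightarrow> t - 0 *\<^sub>R s"
          using LIMSEQ_Suc[OF lim_1_over_n] by (intro tendsto_intros) simp
        then have "(\<lambda>n. t - s /\<^sub>R ?r n) \<longlonglongrightarrow> t" by (simp add: inverse_eq_divide)
        moreover have "isCont f t" using f by (simp add: continuous_on_eq_continuous_at)
        ultimately show "(\<lambda>n. f (t - s /\<^sub>R ?r n)) \<longlonglongrightarrow> f t" by (rule isCont_tendsto_compose[rotated])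
      qed
      show "AE s in lborel. norm (f (t - s /\<^sub>R ?r n) * ?G s) \<le> cmod (?G s)" for n
        using f1 by (intro AE_I2) (simp add: norm_mult mult_left_le_one_le)
    qed (use Gi in \<open>auto intro: integrable_norm\<close>)
    then show ?thesis by (simp add: h_def)
  qed
  have hm [measurable]: "h n \<in> borel_measurable borel" for n unfolding h_def by measurable
  have hz: "(LBINT t. m t * h n t) = 0" for n
  proof -
    let ?a = "(?r n)\<^sup>2"
    have a: "?a > 0" by simp
    have [measurable]: "gauss ?a \<in> borel_measurable (borel :: (real^'d) measure)" by (rule Gm[OF a])
    have ai: "integrable lborel (gauss ?a :: 'd cfun)" by (rule schwartz_integrable[OF schwartz_gauss[OF a]])
    have refl: "(LBINT v. H v) = (LBINT u. H (t - u))"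
      if [measurable]: "H \<in> borel_measurable borel" for H :: "'d cfun" and t
      using lborel_integral_translation[of H t] lborel_integral_reflect[of "\<lambda>u. H (t + u)"] by simp
    have reflr: "(LBINT v. H v) = (LBINT u. H (t - u))"
      if [measurable]: "H \<in> borel_measurable borel" for H :: "real^'d \<Rightarrow> real" and t
      using lborel_integral_translation[of H t] lborel_integral_reflect[of "\<lambda>u. H (t + u)"] by simp
    have ati: "integrable lborel (\<lambda>u. gauss ?a (t - u) :: complex)" for t :: "real^'d"
    proof -
      have "gauss ?a (t - u) = gauss ?a (- t + u)" for u by (simp add: gauss_def inner_diff_left inner_diff_right inner_add_left inner_add_right algebra_simps)
      then show ?thesis using lborel_integrable_translation[OF ai, of "- t"] by simp
    qed
    have inner: "integrable lborel (\<lambda>u. m t * (f u * gauss ?a (t - u)))" for t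
    proof -
      have "integrable lborel (\<lambda>u. gauss ?a (t - u) * f u)"
        by (rule integrable_bounded_mult[OF ati _ f1]) measurable
      then show ?thesis by (simp only: mult.commute[of "f _"]) (rule integrable_mult_right)
    qed
    have hn: "h n t = of_real (?r n ^ CARD('d)) * (LBINT u. f u * gauss ?a (t - u))" for t
    proof -
      have "h n t = \<bar>?r n\<bar> ^ DIM(real^'d) *\<^sub>R (LBINT v. f (t - v) * gauss ?a v)"
        unfolding h_def by (subst lborel_integral_scale[where c="?r n"]) (simp_all add: gauss_scale del: of_nat_Suc)
      also have "(LBINT v. f (t - v) * gauss ?a v) = (LBINT u. f u * gauss ?a (t - u))"
        by (subst refl[of _ t]) simp_all
      finally show ?thesis by (simp add: scaleR_conv_of_real del: of_nat_Suc)
    qed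
    have "integrable (lborel \<Otimes>\<^sub>M lborel) (\<lambda>(t, u). m t * (f u * gauss ?a (t - u)))"
    proof (rule lborel_pair.Fubini_integrable)
      let ?C = "(LBINT u. cmod (gauss ?a (u :: real^'d)))"
      have "(LBINT u. norm (m t * (f u * gauss ?a (t - u)))) \<le> cmod (m t) * ?C" for t
      proof -
        have "(LBINT u. norm (m t * (f u * gauss ?a (t - u)))) \<le> (LBINT u. cmod (m t) * cmod (gauss ?a (t - u)))"
          using f1 by (intro integral_mono integrable_norm inner integrable_mult_right ati)
            (simp add: norm_mult mult_left_mono mult_left_le_one_le)
        also have "\<dots> = cmod (m t) * ?C" by (subst reflr[of "\<lambda>u. cmod (gauss ?a u)" t]) simp_all
        finally show ?thesis .
      qed
      then show "integrable lborel (\<lambda>t. (LBINT u. norm (case (t, u) of (t, u) \<Rightarrow> m t * (f u * gauss ?a (t - u)))))"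
        by (intro Bochner_Integration.integrable_bound[OF integrable_mult_left[OF integrable_norm[OF m], of ?C]])
           (auto intro!: AE_I2 simp: abs_of_nonneg)
      show "AE t in lborel. integrable lborel (\<lambda>u. case (t, u) of (t, u) \<Rightarrow> m t * (f u * gauss ?a (t - u)))"
        using inner by (intro AE_I2) simp
    qed measurable
    from lborel_pair.Fubini_integral[OF this]
    have "(LBINT t. (LBINT u. m t * (f u * gauss ?a (t - u))))
        = (LBINT u. (LBINT t. m t * (f u * gauss ?a (t - u))))" by simp
    also have "\<dots> = (LBINT u. f u * (LBINT t. m t * gauss ?a (t - u)))"
      unfolding mult.left_commute[of "m _"] integral_mult_right_zero ..
    also have "\<dots> = 0" unfolding zero[OF a] by simp
    finally have "(LBINT t. m t * (LBINT u. f u * gauss ?a (t - u))) = 0" by simp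
    then show ?thesis unfolding hn mult.left_commute[of "m _"] integral_mult_right_zero by simp
  qed
  have "(\<lambda>n. (LBINT t. m t * h n t)) \<longlonglongrightarrow> (LBINT t. m t * (f t * ?I))"
  proof (rule integral_dominated_convergence[where w="\<lambda>t. cmod (m t) * (LBINT s. cmod (?G s))"])
    show "AE t in lborel. (\<lambda>n. m t * h n t) \<longlonglongrightarrow> m t * (f t * ?I)"
      by (intro AE_I2 tendsto_mult tendsto_const lim)
    show "AE t in lborel. norm (m t * h n t) \<le> cmod (m t) * (LBINT s. cmod (?G s))" for n
      unfolding norm_mult by (intro AE_I2 mult_left_mono hb) simp
  qed (use m in auto)
  then have "(LBINT t. m t * (f t * ?I)) = 0" unfolding hz by (simp add: LIMSEQ_const_iff)
  then show ?thesis using I0 by (simp add: mult.assoc[symmetric])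
qed

text \<open>The indicator function of a closed set is a bounded limit of continuous functions.\<close>

lemma AE_zero_if_gauss_zero:
  fixes m :: "'d::finite cfun"
  assumes m: "integrable lborel m"
    and zero: "\<And>a u. a > 0 \<Longrightarrow> (LBINT t. m t * gauss a (t - u)) = 0"
  shows "AE t in lborel. m t = 0"
proof -
  have [measurable]: "m \<in> borel_measurable borel" using m by auto
  have closed: "(LBINT t. m t * of_real (indicator C t)) = 0" if C: "closed C" for C
  proof (cases "C = {}")
    case False
    let ?f = "\<lambda>j t. max 0 (1 - real j * infdist t C)"
    have f01: "0 \<le> ?f j t" "?f j t \<le> 1" for j t
      using infdist_nonneg[of t C] by auto
    have fc: "continuous_on UNIV (\<lambda>t. of_real (?f j t) :: complex)" for j
      by (intro continuous_intros)
    have z: "(LBINT t. m t * of_real (?f j t)) = 0" for j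
      by (rule integral_continuous_zero_if_gauss_zero[OF m zero fc]) (use f01[of j] in \<open>simp_all only: norm_of_real abs_of_nonneg\<close>)
    have "(\<lambda>j. (LBINT t. m t * of_real (?f j t))) \<longlonglongrightarrow> (LBINT t. m t * of_real (indicator C t))"
    proof (rule integral_dominated_convergence[where w="\<lambda>t. cmod (m t)"])
      show "AE t in lborel. (\<lambda>j. m t * of_real (?f j t)) \<longlonglongrightarrow> m t * of_real (indicator C t)"
      proof (intro AE_I2 tendsto_mult tendsto_const tendsto_of_real)
        fix t
        show "(\<lambda>j. ?f j t) \<longlonglongrightarrow> indicator C t"
        proof (cases "t \<in> C")
          case True then show ?thesis by simp
        next
          case nt: False
          then have d: "infdist t C > 0" using C False infdist_nonneg[of t C] in_closed_iff_infdist_zero[of C t] by auto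
          obtain N where N: "1 / infdist t C < real N" using reals_Archimedean2 by blast
          have "?f j t = 0" if "j \<ge> N" for j
          proof -
            have "1 / infdist t C \<le> real j" using N that by linarith
            then have "1 \<le> real j * infdist t C" using d by (simp add: divide_le_eq)
            then show ?thesis by simp
          qed
          then show ?thesis using nt
            by (intro tendsto_eventually eventually_sequentiallyI[of N]) simp
        qed
      qed
      show "AE t in lborel. norm (m t * of_real (?f j t)) \<le> cmod (m t)" for j
        using f01[of j] by (intro AE_I2) (simp only: norm_mult norm_of_real abs_of_nonneg mult_left_le norm_ge_zero)
      have "(\<lambda>t. of_real (?f j t) :: complex) \<in> borel_measurable borel" for j
        by (rule borel_measurable_continuous_onI[OF fc])
      then show "(\<lambda>t. m t * of_real (?f j t)) \<in> borel_measurable lborel" for j by measurable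
      show "(\<lambda>t. m t * of_real (indicator C t)) \<in> borel_measurable lborel"
        using borel_closed[OF C] by measurable
    qed (use m in auto)
    then show ?thesis unfolding z by (simp add: LIMSEQ_const_iff)
  qed simp
  have ci: "integrable lborel (\<lambda>t. m t * of_real (indicator C t))" if C: "closed C" for C
    by (rule integrable_bounded_mult[OF m]) (use borel_closed[OF C] in \<open>auto simp: indicator_def\<close>)
  have "AE t in lborel. Re (m t) = 0"
  proof (rule AE_zero_if_closed_integrals_zero)
    fix C :: "(real^'d) set" assume C: "closed C"
    have "(LBINT t. indicator C t * Re (m t)) = (LBINT t. Re (m t * of_real (indicator C t)))" by (simp add: mult.commute)
    also have "\<dots> = 0" unfolding integral_Re[OF ci[OF C]] closed[OF C] by simp
    finally show "(LBINT t. indicator C t * Re (m t)) = 0" .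
  qed (use m in simp)
  moreover have "AE t in lborel. Im (m t) = 0"
  proof (rule AE_zero_if_closed_integrals_zero)
    fix C :: "(real^'d) set" assume C: "closed C"
    have "(LBINT t. indicator C t * Im (m t)) = (LBINT t. Im (m t * of_real (indicator C t)))" by (simp add: mult.commute)
    also have "\<dots> = 0" unfolding integral_Im[OF ci[OF C]] closed[OF C] by simp
    finally show "(LBINT t. indicator C t * Im (m t)) = 0" .
  qed (use m in simp)
  ultimately show ?thesis by eventually_elim (simp add: complex_eq_iff)
qed

text \<open>Completing the square shows that the product is a multiple of a translated Gaussian, in particular a Schwartz
  function.\<close>

lemma gauss_mult_shifted_gauss:
  fixes t u :: "real^'d::finite"
  assumes a: "a > 0"
  shows "gauss 1 t * gauss a (t - u)
    = gauss (a / (1 + a)) u * gauss (1 + a) (t - (a / (1 + a)) *\<^sub>R u)"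
proof -
  define b where "b = a / (1 + a)"
  have b: "(1 + a) * b = a" using a by (simp add: b_def)
  have "- 1 * (t \<bullet> t) + - a * ((t - u) \<bullet> (t - u)) = - (1 + a) * (t \<bullet> t) + 2 * a * (t \<bullet> u) - a * (u \<bullet> u)"
    by (simp add: inner_diff_left inner_diff_right inner_commute algebra_simps)
  also have "\<dots> = - (1 + a) * (t \<bullet> t) + 2 * ((1 + a) * b) * (t \<bullet> u) - ((1 + a) * b * b + b) * (u \<bullet> u)"
  proof -
    have "a * b + b = (1 + a) * b" by (simp add: distrib_right)
    then show ?thesis unfolding b by simp
  qed
  also have "\<dots> = - b * (u \<bullet> u) + - (1 + a) * ((t - b *\<^sub>R u) \<bullet> (t - b *\<^sub>R u))"
    by (simp add: inner_diff_left inner_diff_right inner_commute algebra_simps)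
  finally show ?thesis
    unfolding gauss_def exp_add[symmetric] of_real_add[symmetric] b_def[symmetric] by (simp only:)
qed

lemma integral_bounded_character:
  fixes h :: "'d::finite cfun"
  assumes "integrable lborel h"
  shows "cmod (LBINT x. h x * ch (t \<bullet> x)) \<le> (LBINT x. cmod (h x))"
  by (rule norm_integral_le) (use assms in \<open>auto simp: norm_mult intro!: integrable_mult_ch\<close>)

text \<open>Let \<open>h\<close> be the integrable density of the distributional Fourier transform of \<open>g\<close>. Every Schwartz function \<open>\<psi>\<close> is
  the Fourier transform of a Schwartz function \<open>\<phi>\<close>. Pairing the transform of \<open>g\<close> with \<open>\<phi>\<close> yields
  \<open>\<integral> g \<psi> = \<integral> h \<phi>\<close>, which is \<open>\<integral> g\<^sub>t \<psi>\<close> for the inverse transform \<open>g\<^sub>t\<close> of \<open>h\<close>. So \<open>g - g\<^sub>t\<close> is orthogonal to all Schwartz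
  functions.\<close>

proposition fourier_in_L1_representation:
  fixes g :: "'d::finite cfun"
  assumes g: "fourier_in_L1 g"
  obtains h where "integrable lborel h" "AE t in lebesgue. g t = (LBINT x. h x * ch (t \<bullet> x))"
proof -
  have gm: "g \<in> borel_measurable lebesgue" and gi: "\<And>\<phi>. schwartz \<phi> \<Longrightarrow> integrable lebesgue (\<lambda>x. g x * \<phi> x)"
    using g unfolding fourier_in_L1_def tempered_function_def by auto
  obtain h0 where h0: "integrable lebesgue h0" and eq: "fourier_dist (dist_of g) = dist_of h0"
    using g unfolding fourier_in_L1_def by auto
  obtain g' where g'm [measurable]: "g' \<in> borel_measurable borel" and g': "AE x in lebesgue. g x = g' x"
    using borel_version[OF gm] by blast
  obtain h where hm [measurable]: "h \<in> borel_measurable borel" and h: "AE x in lebesgue. h0 x = h x"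
    using borel_version[of h0] h0 by auto
  have hm': "h \<in> borel_measurable lebesgue" and g'm': "g' \<in> borel_measurable lebesgue"
    by (intro measurable_completion; simp)+
  have "integrable lebesgue h" using h0 h hm' by (subst integrable_cong_AE[symmetric]) auto
  then have hi: "integrable lborel h" by (simp add: integrable_completion)
  define gt where "gt t = (LBINT x. h x * ch (t \<bullet> x))" for t
  have gtm [measurable]: "gt \<in> borel_measurable borel" unfolding gt_def by measurable
  have g'i: "integrable lborel (\<lambda>t. \<psi> t * g' t)"
    and key: "(LBINT t. \<psi> t * g' t) = (LBINT t. \<psi> t * gt t)" if \<psi>: "schwartz \<psi>" for \<psi> :: "'d cfun"
  proof -
    have [measurable]: "\<psi> \<in> borel_measurable borel" "fourier \<psi> \<in> borel_measurable borel"
      using schwartz_borel \<psi> schwartz_fourier by blast+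
    have \<psi>l: "\<psi> \<in> borel_measurable lebesgue" by (intro measurable_completion) simp
    have cong: "AE x in lebesgue. g x * \<psi> x = \<psi> x * g' x"
      using g' by eventually_elim (simp add: mult.commute)
    have "integrable lebesgue (\<lambda>x. \<psi> x * g' x)"
      using gi[OF \<psi>] cong \<psi>l gm g'm' by (subst integrable_cong_AE[symmetric]) auto
    then show "integrable lborel (\<lambda>t. \<psi> t * g' t)" by (simp add: integrable_completion)
    define \<phi> where "\<phi> x = fourier \<psi> (- x)" for x
    have \<phi>: "schwartz \<phi>" unfolding \<phi>_def by (intro schwartz_reflect schwartz_fourier \<psi>)
    have \<phi>m [measurable]: "\<phi> \<in> borel_measurable borel" by (rule schwartz_borel[OF \<phi>])
    have F\<phi>: "fourier \<phi> = \<psi>"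
    proof
      fix w
      have "fourier \<phi> w = (LBINT x. fourier \<psi> (- x) * ch ((- x) \<bullet> w))"
        by (simp add: fourier_lborel \<phi>_def)
      also have "\<dots> = (LBINT x. fourier \<psi> x * ch (x \<bullet> w))"
        by (rule lborel_integral_reflect) measurable
      finally show "fourier \<phi> w = \<psi> w" using fourier_inversion[OF \<psi>] by simp
    qed
    have "(LBINT t. \<psi> t * g' t) = (\<integral>t. \<psi> t * g' t \<partial>lebesgue)" by (intro integral_completion[symmetric]) measurable
    also have "\<dots> = (\<integral>t. g t * \<psi> t \<partial>lebesgue)"
      by (rule integral_cong_AE[symmetric, OF _ _ cong]) (use \<psi>l gm g'm' in auto)
    also have "\<dots> = fourier_dist (dist_of g) \<phi>"
      using \<phi> \<psi> by (simp add: fourier_dist_def F\<phi> dist_of_def)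
    also have "\<dots> = (\<integral>x. h0 x * \<phi> x \<partial>lebesgue)" unfolding eq using \<phi> by (simp add: dist_of_def)
    also have "\<dots> = (\<integral>x. h x * \<phi> x \<partial>lebesgue)"
    proof (rule integral_cong_AE)
      have \<phi>l: "\<phi> \<in> borel_measurable lebesgue" by (intro measurable_completion) simp
      show "(\<lambda>x. h0 x * \<phi> x) \<in> borel_measurable lebesgue" "(\<lambda>x. h x * \<phi> x) \<in> borel_measurable lebesgue"
        using h0 hm' \<phi>l by auto
      show "AE x in lebesgue. h0 x * \<phi> x = h x * \<phi> x" using h by eventually_elim simp
    qed
    also have "\<dots> = (LBINT x. h x * \<phi> x)" by (intro integral_completion) measurable
    also have "\<dots> = (LBINT x. (LBINT t. h x * \<psi> t * ch (t \<bullet> x)))"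
      by (simp add: \<phi>_def fourier_lborel mult.assoc)
    also have "\<dots> = (LBINT t. (LBINT x. h x * \<psi> t * ch (t \<bullet> x)))"
    proof -
      have "(\<lambda>p. ch (snd p \<bullet> fst p)) \<in> borel_measurable ((lborel :: (real^'d) measure) \<Otimes>\<^sub>M (lborel :: (real^'d) measure))" by measurable
      from Fubini_bounded[OF hi schwartz_integrable[OF \<psi>] this, where B=1] show ?thesis by simp
    qed
    also have "\<dots> = (LBINT t. \<psi> t * gt t)"
      unfolding gt_def integral_mult_right_zero[symmetric] by (simp only: mult_ac)
    finally show "(LBINT t. \<psi> t * g' t) = (LBINT t. \<psi> t * gt t)" .
  qed
  have gtb: "cmod (gt t) \<le> (LBINT x. cmod (h x))" for t
    unfolding gt_def by (rule integral_bounded_character[OF hi])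
  have gti: "integrable lborel (\<lambda>t. \<psi> t * gt t)" if \<psi>: "schwartz \<psi>" for \<psi> :: "'d cfun"
  proof (rule Bochner_Integration.integrable_bound)
    show "integrable lborel (\<lambda>t. cmod (\<psi> t) * (LBINT x. cmod (h x)))"
      by (intro integrable_mult_left integrable_norm schwartz_integrable \<psi>)
    show "(\<lambda>t. \<psi> t * gt t) \<in> borel_measurable lborel" using schwartz_borel[OF \<psi>] by measurable
    show "AE t in lborel. norm (\<psi> t * gt t) \<le> norm (cmod (\<psi> t) * (LBINT x. cmod (h x)))"
    proof (rule AE_I2)
      fix t
      have "norm (\<psi> t * gt t) \<le> cmod (\<psi> t) * (LBINT x. cmod (h x))"
        unfolding norm_mult by (intro mult_left_mono gtb) simp
      then show "norm (\<psi> t * gt t) \<le> norm (cmod (\<psi> t) * (LBINT x. cmod (h x)))" by simp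
    qed
  qed
  \<comment> \<open>The factor \<open>gauss 1\<close> makes the difference integrable.\<close>
  have "AE t in lborel. gauss 1 t * g' t - gauss 1 t * gt t = 0"
  proof (rule AE_zero_if_gauss_zero)
    have "schwartz (gauss 1 :: 'd cfun)" by (rule schwartz_gauss) simp
    then show "integrable lborel (\<lambda>t. gauss 1 t * g' t - gauss 1 t * gt t)"
      by (intro Bochner_Integration.integrable_diff g'i gti)
    fix a :: real and u :: "real^'d" assume a: "a > 0"
    let ?b = "a / (1 + a)"
    let ?\<psi> = "\<lambda>t. gauss ?b u * translation (?b *\<^sub>R u) (gauss (1 + a)) t"
    have \<psi>: "schwartz ?\<psi>" by (intro schwartz_cmult schwartz_translation schwartz_gauss) (use a in simp)
    have "(gauss 1 t * g' t - gauss 1 t * gt t) * gauss a (t - u) = ?\<psi> t * g' t - ?\<psi> t * gt t" for t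
      using gauss_mult_shifted_gauss[OF a, of t u] by (simp add: translation_def algebra_simps)
    then have "(LBINT t. (gauss 1 t * g' t - gauss 1 t * gt t) * gauss a (t - u)) = (LBINT t. ?\<psi> t * g' t - ?\<psi> t * gt t)"
      by (simp only:)
    also have "\<dots> = (LBINT t. ?\<psi> t * g' t) - (LBINT t. ?\<psi> t * gt t)"
      by (rule Bochner_Integration.integral_diff[OF g'i[OF \<psi>] gti[OF \<psi>]])
    also have "\<dots> = 0" unfolding key[OF \<psi>] by simp
    finally show "(LBINT t. (gauss 1 t * g' t - gauss 1 t * gt t) * gauss a (t - u)) = 0" .
  qed
  then have "AE t in lborel. g' t = gt t" by eventually_elim (simp add: gauss_def)
  then have "AE t in lebesgue. g' t = gt t" by (rule AE_completion)
  with g' have "AE t in lebesgue. g t = gt t" by eventually_elim simp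
  with hi show thesis unfolding gt_def by (rule that)
qed

section \<open>The Janssen representation\<close>

lemma integral_lebesgue_eq_lborel:
  fixes f f' :: "'d::finite cfun"
  assumes f': "f' \<in> borel_measurable borel" and eq: "AE x in lebesgue. f x = f' x"
  shows "(\<integral>x. f x \<partial>lebesgue) = (LBINT x. f' x)"
proof -
  have m': "f' \<in> borel_measurable lebesgue" using f' by (intro measurable_completion) simp
  have m: "f \<in> borel_measurable lebesgue"
    by (rule borel_measurable_AE[OF m']) (use eq in \<open>auto simp: eq_commute\<close>)
  have "(\<integral>x. f x \<partial>lebesgue) = (\<integral>x. f' x \<partial>lebesgue)" by (rule integral_cong_AE[OF m m' eq])
  then show ?thesis using f' by (simp add: integral_completion)
qed

lemma borel_measurable_cnj [measurable]: "cnj \<in> borel_measurable borel"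
  by (intro borel_measurable_continuous_onI continuous_intros)

lemma AE_lebesgue_translation:
  fixes a :: "'a::euclidean_space"
  assumes "AE x in lebesgue. P x" shows "AE x in lebesgue. P (x - a)"
proof -
  have "AE x in lborel. P x" using assms by (simp add: AE_completion_iff)
  then obtain N where N: "N \<in> null_sets lborel" "{x \<in> space lborel. \<not> P x} \<subseteq> N" by (auto simp: eventually_ae_filter)
  have Nb: "N \<in> sets borel" using N(1) by auto
  have "AE x in distr lborel borel ((+) (- a)). x \<notin> N"
    unfolding lborel_distr_plus using N(1) by (rule AE_not_in)
  then have "AE x in lborel. - a + x \<notin> N"
    by (subst (asm) AE_distr_iff) (use Nb in auto)
  then have "AE x in lborel. P (x - a)"
    by eventually_elim (use N(2) in auto)
  then show ?thesis by (rule AE_completion)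
qed

lemma sum_UNIV_Plus: "(\<Sum>i\<in>UNIV. f i) = (\<Sum>a\<in>UNIV. f (Inl a)) + (\<Sum>b\<in>UNIV. f (Inr b))"
  for f :: "'a::finite + 'b::finite \<Rightarrow> 'c::comm_monoid_add"
  by (simp add: UNIV_Plus_UNIV[symmetric] sum.Plus del: UNIV_Plus_UNIV)

lemma inner_phase_space: "z \<bullet> z' = pos z \<bullet> pos z' + freq z \<bullet> freq z'"
  by (simp add: inner_vec_def sum_UNIV_Plus pos_def freq_def)

lemma norm_phase_space_le: "norm z \<le> norm (pos z) + norm (freq z)"
proof -
  have "(norm z)\<^sup>2 = (norm (pos z))\<^sup>2 + (norm (freq z))\<^sup>2"
    by (simp add: power2_norm_eq_inner inner_phase_space)
  also have "\<dots> \<le> (norm (pos z) + norm (freq z))\<^sup>2" by (simp add: power2_sum)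
  finally show ?thesis by (rule power2_le_imp_le) simp
qed

lemma pos_add [simp]: "pos (z + z') = pos z + pos z'" and freq_add [simp]: "freq (z + z') = freq z + freq z'"
  by (simp_all add: pos_def freq_def vec_eq_iff)

lemma continuous_on_pos: "continuous_on A pos" and continuous_on_freq: "continuous_on A freq"
  unfolding pos_def freq_def by (intro continuous_on_vec_lambda continuous_intros)+

lemma decay_pos_freq_le: "decay M (pos z) * decay M (freq z) \<le> decay M z"
proof -
  have "1 + norm z \<le> (1 + norm (pos z)) * (1 + norm (freq z))"
  proof -
    have "0 \<le> norm (pos z) * norm (freq z)" by simp
    then show ?thesis using norm_phase_space_le[of z]
      unfolding distrib_left distrib_right mult_1_left mult_1_right by linarith
  qed
  then have "(1 + norm z) ^ M \<le> (1 + norm (pos z)) ^ M * (1 + norm (freq z)) ^ M"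
    unfolding power_mult_distrib[symmetric] by (rule power_mono) simp
  then show ?thesis
    unfolding decay_def using one_plus_norm_pos[of z] one_plus_norm_pos[of "pos z"] one_plus_norm_pos[of "freq z"]
    by (simp add: field_simps)
qed

lemma tf_shift_eq: "tf_shift z f t = ch (freq z \<bullet> t) * f (t - pos z)"
  by (simp add: tf_shift_def modulation_ch translation_def)

lemma stft_eq: "stft g f z = (LINT t|lebesgue. f t * ch (- (freq z \<bullet> t)) * cnj (g (t - pos z)))"
  by (simp add: stft_def ch_def)

text \<open>This is the complex conjugate of the Rihaczek distribution of the pair \<open>\<phi>\<^sup>*\<close>, \<open>u\<close>, where \<open>\<phi>\<^sup>*\<close> denotes the conjugate of \<open>\<phi>\<close>.
  Translating it in phase space amounts, up to a constant phase, to shifting \<open>u\<close> and \<open>\<phi>\<close> in time and frequency.\<close>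

definition rihaczek :: "'d::finite cfun \<Rightarrow> 'd cfun \<Rightarrow> real^('d + 'd) \<Rightarrow> complex" where
  "rihaczek u \<phi> z = ch (pos z \<bullet> freq z) * \<phi> (pos z) * fourier u (freq z)"

lemma continuous_on_rihaczek:
  assumes "schwartz u" "schwartz \<phi>" shows "continuous_on A (rihaczek u \<phi>)"
  unfolding rihaczek_def
  by (intro continuous_intros continuous_on_pos continuous_on_freq
      continuous_on_compose2[OF schwartz_continuous_on[OF assms(2), of UNIV] continuous_on_pos]
      continuous_on_compose2[OF schwartz_continuous_on[OF schwartz_fourier[OF assms(1)], of UNIV] continuous_on_freq]) auto

lemma rihaczek_le_decay:
  assumes u: "schwartz u" and \<phi>: "schwartz \<phi>"
  obtains c where "0 \<le> c" "\<And>z. cmod (rihaczek u \<phi> z) \<le> c * decay M z"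
proof -
  obtain a where a: "0 \<le> a" "\<And>x. cmod (\<phi> x) \<le> a * decay M x" using schwartz_le_decay[OF \<phi>] by blast
  obtain b where b: "0 \<le> b" "\<And>x. cmod (fourier u x) \<le> b * decay M x"
    using schwartz_le_decay[OF schwartz_fourier[OF u]] by blast
  show thesis
  proof (rule that)
    show "0 \<le> a * b" using a b by simp
    fix z
    have "cmod (rihaczek u \<phi> z) \<le> (a * decay M (pos z)) * (b * decay M (freq z))"
      unfolding rihaczek_def norm_mult norm_ch mult_1_left
      by (intro mult_mono a b) (use a in auto)
    also have "\<dots> = (a * b) * (decay M (pos z) * decay M (freq z))" by (simp only: mult_ac)
    also have "\<dots> \<le> (a * b) * decay M z"
      by (intro mult_left_mono decay_pos_freq_le) (use a b in simp)
    finally show "cmod (rihaczek u \<phi> z) \<le> (a * b) * decay M z" .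
  qed
qed

lemma integrable_if_le_decay:
  fixes f :: "'a::euclidean_space \<Rightarrow> complex"
  assumes "f \<in> borel_measurable borel" and "\<And>z. cmod (f z) \<le> c * decay M z" and "0 \<le> c" and "M \<ge> DIM('a) + 2"
  shows "integrable lborel f"
proof (rule Bochner_Integration.integrable_bound)
  show "integrable lborel (\<lambda>z::'a. c * decay M z)"
    by (intro integrable_mult_right integrable_decay assms)
  show "AE z in lborel. norm (f z) \<le> norm (c * decay M z)"
    using assms(2,3) by (intro AE_I2) (simp add: abs_mult)
qed (use assms(1) in simp)

lemma integrable_rihaczek:
  fixes u \<phi> :: "'d::finite cfun"
  assumes "schwartz u" "schwartz \<phi>" shows "integrable lborel (rihaczek u \<phi>)"
proof -
  obtain c where "0 \<le> c" "\<And>z. cmod (rihaczek u \<phi> z) \<le> c * decay (DIM(real^('d + 'd)) + 2) z"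
    using rihaczek_le_decay[OF assms] by blast
  then show ?thesis
    by (intro integrable_if_le_decay[where M="DIM(real^('d + 'd)) + 2" and c=c] borel_measurable_continuous_onI
        continuous_on_rihaczek assms) auto
qed

text \<open>Integrating over the frequency first recovers \<open>u\<close> by Fourier inversion. The right-hand side is \<open>\<langle>\<pi>\<^sub>z u, \<phi>\<rangle>\<close> for
  \<open>z = (- freq \<zeta>, pos \<zeta>)\<close>, which is \<open>\<J> \<zeta>\<close>.\<close>

lemma integral_rihaczek_character:
  fixes u \<phi> :: "'d::finite cfun"
  assumes u: "schwartz u" and \<phi>: "schwartz \<phi>"
  shows "(LBINT z. rihaczek u \<phi> z * ch (\<zeta> \<bullet> z)) = (LBINT x. \<phi> x * ch (pos \<zeta> \<bullet> x) * u (x + freq \<zeta>))"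
proof -
  have [measurable]: "u \<in> borel_measurable borel" "\<phi> \<in> borel_measurable borel" "fourier u \<in> borel_measurable borel"
    using schwartz_borel u \<phi> schwartz_fourier by blast+
  have rm [measurable]: "rihaczek u \<phi> \<in> borel_measurable borel"
    using integrable_rihaczek[OF u \<phi>] by auto
  let ?\<Phi> = "\<lambda>p. ch (fst p \<bullet> snd p) * ch (pos \<zeta> \<bullet> fst p + freq \<zeta> \<bullet> snd p)"
  have \<Phi>: "?\<Phi> \<in> borel_measurable ((lborel :: (real^'d) measure) \<Otimes>\<^sub>M (lborel :: (real^'d) measure))"
    by measurable
  have "(LBINT z. rihaczek u \<phi> z * ch (\<zeta> \<bullet> z)) = (\<integral>p. \<phi> (fst p) * fourier u (snd p) * ?\<Phi> p \<partial>(lborel \<Otimes>\<^sub>M lborel))"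
    by (subst lborel_integral_join) (measurable, simp add: rihaczek_def inner_phase_space mult_ac)
  also have "\<dots> = (LBINT x. (LBINT w. \<phi> x * fourier u w * ?\<Phi> (x, w)))"
    by (rule integral_pair_bounded[OF schwartz_integrable[OF \<phi>] schwartz_integrable[OF schwartz_fourier[OF u]] \<Phi>, where B=1])
       (simp add: norm_mult)
  also have "\<dots> = (LBINT x. \<phi> x * ch (pos \<zeta> \<bullet> x) * u (x + freq \<zeta>))"
  proof (rule Bochner_Integration.integral_cong[OF refl])
    fix x
    have "\<phi> x * fourier u w * ?\<Phi> (x, w) = (\<phi> x * ch (pos \<zeta> \<bullet> x)) * (fourier u w * ch (w \<bullet> (x + freq \<zeta>)))" for w
      by (simp add: ch_add inner_add_right inner_commute mult_ac)
    then have "(LBINT w. \<phi> x * fourier u w * ?\<Phi> (x, w)) = (\<phi> x * ch (pos \<zeta> \<bullet> x)) * (LBINT w. fourier u w * ch (w \<bullet> (x + freq \<zeta>)))"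
      by (simp only: integral_mult_right_zero)
    then show "(LBINT w. \<phi> x * fourier u w * ?\<Phi> (x, w)) = \<phi> x * ch (pos \<zeta> \<bullet> x) * u (x + freq \<zeta>)"
      by (simp only: fourier_inversion[OF u])
  qed
  finally show ?thesis .
qed

lemma tf_shift_dist_dist_of:
  assumes u: "schwartz u" and \<phi>: "schwartz \<phi>"
  shows "tf_shift_dist z (dist_of u) \<phi> = (LBINT x. \<phi> x * ch (freq z \<bullet> x) * u (x - pos z))"
proof -
  have [measurable]: "u \<in> borel_measurable borel" "\<phi> \<in> borel_measurable borel"
    using schwartz_borel u \<phi> by blast+
  have s: "schwartz (translation (- pos z) (modulation (freq z) \<phi>))"
    by (intro schwartz_translation schwartz_modulation \<phi>)
  have "tf_shift_dist z (dist_of u) \<phi> = (\<integral>x. u x * (ch (freq z \<bullet> (x + pos z)) * \<phi> (x + pos z)) \<partial>lebesgue)"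
    using s by (simp add: tf_shift_dist_def modulation_dist_def translation_dist_def dist_of_def translation_def modulation_ch)
  also have "\<dots> = (LBINT x. u x * (ch (freq z \<bullet> (x + pos z)) * \<phi> (x + pos z)))"
    by (intro integral_completion) measurable
  also have "\<dots> = (LBINT x. \<phi> (pos z + x) * ch (freq z \<bullet> (pos z + x)) * u ((pos z + x) - pos z))"
    by (simp add: add.commute mult_ac)
  also have "\<dots> = (LBINT x. \<phi> x * ch (freq z \<bullet> x) * u (x - pos z))"
    by (rule lborel_integral_translation) measurable
  finally show ?thesis .
qed

lemma tf_shift_dist_bounded:
  assumes u: "schwartz u" and \<phi>: "schwartz \<phi>"
  obtains B where "\<And>z. cmod (tf_shift_dist z (dist_of u) \<phi>) \<le> B"
proof -
  obtain c where c: "0 \<le> c" "\<And>x. cmod (u x) \<le> c * decay 0 x" using schwartz_le_decay[OF u, of 0] by blast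
  have [measurable]: "u \<in> borel_measurable borel" "\<phi> \<in> borel_measurable borel"
    using schwartz_borel u \<phi> by blast+
  have le: "cmod (\<phi> x * ch (freq z \<bullet> x) * u (x - pos z)) \<le> cmod (\<phi> x) * c" for x z
    using c(2)[of "x - pos z"] by (simp add: norm_mult decay_def mult_left_mono)
  have i: "integrable lborel (\<lambda>x. cmod (\<phi> x) * c)" by (intro integrable_mult_left integrable_norm schwartz_integrable \<phi>)
  have "integrable lborel (\<lambda>x. \<phi> x * ch (freq z \<bullet> x) * u (x - pos z))" for z
    by (rule Bochner_Integration.integrable_bound[OF i]) (use order_trans[OF le abs_ge_self] in \<open>auto intro!: AE_I2\<close>)
  from norm_integral_le[OF this i le] show thesis
    using that tf_shift_dist_dist_of[OF u \<phi>] by metis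
qed

text \<open>Up to a reflection, \<open>F\<close> is the convolution of \<open>G\<close> with the integrable kernel \<open>k\<close>; its Fourier transform factorizes.\<close>

lemma
  fixes k :: "(real^'d) \<times> (real^'d) \<Rightarrow> complex" and G :: "real^('d + 'd::finite) \<Rightarrow> complex"
  assumes k: "integrable lborel k" and Gc: "continuous_on UNIV G" and Gi: "integrable lborel G"
    and Gb: "\<And>z. cmod (G z) \<le> c"
  defines "F \<equiv> \<lambda>z. (LBINT p. k p * G (z + join p))"
  shows convolution_continuous: "continuous_on UNIV F" and convolution_integrable: "integrable lborel F"
    and convolution_fourier: "(LBINT z. F z * ch (\<zeta> \<bullet> z)) = (LBINT p. k p * ch (- (\<zeta> \<bullet> join p))) * (LBINT z. G z * ch (\<zeta> \<bullet> z))"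
proof -
  have [measurable]: "k \<in> borel_measurable borel" "G \<in> borel_measurable borel" using k Gi by auto
  have jm: "(\<lambda>p. z + join p) \<in> borel_measurable (borel :: ((real^'d) \<times> (real^'d)) measure)" for z :: "real^('d+'d)"
    by measurable
  have bi: "integrable lborel (\<lambda>p. cmod (k p) * c)" using k by (intro integrable_mult_left) auto
  have le: "cmod (k p * G (z + join p)) \<le> cmod (k p) * c" for p z
    unfolding norm_mult by (intro mult_left_mono Gb) simp
  have meas: "(\<lambda>p. k p * G (z + join p)) \<in> borel_measurable lborel" for z using jm by simp
  show "continuous_on UNIV F"
    unfolding continuous_on_sequentially
  proof (intro allI ballI impI, elim conjE)
    fix X :: "nat \<Rightarrow> real^('d + 'd)" and a assume X: "X \<longlonglongrightarrow> a"
    show "(F \<circ> X) \<longlonglongrightarrow> F a"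
      unfolding F_def o_def
    proof (rule integral_dominated_convergence[OF meas meas bi])
      have Gc': "isCont G x" for x using Gc by (simp add: continuous_on_eq_continuous_at)
      show "AE p in lborel. (\<lambda>n. k p * G (X n + join p)) \<longlonglongrightarrow> k p * G (a + join p)"
        by (intro AE_I2 tendsto_mult tendsto_const isCont_tendsto_compose[OF Gc'] tendsto_add X)
    qed (use le in auto)
  qed
  have pair: "integrable (lborel \<Otimes>\<^sub>M lborel) (\<lambda>(p, z). k p * G (z + join p))"
  proof (rule lborel_pair.Fubini_integrable)
    have Gt: "integrable lborel (\<lambda>z. G (z + join p))" for p
      using lborel_integrable_translation[OF Gi, of "join p"] by (simp add: add.commute)
    have "(LBINT z. cmod (G (z + join p))) = (LBINT z. cmod (G z))" for p
      using lborel_integral_translation[of "\<lambda>z. cmod (G z)" "join p"] by (simp add: add.commute)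
    then have "(LBINT z. norm (case (p, z) of (p, z) \<Rightarrow> k p * G (z + join p))) = cmod (k p) * (LBINT z. cmod (G z))" for p
      by (simp add: norm_mult)
    then show "integrable lborel (\<lambda>p. (LBINT z. norm (case (p, z) of (p, z) \<Rightarrow> k p * G (z + join p))))"
      using integrable_mult_left[OF integrable_norm[OF k]] by presburger
    show "AE p in lborel. integrable lborel (\<lambda>z. case (p, z) of (p, z) \<Rightarrow> k p * G (z + join p))"
      using integrable_mult_right[OF Gt] by (intro AE_I2) simp
    show "(\<lambda>(p, z). k p * G (z + join p)) \<in> borel_measurable (lborel \<Otimes>\<^sub>M lborel)"
      by measurable
  qed
  show "integrable lborel F"
    unfolding F_def using lborel_pair.integrable_snd[OF pair] .
  have "integrable (lborel \<Otimes>\<^sub>M lborel) (\<lambda>q. (case q of (p, z) \<Rightarrow> k p * G (z + join p)) * ch (\<zeta> \<bullet> snd q))"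
    by (rule integrable_mult_ch[OF pair]) measurable
  then have "integrable (lborel \<Otimes>\<^sub>M lborel) (\<lambda>(p, z). k p * G (z + join p) * ch (\<zeta> \<bullet> z))"
    by (simp add: case_prod_beta')
  from lborel_pair.Fubini_integral[OF this]
  have "(LBINT z. F z * ch (\<zeta> \<bullet> z)) = (LBINT p. (LBINT z. k p * G (z + join p) * ch (\<zeta> \<bullet> z)))"
    by (simp add: F_def)
  also have "\<dots> = (LBINT p. k p * ch (- (\<zeta> \<bullet> join p)) * (LBINT z. G z * ch (\<zeta> \<bullet> z)))"
  proof (rule Bochner_Integration.integral_cong[OF refl])
    fix p :: "(real^'d) \<times> (real^'d)"
    have "k p * G (z + join p) * ch (\<zeta> \<bullet> z) = k p * ch (- (\<zeta> \<bullet> join p)) * (G (join p + z) * ch (\<zeta> \<bullet> (join p + z)))" for z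
    proof -
      have "\<zeta> \<bullet> z = - (\<zeta> \<bullet> join p) + \<zeta> \<bullet> (join p + z)" by (simp add: inner_add_right)
      then show ?thesis by (simp only: ch_add add.commute[of z] mult_ac)
    qed
    then show "(LBINT z. k p * G (z + join p) * ch (\<zeta> \<bullet> z)) = k p * ch (- (\<zeta> \<bullet> join p)) * (LBINT z. G z * ch (\<zeta> \<bullet> z))"
      using lborel_integral_translation[of "\<lambda>z. G z * ch (\<zeta> \<bullet> z)" "join p"]
      by (simp only: integral_mult_right_zero) simp
  qed
  also have "\<dots> = (LBINT p. k p * ch (- (\<zeta> \<bullet> join p))) * (LBINT z. G z * ch (\<zeta> \<bullet> z))"
    by (rule integral_mult_left_zero)
  finally show "(LBINT z. F z * ch (\<zeta> \<bullet> z)) = (LBINT p. k p * ch (- (\<zeta> \<bullet> join p))) * (LBINT z. G z * ch (\<zeta> \<bullet> z))" .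
qed

lemma matrix_inv_transpose_inner: "x \<bullet> (A *v y) = (transpose A *v x) \<bullet> y" for A :: "real^'n::finite^'m::finite"
  by (simp add: dot_lmul_matrix)

text \<open>The convolution \<open>F\<close> need not decay at any rate. Its majorant \<open>V\<close>, the same average of translates of \<open>decay M\<close>,
  nevertheless inherits moderateness and bounded lattice sums, because these hold for all translates of
  \<open>decay M\<close> with the same constants.\<close>

lemma poisson_summation_convolution:
  fixes k :: "(real^'d) \<times> (real^'d) \<Rightarrow> complex" and u \<phi> :: "'d::finite cfun" and L :: "real^('d + 'd)^('d + 'd)"
  assumes k: "integrable lborel k" and u: "schwartz u" and \<phi>: "schwartz \<phi>" and L: "invertible L"
  defines "F \<equiv> \<lambda>z. (LBINT p. k p * rihaczek u \<phi> (z + join p))"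
  defines "\<zeta> \<equiv> \<lambda>\<kappa>. transpose (matrix_inv L) *v int_vec \<kappa>"
  defines "c \<equiv> \<lambda>\<kappa>. (LBINT p. k p * ch (- (\<zeta> \<kappa> \<bullet> join p))) * (LBINT z. rihaczek u \<phi> z * ch (\<zeta> \<kappa> \<bullet> z)) / of_real \<bar>det L\<bar>"
  assumes cs: "(\<lambda>\<kappa>. cmod (c \<kappa>)) summable_on UNIV"
  shows "((\<lambda>\<kappa>. F (- (L *v int_vec \<kappa>))) has_sum (\<Sum>\<^sub>\<infinity>\<kappa>. c \<kappa>)) UNIV"
proof -
  let ?M = "CARD('d + 'd) + 2"
  let ?G = "rihaczek u \<phi>"
  obtain C where C: "0 \<le> C" "\<And>z. cmod (?G z) \<le> C * decay ?M z" using rihaczek_le_decay[OF u \<phi>] by blast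
  have Gc: "continuous_on UNIV ?G" by (rule continuous_on_rihaczek[OF u \<phi>])
  have Gi: "integrable lborel ?G" by (rule integrable_rihaczek[OF u \<phi>])
  have [measurable]: "k \<in> borel_measurable borel" "?G \<in> borel_measurable borel" using k Gi by auto
  have d1: "decay ?M z \<le> 1" for z :: "real^('d+'d)"
    unfolding decay_def using one_le_power[of "1 + norm z" ?M] by simp
  have Gb: "cmod (?G z) \<le> C" for z
    using C(2)[of z] mult_left_mono[OF d1 C(1), of z] by simp
  have conv: "continuous_on UNIV F" "integrable lborel F"
    unfolding F_def by (rule convolution_continuous convolution_integrable; fact k Gc Gi Gb)+
  have Fm: "F \<in> borel_measurable borel" using conv(2) by auto
  have conv3: "(LBINT z. F z * ch (w \<bullet> z))
      = (LBINT p. k p * ch (- (w \<bullet> join p))) * (LBINT z. ?G z * ch (w \<bullet> z))" for w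
    unfolding F_def by (rule convolution_fourier[OF k Gc Gi Gb])
  obtain K where K: "\<And>p S. finite S \<Longrightarrow> (\<Sum>\<kappa>\<in>S. decay ?M (L *v int_vec \<kappa> + p)) \<le> K"
    using lattice_decay_sum_bounded[OF L, of ?M] by auto
  define V where "V z = (LBINT p. cmod (k p) * (C * decay ?M (z - join p)))" for z
  have Vi: "integrable lborel (\<lambda>p. cmod (k p) * (C * decay ?M (z - join p)))" for z
  proof (rule Bochner_Integration.integrable_bound)
    show "integrable lborel (\<lambda>p. cmod (k p) * C)" using k by (intro integrable_mult_left) auto
    have "cmod (k p) * (C * decay ?M (z - join p)) \<le> cmod (k p) * C" for p
      using mult_left_mono[OF d1 C(1), of "z - join p"] by (intro mult_left_mono) auto
    then show "AE p in lborel. norm (cmod (k p) * (C * decay ?M (z - join p))) \<le> norm (cmod (k p) * C)"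
      using C(1) by (intro AE_I2) (simp add: abs_mult)
    have "(\<lambda>p. z - join p) \<in> borel_measurable borel" by measurable
    then show "(\<lambda>p. cmod (k p) * (C * decay ?M (z - join p))) \<in> borel_measurable lborel" by simp
  qed
  have FV: "cmod (F (- z)) \<le> V z" for z
    unfolding F_def V_def
  proof (rule norm_integral_le[OF _ Vi])
    show le: "norm (k p * ?G (- z + join p)) \<le> cmod (k p) * (C * decay ?M (z - join p))" for p
      using C(2)[of "- z + join p"] decay_minus[of ?M "z - join p"] by (simp add: norm_mult mult_left_mono)
    have "(\<lambda>p. - z + join p) \<in> borel_measurable borel" by measurable
    then have "(\<lambda>p. k p * ?G (- z + join p)) \<in> borel_measurable lborel" by simp
    then show "integrable lborel (\<lambda>p. k p * ?G (- z + join p))"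
      by (rule Bochner_Integration.integrable_bound[OF Vi[of z]]) (use order_trans[OF le abs_ge_self] in \<open>auto intro!: AE_I2\<close>)
  qed
  have "((\<lambda>\<kappa>. F (- (L *v int_vec \<kappa>))) has_sum (\<Sum>\<^sub>\<infinity>\<kappa>. c \<kappa>)) UNIV"
  proof (rule poisson_summation_lattice[OF L, of "\<lambda>z. F (- z)" V ?M])
    show "continuous_on UNIV (\<lambda>z. F (- z))"
      by (rule continuous_on_compose2[OF conv(1)]) (auto intro: continuous_intros)
    show "integrable lborel (\<lambda>z. F (- z))"
      using lborel_integrable_scale[OF Fm, of "-1"] conv(2) by simp
    show "cmod (F (- z)) \<le> V z" for z by (rule FV)
    show "V (z + x) \<le> (1 + norm x) ^ ?M * V z" for z x
    proof -
      have "V (z + x) \<le> (LBINT p. (1 + norm x) ^ ?M * (cmod (k p) * (C * decay ?M (z - join p))))"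
        unfolding V_def
      proof (rule integral_mono[OF Vi integrable_mult_right[OF Vi]])
        fix p
        have "decay ?M (z + x - join p) \<le> (1 + norm (- x)) ^ ?M * decay ?M (z + x - join p + - x)" by (rule decay_shift)
        then have "decay ?M (z + x - join p) \<le> (1 + norm x) ^ ?M * decay ?M (z - join p)" by simp
        then have "cmod (k p) * (C * decay ?M (z + x - join p)) \<le> cmod (k p) * (C * ((1 + norm x) ^ ?M * decay ?M (z - join p)))"
          using C(1) by (intro mult_left_mono) auto
        then show "cmod (k p) * (C * decay ?M (z + x - join p)) \<le> (1 + norm x) ^ ?M * (cmod (k p) * (C * decay ?M (z - join p)))"
          by (simp only: mult_ac)
      qed
      then show ?thesis by (simp add: V_def)
    qed
    show "(\<Sum>\<kappa>\<in>S. V (L *v int_vec \<kappa>)) \<le> (LBINT p. cmod (k p) * (C * K))" if S: "finite S" for S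
    proof -
      have "(\<Sum>\<kappa>\<in>S. V (L *v int_vec \<kappa>)) = (LBINT p. (\<Sum>\<kappa>\<in>S. cmod (k p) * (C * decay ?M (L *v int_vec \<kappa> - join p))))"
        unfolding V_def by (rule Bochner_Integration.integral_sum[symmetric]) (rule Vi)
      also have "\<dots> \<le> (LBINT p. cmod (k p) * (C * K))"
      proof (rule integral_mono)
        show "integrable lborel (\<lambda>p. \<Sum>\<kappa>\<in>S. cmod (k p) * (C * decay ?M (L *v int_vec \<kappa> - join p)))"
          by (rule Bochner_Integration.integrable_sum) (rule Vi)
        show "integrable lborel (\<lambda>p. cmod (k p) * (C * K))" using k by (intro integrable_mult_left) auto
        fix p
        show "(\<Sum>\<kappa>\<in>S. cmod (k p) * (C * decay ?M (L *v int_vec \<kappa> - join p))) \<le> cmod (k p) * (C * K)"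
          unfolding sum_distrib_left[symmetric] using K[OF S, of "- join p"] C(1)
          by (intro mult_left_mono) auto
      qed
      finally show ?thesis .
    qed
    show "c \<kappa> = (LBINT z. F (- z) * ch (- (int_vec \<kappa> \<bullet> (matrix_inv L *v z)))) / of_real \<bar>det L\<bar>" for \<kappa>
    proof -
      have "(LBINT z. F (- z) * ch (- (int_vec \<kappa> \<bullet> (matrix_inv L *v z)))) = (LBINT z. F (- z) * ch (\<zeta> \<kappa> \<bullet> (- z)))"
        by (simp add: matrix_inv_transpose_inner \<zeta>_def)
      also have "\<dots> = (LBINT z. F z * ch (\<zeta> \<kappa> \<bullet> z))"
        by (rule lborel_integral_reflect) (use Fm in measurable)
      finally show ?thesis by (simp only: c_def conv3)
    qed
  qed (rule cs)
  then show ?thesis .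
qed

text \<open>With \<open>g\<close> a superposition of characters with density \<open>h\<close>, and \<open>\<gamma>\<close> one of point masses, the product
  \<open>(u, \<pi>\<^sub>z g) \<langle>\<pi>\<^sub>z \<gamma>, \<phi>\<rangle>\<close> is a superposition of translates of \<open>rihaczek u \<phi>\<close> with this kernel as density. The phase
  compensates the part of the phase of the translated function that does not depend on \<open>z\<close>.\<close>

definition gabor_kernel :: "'d::finite cfun \<Rightarrow> 'd cfun \<Rightarrow> (real^'d) \<times> (real^'d) \<Rightarrow> complex" where
  "gabor_kernel \<gamma> h p = \<gamma> (fst p) * cnj (h (snd p)) * ch (- (fst p \<bullet> snd p))"

lemma integrable_gabor_kernel:
  fixes \<gamma> h :: "'d::finite cfun"
  assumes "integrable lborel \<gamma>" "integrable lborel h" shows "integrable lborel (gabor_kernel \<gamma> h)"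
proof -
  have "(\<lambda>p. ch (- (fst p \<bullet> snd p))) \<in> borel_measurable ((lborel :: (real^'d) measure) \<Otimes>\<^sub>M (lborel :: (real^'d) measure))"
    by measurable
  from integrable_pair_bounded[OF assms(1) _ this, of "\<lambda>x. cnj (h x)" 1]
  show ?thesis using assms(2) unfolding gabor_kernel_def[abs_def] lborel_prod by simp
qed

lemma gabor_coefficient_eq:
  fixes h u :: "'d::finite cfun"
  assumes h: "integrable lborel h" and u: "schwartz u"
  shows "(LBINT t. u t * cnj (ch (w \<bullet> t) * (LBINT \<xi>. h \<xi> * ch ((t - x) \<bullet> \<xi>))))
    = (LBINT \<xi>. cnj (h \<xi>) * ch (x \<bullet> \<xi>) * fourier u (w + \<xi>))"
proof -
  have [measurable]: "u \<in> borel_measurable borel" by (rule schwartz_borel[OF u])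
  have hc: "integrable lborel (\<lambda>\<xi>. cnj (h \<xi>))" using h by simp
  let ?\<Phi> = "\<lambda>p. ch (- (w \<bullet> fst p)) * ch (- ((fst p - x) \<bullet> snd p))"
  have \<Phi>: "?\<Phi> \<in> borel_measurable ((lborel :: (real^'d) measure) \<Otimes>\<^sub>M (lborel :: (real^'d) measure))" by measurable
  have "u t * cnj (ch (w \<bullet> t) * (LBINT \<xi>. h \<xi> * ch ((t - x) \<bullet> \<xi>))) = (LBINT \<xi>. u t * cnj (h \<xi>) * ?\<Phi> (t, \<xi>))" for t
  proof -
    have "cnj (LBINT \<xi>. h \<xi> * ch ((t - x) \<bullet> \<xi>)) = (LBINT \<xi>. cnj (h \<xi>) * ch (- ((t - x) \<bullet> \<xi>)))"
      by (subst Bochner_Integration.integral_cnj[symmetric]) (simp add: ch_minus del: Bochner_Integration.integral_cnj)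
    moreover have "u t * cnj (h \<xi>) * ?\<Phi> (t, \<xi>) = u t * ch (- (w \<bullet> t)) * (cnj (h \<xi>) * ch (- ((t - x) \<bullet> \<xi>)))" for \<xi>
      by (simp only: fst_conv snd_conv mult_ac)
    ultimately show ?thesis by (simp only: integral_mult_right_zero complex_cnj_mult ch_minus[symmetric] mult.assoc)
  qed
  then have "(LBINT t. u t * cnj (ch (w \<bullet> t) * (LBINT \<xi>. h \<xi> * ch ((t - x) \<bullet> \<xi>))))
      = (LBINT t. (LBINT \<xi>. u t * cnj (h \<xi>) * ?\<Phi> (t, \<xi>)))" by (simp only:)
  also have "\<dots> = (LBINT \<xi>. (LBINT t. u t * cnj (h \<xi>) * ?\<Phi> (t, \<xi>)))"
    by (rule Fubini_bounded[OF schwartz_integrable[OF u] hc \<Phi>, where B=1]) (simp add: norm_mult)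
  also have "\<dots> = (LBINT \<xi>. cnj (h \<xi>) * ch (x \<bullet> \<xi>) * fourier u (w + \<xi>))"
  proof (rule Bochner_Integration.integral_cong[OF refl])
    fix \<xi>
    have "u t * cnj (h \<xi>) * ?\<Phi> (t, \<xi>) = cnj (h \<xi>) * ch (x \<bullet> \<xi>) * (u t * ch (- (t \<bullet> (w + \<xi>))))" for t
    proof -
      have "ch (- (w \<bullet> t)) * ch (- ((t - x) \<bullet> \<xi>)) = ch (x \<bullet> \<xi>) * ch (- (t \<bullet> (w + \<xi>)))"
        unfolding ch_add[symmetric] by (rule arg_cong[where f=ch])
          (simp add: inner_diff_left inner_add_right inner_commute[of t w])
      then show ?thesis by (simp add: mult_ac)
    qed
    then show "(LBINT t. u t * cnj (h \<xi>) * ?\<Phi> (t, \<xi>)) = cnj (h \<xi>) * ch (x \<bullet> \<xi>) * fourier u (w + \<xi>)"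
      by (simp only: integral_mult_right_zero fourier_lborel[OF schwartz_borel[OF u]])
  qed
  finally show ?thesis .
qed

lemma gabor_term_eq_convolution:
  fixes \<gamma> h u \<phi> :: "'d::finite cfun"
  assumes \<gamma>: "integrable lborel \<gamma>" and h: "integrable lborel h" and u: "schwartz u" and \<phi>: "schwartz \<phi>"
  shows "(LBINT t. u t * cnj (ch (freq z \<bullet> t) * (LBINT \<xi>. h \<xi> * ch ((t - pos z) \<bullet> \<xi>))))
      * (LBINT t. ch (freq z \<bullet> t) * \<gamma> (t - pos z) * \<phi> t)
    = (LBINT p. gabor_kernel \<gamma> h p * rihaczek u \<phi> (z + join p))"
proof -
  have [measurable]: "\<phi> \<in> borel_measurable borel" "fourier u \<in> borel_measurable borel" "\<gamma> \<in> borel_measurable borel"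
    using schwartz_borel \<phi> schwartz_fourier u \<gamma> by auto
  have hc: "integrable lborel (\<lambda>\<xi>. cnj (h \<xi>))" using h by simp
  let ?x = "pos z" and ?w = "freq z"
  let ?\<Phi> = "\<lambda>p. ch (?w \<bullet> (fst p + ?x)) * \<phi> (fst p + ?x) * (ch (?x \<bullet> snd p) * fourier u (?w + snd p))"
  obtain a where a: "0 \<le> a" "\<And>x. cmod (\<phi> x) \<le> a * decay 0 x" using schwartz_le_decay[OF \<phi>, of 0] by blast
  obtain b where b: "0 \<le> b" "\<And>x. cmod (fourier u x) \<le> b * decay 0 x"
    using schwartz_le_decay[OF schwartz_fourier[OF u], of 0] by blast
  have \<Phi>b: "cmod (?\<Phi> p) \<le> a * b" for p
    unfolding norm_mult norm_ch mult_1_left using a b by (intro mult_mono) (auto simp: decay_def)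
  have \<Phi>: "?\<Phi> \<in> borel_measurable ((lborel :: (real^'d) measure) \<Otimes>\<^sub>M (lborel :: (real^'d) measure))" by measurable
  have "(LBINT t. ch (?w \<bullet> t) * \<gamma> (t - ?x) * \<phi> t) = (LBINT t. \<gamma> t * (ch (?w \<bullet> (t + ?x)) * \<phi> (t + ?x)))"
    using lborel_integral_translation[of "\<lambda>t. ch (?w \<bullet> t) * \<gamma> (t - ?x) * \<phi> t" ?x] by (simp add: add.commute mult_ac)
  then have "(LBINT t. u t * cnj (ch (?w \<bullet> t) * (LBINT \<xi>. h \<xi> * ch ((t - ?x) \<bullet> \<xi>))))
      * (LBINT t. ch (?w \<bullet> t) * \<gamma> (t - ?x) * \<phi> t)
      = (LBINT t. \<gamma> t * (ch (?w \<bullet> (t + ?x)) * \<phi> (t + ?x)) * (LBINT \<xi>. cnj (h \<xi>) * ch (?x \<bullet> \<xi>) * fourier u (?w + \<xi>)))"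
    by (simp only: gabor_coefficient_eq[OF h u] integral_mult_left_zero mult.commute)
  also have "\<dots> = (LBINT t. (LBINT \<xi>. \<gamma> t * cnj (h \<xi>) * ?\<Phi> (t, \<xi>)))"
    unfolding integral_mult_right_zero[symmetric] by (simp only: fst_conv snd_conv mult_ac)
  also have "\<dots> = (\<integral>p. \<gamma> (fst p) * cnj (h (snd p)) * ?\<Phi> p \<partial>(lborel \<Otimes>\<^sub>M lborel))"
    by (rule integral_pair_bounded[OF \<gamma> hc \<Phi> \<Phi>b, symmetric])
  also have "\<dots> = (LBINT p. gabor_kernel \<gamma> h p * rihaczek u \<phi> (z + join p))"
    unfolding lborel_prod
  proof (rule Bochner_Integration.integral_cong[OF refl])
    fix p :: "(real^'d) \<times> (real^'d)"
    have "ch (- (fst p \<bullet> snd p)) * ch ((?x + fst p) \<bullet> (?w + snd p)) = ch (?w \<bullet> (fst p + ?x)) * ch (?x \<bullet> snd p)"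
      unfolding ch_add[symmetric] by (rule arg_cong[where f=ch]) (simp add: inner_add_left inner_add_right inner_commute)
    then show "\<gamma> (fst p) * cnj (h (snd p)) * ?\<Phi> p = gabor_kernel \<gamma> h p * rihaczek u \<phi> (z + join p)"
      by (simp add: gabor_kernel_def rihaczek_def add.commute mult_ac)
  qed
  finally show ?thesis .
qed

text \<open>The integral over the second variable of the kernel reassembles \<open>g\<close> from its density. The right-hand side is the value
  of \<open>V\<^sub>g\<gamma>\<close> at \<open>\<J> \<zeta>\<close>.\<close>

lemma gabor_kernel_fourier:
  fixes \<gamma> h :: "'d::finite cfun"
  assumes \<gamma>: "integrable lborel \<gamma>" and h: "integrable lborel h"
  shows "(LBINT p. gabor_kernel \<gamma> h p * ch (- (\<zeta> \<bullet> join p)))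
    = (LBINT t. \<gamma> t * ch (- (pos \<zeta> \<bullet> t)) * cnj (LBINT \<xi>. h \<xi> * ch ((t + freq \<zeta>) \<bullet> \<xi>)))"
proof -
  have hc: "integrable lborel (\<lambda>\<xi>. cnj (h \<xi>))" using h by simp
  let ?\<Phi> = "\<lambda>p. ch (- (pos \<zeta> \<bullet> fst p)) * ch (- ((fst p + freq \<zeta>) \<bullet> snd p))"
  have \<Phi>: "?\<Phi> \<in> borel_measurable ((lborel :: (real^'d) measure) \<Otimes>\<^sub>M (lborel :: (real^'d) measure))" by measurable
  have "gabor_kernel \<gamma> h p * ch (- (\<zeta> \<bullet> join p)) = \<gamma> (fst p) * cnj (h (snd p)) * ?\<Phi> p" for p
  proof -
    have "ch (- (fst p \<bullet> snd p)) * ch (- (\<zeta> \<bullet> join p)) = ?\<Phi> p"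
      unfolding ch_add[symmetric] by (rule arg_cong[where f=ch]) (simp add: inner_phase_space inner_add_left)
    then show ?thesis by (simp add: gabor_kernel_def mult.assoc)
  qed
  then have "(LBINT p. gabor_kernel \<gamma> h p * ch (- (\<zeta> \<bullet> join p))) = (\<integral>p. \<gamma> (fst p) * cnj (h (snd p)) * ?\<Phi> p \<partial>(lborel \<Otimes>\<^sub>M lborel))"
    by (simp only: lborel_prod)
  also have "\<dots> = (LBINT t. (LBINT \<xi>. \<gamma> t * cnj (h \<xi>) * ?\<Phi> (t, \<xi>)))"
    by (rule integral_pair_bounded[OF \<gamma> hc \<Phi>, where B=1]) (simp add: norm_mult)
  also have "\<dots> = (LBINT t. \<gamma> t * ch (- (pos \<zeta> \<bullet> t)) * cnj (LBINT \<xi>. h \<xi> * ch ((t + freq \<zeta>) \<bullet> \<xi>)))"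
  proof (rule Bochner_Integration.integral_cong[OF refl])
    fix t
    have "cnj (LBINT \<xi>. h \<xi> * ch ((t + freq \<zeta>) \<bullet> \<xi>)) = (LBINT \<xi>. cnj (h \<xi>) * ch (- ((t + freq \<zeta>) \<bullet> \<xi>)))"
      by (subst Bochner_Integration.integral_cnj[symmetric]) (simp add: ch_minus del: Bochner_Integration.integral_cnj)
    moreover have "\<gamma> t * cnj (h \<xi>) * ?\<Phi> (t, \<xi>) = \<gamma> t * ch (- (pos \<zeta> \<bullet> t)) * (cnj (h \<xi>) * ch (- ((t + freq \<zeta>) \<bullet> \<xi>)))" for \<xi>
      by (simp only: fst_conv snd_conv mult_ac)
    ultimately show "(LBINT \<xi>. \<gamma> t * cnj (h \<xi>) * ?\<Phi> (t, \<xi>)) = \<gamma> t * ch (- (pos \<zeta> \<bullet> t)) * cnj (LBINT \<xi>. h \<xi> * ch ((t + freq \<zeta>) \<bullet> \<xi>))"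
      by (simp only: integral_mult_right_zero)
  qed
  finally show ?thesis .
qed

lemma symplectic_J_mult: "symplectic_J *v z = join (- freq z, pos z)"
proof -
  have "(symplectic_J *v z) $ i = join (- freq z, pos z) $ i" for i
    by (cases i) (simp_all add: matrix_vector_mult_def sum_UNIV_Plus symplectic_J_def join_def pos_def freq_def
        if_distrib[of "\<lambda>a. a * _"] cong: if_cong)
  then show ?thesis by (simp add: vec_eq_iff)
qed

lemma adjoint_point_eq:
  "adjoint_point L \<kappa> = join (- freq (transpose (matrix_inv L) *v int_vec \<kappa>), pos (transpose (matrix_inv L) *v int_vec \<kappa>))"
  unfolding adjoint_point_def by (simp only: matrix_vector_mul_assoc[symmetric] symplectic_J_mult)

text \<open>Poisson summation turns the sum over the lattice \<open>L \<int>\<^sup>2\<^sup>d\<close> into one over the dual lattice \<open>L\<^sup>-\<^sup>T \<int>\<^sup>2\<^sup>d\<close>. Both factors of the Fourier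
  transform at \<open>\<zeta>\<close> in the dual lattice are values at \<open>\<J> \<zeta>\<close>; this is where the adjoint points come from.\<close>

theorem janssen_representation:
  fixes g \<gamma> u \<phi> :: "'d::finite cfun" and L :: "real^('d + 'd)^('d + 'd)"
  assumes \<gamma>: "integrable lebesgue \<gamma>" and g: "fourier_in_L1 g" and L: "invertible L"
    and u: "schwartz u" and \<phi>: "schwartz \<phi>"
    and sm: "(\<lambda>\<kappa>. cmod (stft g \<gamma> (adjoint_point L \<kappa>))) summable_on UNIV"
  shows "((\<lambda>\<kappa>. L2_product u (tf_shift (- (L *v int_vec \<kappa>)) g) * dist_of (tf_shift (- (L *v int_vec \<kappa>)) \<gamma>) \<phi>)
    has_sum (\<Sum>\<^sub>\<infinity>\<kappa>. stft g \<gamma> (adjoint_point L \<kappa>) * tf_shift_dist (adjoint_point L \<kappa>) (dist_of u) \<phi> / of_real \<bar>det L\<bar>)) UNIV"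
proof -
  obtain h where h: "integrable lborel h" and gh: "AE t in lebesgue. g t = (LBINT \<xi>. h \<xi> * ch (t \<bullet> \<xi>))"
    using fourier_in_L1_representation[OF g] by blast
  obtain \<gamma>' where \<gamma>'m [measurable]: "\<gamma>' \<in> borel_measurable borel" and \<gamma>\<gamma>': "AE t in lebesgue. \<gamma> t = \<gamma>' t"
    using borel_version[of \<gamma>] \<gamma> by auto
  have "\<gamma>' \<in> borel_measurable lebesgue" by (intro measurable_completion) simp
  then have "integrable lebesgue \<gamma>'" using \<gamma> \<gamma>\<gamma>' by (subst integrable_cong_AE[symmetric]) auto
  then have \<gamma>': "integrable lborel \<gamma>'" by (simp add: integrable_completion)
  have [measurable]: "h \<in> borel_measurable borel" "u \<in> borel_measurable borel" "\<phi> \<in> borel_measurable borel"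
    using h schwartz_borel u \<phi> by auto
  define gt where "gt t = (LBINT \<xi>. h \<xi> * ch (t \<bullet> \<xi>))" for t
  have gtm [measurable]: "gt \<in> borel_measurable borel" unfolding gt_def by measurable
  have ggt: "AE t in lebesgue. g t = gt t" using gh by (simp add: gt_def)
  let ?k = "gabor_kernel \<gamma>' h"
  let ?F = "\<lambda>z. (LBINT p. ?k p * rihaczek u \<phi> (z + join p))"
  let ?\<zeta> = "\<lambda>\<kappa>. transpose (matrix_inv L) *v int_vec \<kappa>"
  let ?c = "\<lambda>\<kappa>. (LBINT p. ?k p * ch (- (?\<zeta> \<kappa> \<bullet> join p))) * (LBINT z. rihaczek u \<phi> z * ch (?\<zeta> \<kappa> \<bullet> z)) / of_real \<bar>det L\<bar>"
  have coeff: "L2_product u (tf_shift z g) * dist_of (tf_shift z \<gamma>) \<phi> = ?F z" for z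
  proof -
    have "L2_product u (tf_shift z g) = (LBINT t. u t * cnj (ch (freq z \<bullet> t) * gt (t - pos z)))"
      unfolding L2_product_def tf_shift_eq
    proof (rule integral_lebesgue_eq_lborel)
      show "AE t in lebesgue. u t * cnj (ch (freq z \<bullet> t) * g (t - pos z)) = u t * cnj (ch (freq z \<bullet> t) * gt (t - pos z))"
        using AE_lebesgue_translation[OF ggt, of "pos z"] by eventually_elim simp
    qed measurable
    moreover have "dist_of (tf_shift z \<gamma>) \<phi> = (LBINT t. ch (freq z \<bullet> t) * \<gamma>' (t - pos z) * \<phi> t)"
      unfolding dist_of_def tf_shift_eq if_P[OF \<phi>]
    proof (rule integral_lebesgue_eq_lborel)
      show "AE t in lebesgue. ch (freq z \<bullet> t) * \<gamma> (t - pos z) * \<phi> t = ch (freq z \<bullet> t) * \<gamma>' (t - pos z) * \<phi> t"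
        using AE_lebesgue_translation[OF \<gamma>\<gamma>', of "pos z"] by eventually_elim simp
    qed measurable
    ultimately show ?thesis
      using gabor_term_eq_convolution[OF \<gamma>' h u \<phi>, of z] by (simp only: gt_def)
  qed
  have c: "?c \<kappa> = stft g \<gamma> (adjoint_point L \<kappa>) * tf_shift_dist (adjoint_point L \<kappa>) (dist_of u) \<phi> / of_real \<bar>det L\<bar>" for \<kappa>
  proof -
    let ?w = "adjoint_point L \<kappa>"
    have w: "pos ?w = - freq (?\<zeta> \<kappa>)" "freq ?w = pos (?\<zeta> \<kappa>)" by (simp_all add: adjoint_point_eq)
    have "stft g \<gamma> ?w = (LBINT t. \<gamma>' t * ch (- (freq ?w \<bullet> t)) * cnj (gt (t - pos ?w)))"
      unfolding stft_eq
    proof (rule integral_lebesgue_eq_lborel)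
      show "AE t in lebesgue. \<gamma> t * ch (- (freq ?w \<bullet> t)) * cnj (g (t - pos ?w)) = \<gamma>' t * ch (- (freq ?w \<bullet> t)) * cnj (gt (t - pos ?w))"
        using \<gamma>\<gamma>' AE_lebesgue_translation[OF ggt, of "pos ?w"] by eventually_elim simp
    qed measurable
    then have "(LBINT p. ?k p * ch (- (?\<zeta> \<kappa> \<bullet> join p))) = stft g \<gamma> ?w"
      unfolding gabor_kernel_fourier[OF \<gamma>' h] gt_def w by (simp only: diff_minus_eq_add)
    moreover have "(LBINT z. rihaczek u \<phi> z * ch (?\<zeta> \<kappa> \<bullet> z)) = tf_shift_dist ?w (dist_of u) \<phi>"
      unfolding integral_rihaczek_character[OF u \<phi>] tf_shift_dist_dist_of[OF u \<phi>] w by simp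
    ultimately show ?thesis by (simp only:)
  qed
  \<comment> \<open>The second factor is bounded, so the coefficients inherit summability from the short-time Fourier transform.\<close>
  obtain B where B: "\<And>z. cmod (tf_shift_dist z (dist_of u) \<phi>) \<le> B" using tf_shift_dist_bounded[OF u \<phi>] by blast
  have cs: "(\<lambda>\<kappa>. cmod (?c \<kappa>)) summable_on UNIV"
  proof (rule summable_on_comparison_test)
    show "(\<lambda>\<kappa>. cmod (stft g \<gamma> (adjoint_point L \<kappa>)) * (B / \<bar>det L\<bar>)) summable_on UNIV"
      by (rule summable_on_cmult_left[OF sm])
    show "cmod (?c \<kappa>) \<le> cmod (stft g \<gamma> (adjoint_point L \<kappa>)) * (B / \<bar>det L\<bar>)" for \<kappa>
      unfolding c norm_divide norm_mult norm_of_real abs_abs times_divide_eq_right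
      by (intro divide_right_mono mult_left_mono B) auto
  qed auto
  show ?thesis
    using poisson_summation_convolution[OF integrable_gabor_kernel[OF \<gamma>' h] u \<phi> L cs]
    by (simp only: coeff c)
qed

section \<open>Absolutely convergent series of time-frequency shifts\<close>

lemma complex_banach_onD:
  assumes "complex_banach_on X nrm"
  shows "(\<lambda>\<phi>. 0) \<in> X"
    and "u \<in> X \<Longrightarrow> w \<in> X \<Longrightarrow> (\<lambda>\<phi>. u \<phi> + w \<phi>) \<in> X"
    and "u \<in> X \<Longrightarrow> (\<lambda>\<phi>. c * u \<phi>) \<in> X"
    and "u \<in> X \<Longrightarrow> nrm u \<ge> 0"
    and "nrm (\<lambda>\<phi>. 0) = 0"
    and "u \<in> X \<Longrightarrow> nrm (\<lambda>\<phi>. c * u \<phi>) = cmod c * nrm u"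
    and "u \<in> X \<Longrightarrow> w \<in> X \<Longrightarrow> nrm (\<lambda>\<phi>. u \<phi> + w \<phi>) \<le> nrm u + nrm w"
  using assms unfolding complex_banach_on_def by blast+

lemma complex_banach_on_diff:
  assumes X: "complex_banach_on X nrm" and "u \<in> X" "w \<in> X"
  shows "(\<lambda>\<phi>. u \<phi> - w \<phi>) \<in> X"
  using complex_banach_onD(2)[OF X assms(2) complex_banach_onD(3)[OF X assms(3), of "- 1"]] by simp

lemma complex_banach_on_sum:
  assumes X: "complex_banach_on X nrm" and U: "\<And>i. i \<in> A \<Longrightarrow> U i \<in> X"
  shows "(\<lambda>\<phi>. \<Sum>i\<in>A. U i \<phi>) \<in> X \<and> nrm (\<lambda>\<phi>. \<Sum>i\<in>A. U i \<phi>) \<le> (\<Sum>i\<in>A. nrm (U i))"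
  using U
proof (induction A rule: infinite_finite_induct)
  case (insert i A)
  then have "(\<lambda>\<phi>. \<Sum>i\<in>A. U i \<phi>) \<in> X" "nrm (\<lambda>\<phi>. \<Sum>i\<in>A. U i \<phi>) \<le> (\<Sum>i\<in>A. nrm (U i))" "U i \<in> X" by auto
  then show ?case
    using complex_banach_onD(2,7)[OF X, of "U i" "\<lambda>\<phi>. \<Sum>i\<in>A. U i \<phi>"] insert(1,2) by auto
qed (simp_all add: complex_banach_onD(1,5)[OF X])

text \<open>Convergence in the norm forces pointwise convergence because evaluation at a test function is
  continuous, so the pointwise sum is the limit that completeness provides.\<close>

proposition absolutely_convergent_series:
  fixes U :: "'i \<Rightarrow> 'd::finite functional"
  assumes I: "infinite (UNIV :: 'i set)" "countable (UNIV :: 'i set)"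
    and X: "complex_banach_on X nrm"
    and ev: "\<And>\<phi>. \<exists>K. \<forall>u\<in>X. cmod (u \<phi>) \<le> K * nrm u"
    and U: "\<And>i. U i \<in> X" and b: "\<And>i. nrm (U i) \<le> b i" and sm: "b summable_on UNIV"
  shows "(\<lambda>\<phi>. \<Sum>\<^sub>\<infinity>i. U i \<phi>) \<in> X" and "nrm (\<lambda>\<phi>. \<Sum>\<^sub>\<infinity>i. U i \<phi>) \<le> (\<Sum>\<^sub>\<infinity>i. b i)"
    and "(\<lambda>i. U i \<phi>) summable_on UNIV"
proof -
  note D = complex_banach_onD[OF X]
  have b0: "0 \<le> b i" for i using b[of i] D(4)[OF U[of i]] by linarith
  have abs: "(\<lambda>i. cmod (U i \<phi>)) summable_on UNIV" for \<phi>
  proof -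
    obtain K where K: "\<forall>u\<in>X. cmod (u \<phi>) \<le> K * nrm u" using ev by blast
    show ?thesis
    proof (rule summable_on_comparison_test[OF summable_on_cmult_right[OF sm, of "\<bar>K\<bar>"]])
      fix i
      have "cmod (U i \<phi>) \<le> K * nrm (U i)" using K U by blast
      also have "\<dots> \<le> \<bar>K\<bar> * b i" using b[of i] D(4)[OF U[of i]] by (intro mult_mono) auto
      finally show "cmod (U i \<phi>) \<le> \<bar>K\<bar> * b i" .
    qed simp
  qed
  show "(\<lambda>i. U i \<phi>) summable_on UNIV" by (rule abs_summable_summable[OF abs])
  obtain e :: "nat \<Rightarrow> 'i" where e: "bij_betw e UNIV UNIV"
    using bij_betw_from_nat_into[OF I(2,1)] by blast
  have bsum: "((\<lambda>n. b (e n)) has_sum (\<Sum>\<^sub>\<infinity>i. b i)) UNIV"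
    using has_sum_reindex_bij_betw[OF e, of b] sm by simp
  then have bsums: "(\<lambda>n. b (e n)) sums (\<Sum>\<^sub>\<infinity>i. b i)" by (rule has_sum_imp_sums)
  define P where "P n = (\<lambda>\<phi>. \<Sum>k<n. U (e k) \<phi>)" for n
  have PX: "P n \<in> X" and Pn: "nrm (P n) \<le> (\<Sum>\<^sub>\<infinity>i. b i)" for n
  proof -
    show "P n \<in> X" using complex_banach_on_sum[OF X, of "{..<n}" "\<lambda>k. U (e k)"] U by (simp add: P_def)
    have "nrm (P n) \<le> (\<Sum>k<n. nrm (U (e k)))"
      using complex_banach_on_sum[OF X, of "{..<n}" "\<lambda>k. U (e k)"] U by (simp add: P_def)
    also have "\<dots> \<le> (\<Sum>k<n. b (e k))" by (intro sum_mono b)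
    also have "\<dots> \<le> (\<Sum>\<^sub>\<infinity>i. b i)"
      using sum_le_suminf[OF sums_summable[OF bsums], of "{..<n}"] sums_unique[OF bsums] b0 by simp
    finally show "nrm (P n) \<le> (\<Sum>\<^sub>\<infinity>i. b i)" .
  qed
  have tail: "nrm (\<lambda>\<phi>. P m \<phi> - P n \<phi>) \<le> \<bar>(\<Sum>k<m. b (e k)) - (\<Sum>k<n. b (e k))\<bar>" for m n
  proof -
    have le: "nrm (\<lambda>\<phi>. P m \<phi> - P n \<phi>) \<le> (\<Sum>k<m. b (e k)) - (\<Sum>k<n. b (e k))" if "n \<le> m" for m n
    proof -
      have split: "(\<Sum>k<m. f k) - (\<Sum>k<n. f k) = (\<Sum>k\<in>{n..<m}. f k)" for f :: "nat \<Rightarrow> 'c::ab_group_add"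
        using sum_diff_nat_ivl[of 0 n m f] that by (simp add: atLeast0LessThan)
      have "nrm (\<lambda>\<phi>. P m \<phi> - P n \<phi>) \<le> (\<Sum>k\<in>{n..<m}. nrm (U (e k)))"
        unfolding P_def split using complex_banach_on_sum[OF X, of "{n..<m}" "\<lambda>k. U (e k)"] U by simp
      also have "\<dots> \<le> (\<Sum>k\<in>{n..<m}. b (e k))" by (intro sum_mono b)
      finally show ?thesis unfolding split .
    qed
    have sym: "nrm (\<lambda>\<phi>. P m \<phi> - P n \<phi>) = nrm (\<lambda>\<phi>. P n \<phi> - P m \<phi>)"
      using D(6)[OF complex_banach_on_diff[OF X PX[of n] PX[of m]], of "- 1"] by simp
    show ?thesis using le[of n m] le[of m n] sym by (cases "n \<le> m") auto
  qed
  have "\<forall>\<epsilon>>0. \<exists>N. \<forall>m\<ge>N. \<forall>n\<ge>N. nrm (\<lambda>\<phi>. P m \<phi> - P n \<phi>) < \<epsilon>"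
  proof (intro allI impI)
    fix \<epsilon> :: real assume "\<epsilon> > 0"
    have "Cauchy (\<lambda>n. \<Sum>k<n. b (e k))"
      using bsums unfolding sums_def by (rule LIMSEQ_imp_Cauchy)
    from metric_CauchyD[OF this \<open>\<epsilon> > 0\<close>]
    obtain N where "\<forall>m\<ge>N. \<forall>n\<ge>N. \<bar>(\<Sum>k<m. b (e k)) - (\<Sum>k<n. b (e k))\<bar> < \<epsilon>"
      unfolding dist_real_def by blast
    then show "\<exists>N. \<forall>m\<ge>N. \<forall>n\<ge>N. nrm (\<lambda>\<phi>. P m \<phi> - P n \<phi>) < \<epsilon>"
      using tail le_less_trans by blast
  qed
  then have "\<exists>w\<in>X. (\<lambda>n. nrm (\<lambda>\<phi>. P n \<phi> - w \<phi>)) \<longlonglongrightarrow> 0"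
    using X[unfolded complex_banach_on_def, THEN conjunct2, THEN conjunct2, THEN conjunct2, THEN conjunct2,
        THEN conjunct2, THEN conjunct2, THEN spec, of P] PX by blast
  then obtain w where w: "w \<in> X" and lim: "(\<lambda>n. nrm (\<lambda>\<phi>. P n \<phi> - w \<phi>)) \<longlonglongrightarrow> 0" by blast
  have "w \<phi> = (\<Sum>\<^sub>\<infinity>i. U i \<phi>)" for \<phi>
  proof -
    obtain K where K: "\<forall>u\<in>X. cmod (u \<phi>) \<le> K * nrm u" using ev by blast
    have "(\<lambda>n. P n \<phi> - w \<phi>) \<longlonglongrightarrow> 0"
    proof (rule Lim_null_comparison)
      show "(\<lambda>n. K * nrm (\<lambda>\<phi>. P n \<phi> - w \<phi>)) \<longlonglongrightarrow> 0" using tendsto_mult_right_zero[OF lim] by blast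
      show "\<forall>\<^sub>F n in sequentially. norm (P n \<phi> - w \<phi>) \<le> K * nrm (\<lambda>\<phi>. P n \<phi> - w \<phi>)"
        by (intro always_eventually allI K[rule_format, OF complex_banach_on_diff[OF X PX w]])
    qed
    then have "(\<lambda>n. P n \<phi>) \<longlonglongrightarrow> w \<phi>" by (rule LIM_zero_cancel)
    moreover have "((\<lambda>n. U (e n) \<phi>) has_sum (\<Sum>\<^sub>\<infinity>i. U i \<phi>)) UNIV"
      using has_sum_reindex_bij_betw[OF e, of "\<lambda>i. U i \<phi>"] abs_summable_summable[OF abs] by simp
    then have "(\<lambda>n. P n \<phi>) \<longlonglongrightarrow> (\<Sum>\<^sub>\<infinity>i. U i \<phi>)"
      using has_sum_imp_sums unfolding sums_def P_def by blast
    ultimately show ?thesis by (rule LIMSEQ_unique)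
  qed
  then have weq: "w = (\<lambda>\<phi>. \<Sum>\<^sub>\<infinity>i. U i \<phi>)" by blast
  then show "(\<lambda>\<phi>. \<Sum>\<^sub>\<infinity>i. U i \<phi>) \<in> X" using w by simp
  have "nrm w \<le> (\<Sum>\<^sub>\<infinity>i. b i) + nrm (\<lambda>\<phi>. P n \<phi> - w \<phi>)" for n
  proof -
    have "nrm w = nrm (\<lambda>\<phi>. P n \<phi> + (- 1) * (P n \<phi> - w \<phi>))" by (rule arg_cong[where f=nrm]) auto
    also have "\<dots> \<le> nrm (P n) + nrm (\<lambda>\<phi>. (- 1) * (P n \<phi> - w \<phi>))"
      by (intro D(7) D(3) PX complex_banach_on_diff[OF X] w)
    also have "nrm (\<lambda>\<phi>. (- 1) * (P n \<phi> - w \<phi>)) = nrm (\<lambda>\<phi>. P n \<phi> - w \<phi>)"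
      using D(6)[OF complex_banach_on_diff[OF X PX[of n] w], of "- 1"] by simp
    finally show ?thesis using Pn[of n] by linarith
  qed
  then have "nrm w \<le> (\<Sum>\<^sub>\<infinity>i. b i) + 0"
    by (intro LIMSEQ_le_const[OF tendsto_add[OF tendsto_const lim]]) auto
  then show "nrm (\<lambda>\<phi>. \<Sum>\<^sub>\<infinity>i. U i \<phi>) \<le> (\<Sum>\<^sub>\<infinity>i. b i)" unfolding weq by simp
qed

theorem proposition4p3:
  fixes X :: "'d::finite functional set"
    and nrm :: "'d functional \<Rightarrow> real"
    and s C :: real
    and v :: "real^('d + 'd) \<Rightarrow> real"
    and g \<gamma> :: "real^'d \<Rightarrow> complex"
    and L :: "real^('d + 'd)^('d + 'd)"
    and \<sigma> :: real
  assumes "banach_between X nrm"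
    and "s \<ge> 0" and "v = poly_weight s" and "C > 0"
    and "tf_invariant X nrm v C"
    and "g \<in> borel_measurable lebesgue" and "\<gamma> \<in> borel_measurable lebesgue"
    and "integrable lebesgue \<gamma>"
    and "fourier_in_L1 g"
    and "invertible L"
    and "(\<lambda>\<kappa>. v (adjoint_point L \<kappa>) * cmod (stft g \<gamma> (adjoint_point L \<kappa>))) summable_on UNIV"
    and "\<sigma> = (\<Sum>\<^sub>\<infinity>\<kappa>. v (adjoint_point L \<kappa>) * cmod (stft g \<gamma> (adjoint_point L \<kappa>)))"
  shows "\<exists>S \<in> bounded_operators X nrm.
           (\<forall>u. schwartz u \<longrightarrow> gabor_sums L g \<gamma> u (S (dist_of u))) \<and>
           operator_norm X nrm S \<le> C / \<bar>det L\<bar> * \<sigma>"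
proof -
  have X: "complex_banach_on X nrm" and XT: "X \<subseteq> tempered_dists"
    and ev: "\<And>\<phi>. schwartz \<phi> \<Longrightarrow> \<exists>K. \<forall>u\<in>X. cmod (u \<phi>) \<le> K * nrm u"
    and SX: "\<And>f. schwartz f \<Longrightarrow> dist_of f \<in> X"
    using assms(1) unfolding banach_between_def by blast+
  note D = complex_banach_onD[OF X]
  have ev': "\<exists>K. \<forall>u\<in>X. cmod (u \<phi>) \<le> K * nrm u" for \<phi>
  proof (cases "schwartz \<phi>")
    case False
    then have "u \<phi> = 0" if "u \<in> X" for u using XT that unfolding tempered_dists_def by blast
    then show ?thesis by (intro exI[of _ 0]) simp
  qed (rule ev)
  have tfX: "tf_shift_dist z u \<in> X" and tfn: "nrm (tf_shift_dist z u) \<le> C * v z * nrm u" if "u \<in> X" for u z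
    using assms(5) that unfolding tf_invariant_def by blast+
  \<comment> \<open>The weight may be dropped from the summability hypothesis, as the Janssen representation requires.\<close>
  have v1: "1 \<le> v z" for z
    unfolding assms(3) poly_weight_def using assms(2) by (intro ge_one_powr_ge_zero) auto
  define \<delta> where "\<delta> = \<bar>det L\<bar>"
  have \<delta>: "\<delta> > 0" using assms(10) by (simp add: \<delta>_def invertible_det_nz)
  define z where "z \<kappa> = adjoint_point L \<kappa>" for \<kappa>
  \<comment> \<open>The operator is defined on all of \<open>X\<close> by the series of the Janssen representation.\<close>
  define a where "a \<kappa> = stft g \<gamma> (z \<kappa>) / of_real \<delta>" for \<kappa>
  let ?b = "\<lambda>\<kappa>. v (z \<kappa>) * cmod (stft g \<gamma> (z \<kappa>))"
  have bs: "?b summable_on UNIV" and \<sigma>: "\<sigma> = (\<Sum>\<^sub>\<infinity>\<kappa>. ?b \<kappa>)" using assms(11,12) by (simp_all add: z_def)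
  define S where "S u = (\<lambda>\<phi>. \<Sum>\<^sub>\<infinity>\<kappa>. a \<kappa> * tf_shift_dist (z \<kappa>) u \<phi>)" for u :: "'d functional"
  have summand: "(\<lambda>\<phi>. a \<kappa> * tf_shift_dist (z \<kappa>) u \<phi>) \<in> X"
    "nrm (\<lambda>\<phi>. a \<kappa> * tf_shift_dist (z \<kappa>) u \<phi>) \<le> ?b \<kappa> * (C / \<delta> * nrm u)" if u: "u \<in> X" for u \<kappa>
  proof -
    show "(\<lambda>\<phi>. a \<kappa> * tf_shift_dist (z \<kappa>) u \<phi>) \<in> X" by (intro D(3) tfX u)
    have "nrm (\<lambda>\<phi>. a \<kappa> * tf_shift_dist (z \<kappa>) u \<phi>) = cmod (a \<kappa>) * nrm (tf_shift_dist (z \<kappa>) u)"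
      by (intro D(6) tfX u)
    also have "\<dots> \<le> cmod (a \<kappa>) * (C * v (z \<kappa>) * nrm u)" by (intro mult_left_mono tfn u) simp
    also have "\<dots> = ?b \<kappa> * (C / \<delta> * nrm u)" using \<delta> by (simp add: a_def norm_divide)
    finally show "nrm (\<lambda>\<phi>. a \<kappa> * tf_shift_dist (z \<kappa>) u \<phi>) \<le> ?b \<kappa> * (C / \<delta> * nrm u)" .
  qed
  have sm: "(\<lambda>\<kappa>. ?b \<kappa> * (C / \<delta> * nrm u)) summable_on UNIV" for u by (rule summable_on_cmult_left[OF bs])
  have SX': "S u \<in> X" and Sn: "nrm (S u) \<le> C / \<delta> * \<sigma> * nrm u"
    and Ssm: "(\<lambda>\<kappa>. a \<kappa> * tf_shift_dist (z \<kappa>) u \<phi>) summable_on UNIV" if u: "u \<in> X" for u \<phi>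
  proof -
    let ?U = "\<lambda>\<kappa> \<phi>. a \<kappa> * tf_shift_dist (z \<kappa>) u \<phi>"
    let ?b' = "\<lambda>\<kappa>. ?b \<kappa> * (C / \<delta> * nrm u)"
    have UX: "?U \<kappa> \<in> X" and Ub: "nrm (?U \<kappa>) \<le> ?b' \<kappa>" for \<kappa> using summand[OF u, of \<kappa>] by blast+
    have countable: "countable (UNIV :: (int^('d + 'd)) set)" by (rule countableI_type)
    note series = absolutely_convergent_series[of X nrm ?U ?b', OF infinite_int_vec countable X]
    show "S u \<in> X" unfolding S_def by (rule series(1)) (fact ev' UX Ub sm)+
    show "(\<lambda>\<kappa>. ?U \<kappa> \<phi>) summable_on UNIV" by (rule series(3)) (fact ev' UX Ub sm)+
    have "nrm (S u) \<le> (\<Sum>\<^sub>\<infinity>\<kappa>. ?b' \<kappa>)" unfolding S_def by (rule series(2)) (fact ev' UX Ub sm)+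
    also have "\<dots> = C / \<delta> * \<sigma> * nrm u" unfolding infsum_cmult_left' \<sigma> by (simp only: mult_ac)
    finally show "nrm (S u) \<le> C / \<delta> * \<sigma> * nrm u" .
  qed
  have \<sigma>0: "0 \<le> C / \<delta> * \<sigma>"
    unfolding \<sigma> using assms(4) \<delta> order_trans[OF zero_le_one v1]
    by (intro mult_nonneg_nonneg infsum_nonneg divide_nonneg_pos) auto
  have "S \<in> bounded_operators X nrm"
    unfolding bounded_operators_def
  proof (intro CollectI conjI ballI allI exI)
    fix u assume u: "u \<in> X"
    show "S u \<in> X" by (rule SX'[OF u])
    show "nrm (S u) \<le> C / \<delta> * \<sigma> * nrm u" by (rule Sn[OF u])
    show "S (\<lambda>\<phi>. c * u \<phi>) = (\<lambda>\<phi>. c * S u \<phi>)" for c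
      unfolding S_def infsum_cmult_right'[symmetric]
      by (simp add: tf_shift_dist_def modulation_dist_def translation_dist_def mult.left_commute)
    fix w assume w: "w \<in> X"
    show "S (\<lambda>\<phi>. u \<phi> + w \<phi>) = (\<lambda>\<phi>. S u \<phi> + S w \<phi>)"
    proof
      fix \<phi>
      have "S (\<lambda>\<phi>. u \<phi> + w \<phi>) \<phi> = (\<Sum>\<^sub>\<infinity>\<kappa>. a \<kappa> * tf_shift_dist (z \<kappa>) u \<phi> + a \<kappa> * tf_shift_dist (z \<kappa>) w \<phi>)"
        by (simp add: S_def tf_shift_dist_def modulation_dist_def translation_dist_def distrib_left)
      also have "\<dots> = S u \<phi> + S w \<phi>" unfolding S_def by (rule infsum_add[OF Ssm[OF u] Ssm[OF w]])
      finally show "S (\<lambda>\<phi>. u \<phi> + w \<phi>) \<phi> = S u \<phi> + S w \<phi>" .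
    qed
  qed
  moreover have "gabor_sums L g \<gamma> u (S (dist_of u))" if u: "schwartz u" for u
    unfolding gabor_sums_def
  proof (intro conjI allI impI)
    show "S (dist_of u) \<in> tempered_dists" using SX'[OF SX[OF u]] XT by blast
    fix \<phi> :: "'d cfun" assume \<phi>: "schwartz \<phi>"
    have "(\<lambda>\<kappa>. cmod (stft g \<gamma> (adjoint_point L \<kappa>))) summable_on UNIV"
    proof (rule summable_on_comparison_test[OF assms(11)])
      show "cmod (stft g \<gamma> (adjoint_point L \<kappa>)) \<le> v (adjoint_point L \<kappa>) * cmod (stft g \<gamma> (adjoint_point L \<kappa>))" for \<kappa>
        using mult_right_mono[OF v1[of "adjoint_point L \<kappa>"] norm_ge_zero[of "stft g \<gamma> (adjoint_point L \<kappa>)"]] by simp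
    qed simp
    from janssen_representation[OF assms(8,9,10) u \<phi> this]
    show "((\<lambda>\<kappa>. L2_product u (tf_shift (- (L *v int_vec \<kappa>)) g) * dist_of (tf_shift (- (L *v int_vec \<kappa>)) \<gamma>) \<phi>)
        has_sum S (dist_of u) \<phi>) UNIV"
      by (simp add: S_def a_def z_def \<delta>_def)
  qed
  moreover have "operator_norm X nrm S \<le> C / \<bar>det L\<bar> * \<sigma>"
    unfolding operator_norm_def \<delta>_def[symmetric]
  proof (rule cSUP_least)
    have "(\<lambda>\<phi>. 0) \<in> {u \<in> X. nrm u \<le> 1}" using D(1,5) by simp
    then show "{u \<in> X. nrm u \<le> 1} \<noteq> {}" by blast
    fix u assume "u \<in> {u \<in> X. nrm u \<le> 1}"
    then have u: "u \<in> X" "nrm u \<le> 1" by auto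
    have "nrm (S u) \<le> C / \<delta> * \<sigma> * nrm u" by (rule Sn[OF u(1)])
    also have "\<dots> \<le> C / \<delta> * \<sigma> * 1" by (intro mult_left_mono u(2) \<sigma>0)
    finally show "nrm (S u) \<le> C / \<delta> * \<sigma>" by simp
  qed
  ultimately show ?thesis by blast
qed

end
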